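(* Let $M$ be a matroid of rank $d+1$ on $E$, let $i\in E$ be such that $\{i\}$ is a flat of $M$ and $i$ is not a coloop. Let $S_i=\{F_1,\ldots,F_k\}$ and the fan $\Delta_k$ be as in the context, and let $\operatorname{Vol}_{M\setminus i}(x_G)_{G\in\mathcal{L}^{nt}(M\setminus i)}$ be the mixed volume of the deletion $M\setminus i$. Suppose real numbers $b_{\overline G}$ satisfy $\partial_i=\sum_{G\in\mathcal{L}^{nt}(M\setminus i)}b_{\overline G}\partial_{\overline G}$ in $\operatorname{CH}(\Delta_k)$. Then the mixed volume of $\Delta_k$ (for the Minkowski weight equal to $1$ on every maximal cone) is obtained by substituting $x_{\overline G}+b_{\overline G}x_i$ for $x_G$: \[\operatorname{Vol}_{\Delta_k}=\operatorname{Vol}_{M\setminus i}(x_{\overline G}+b_{\overline G}x_i).\]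
   Context: Matroid notation: $\mathcal{L}(M)$ is the lattice of flats, $\mathcal{L}^{nt}(M)=\mathcal{L}(M)\setminus\{\emptyset,E\}$. The deletion $M\setminus i$ is the matroid on $E\setminus i$ whose flats are $F\setminus i$ for $F\in\mathcal{L}(M)$; $i$ is a coloop if $M\setminus i$ has smaller rank than $M$. For a flat $G$ of $M\setminus i$, $\overline G$ is its closure in $M$. The set $S_i$ consists of all $F\subseteq E$ such that $F$ and $F\cup i$ are distinct nontrivial flats of $M$, totally ordered as $F_1,\ldots,F_k$ refining inclusion. The fan $\Delta_k$: its rays are the equivalence classes of $\mathcal{L}^{nt}(M)$ under the relation identifying $F_l$ with $F_l\cup i$ for $l=1,\ldots,k$ (all other classes are singletons), and its cones are the images of chains of $\mathcal{L}^{nt}(M)$; it is embedded in $\mathbb{R}^E/\mathbb{R}e_E$ by sending the class $\{F_l,F_l\cup i\}$ to $e_{F_l}$ and a singleton class $\{F\}$ to $e_F$, where $e_F=\sum_{a\in F}e_a$. The rays of $\Delta_k$ other than $\{i\}$ are in bijection with $\mathcal{L}^{nt}(M\setminus i)$, the ray for $G$ being the class containing $\overline G$; accordingly $\operatorname{Vol}_{\Delta_k}$ has variables $x_i$ and $x_{\overline G}$, and $\partial_{\overline G}$ denotes the corresponding generator. For any such fan in $\mathbb{R}^n$ (abstract simplicial fan with ray vectors, linearly independent on each cone): $\operatorname{CH}(\Delta)$ is the Stanley–Reisner ring $\mathbb{R}[\partial_\rho]/(\text{square-free monomials of rays not in a common cone})$ modulo the linear forms $\sum_\rho \ell(v_\rho)\partial_\rho$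 for global linear functions $\ell$; the mixed volume for a Minkowski weight $w$ (here $w\equiv 1$ on maximal cones, with $\phi(\partial_\sigma)=1$ for each maximal cone $\sigma$) is the unique homogeneous degree $d$ polynomial $V$ in the variables $x_\rho$ with $f(\partial/\partial x_\rho)V=\phi(\text{class of }f)$ for all degree $d$ polynomials $f$, where $\phi:\operatorname{CH}^d\to\mathbb{R}$ is linear with $\phi(\partial_\sigma)=w_\sigma$. The mixed volume of a matroid is that of its Bergman fan (rays $e_F$, $F$ nontrivial flat; cones = chains) with weight $1$. *)

theory Defs
  imports
    Complex_Main
    "HOL-Library.Poly_Mapping"
    "HOL-Library.Indicator_Function"
    "HOL-Algebra.QuotRing"
begin

section \<open>Matroids, given by their flats\<close>

locale matroid =
  fixes E :: "'a set" and L :: "'a set set"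
  assumes finite_ground: "finite E"
    and flats_subset: "F \<in> L \<Longrightarrow> F \<subseteq> E"
    and ground_flat: "E \<in> L"
    and inter_flat: "F \<in> L \<Longrightarrow> G \<in> L \<Longrightarrow> F \<inter> G \<in> L"
    and cover_partition:
      "F \<in> L \<Longrightarrow> a \<in> E - F \<Longrightarrow>
        \<exists>!G. G \<in> L \<and> F \<subset> G \<and> \<not> (\<exists>H\<in>L. F \<subset> H \<and> H \<subset> G) \<and> a \<in> G"

definition matroid_rank :: "'a set set \<Rightarrow> nat" where
  "matroid_rank L = Max (card ` chains L) - 1"

definition nontrivial_flats :: "'a set \<Rightarrow> 'a set set \<Rightarrow> 'a set set" where
  "nontrivial_flats E L = L - {{}, E}"

definition flat_closure :: "'a set set \<Rightarrow> 'a set \<Rightarrow> 'a set" where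
  "flat_closure L A = \<Inter> {F \<in> L. A \<subseteq> F}"

text \<open>The flats of the deletion of \<open>i\<close>; its ground set is \<open>E - {i}\<close>.\<close>

definition deletion_flats :: "'a set set \<Rightarrow> 'a \<Rightarrow> 'a set set" where
  "deletion_flats L i = (\<lambda>F. F - {i}) ` L"

definition is_coloop :: "'a set set \<Rightarrow> 'a \<Rightarrow> bool" where
  "is_coloop L i \<longleftrightarrow> matroid_rank (deletion_flats L i) < matroid_rank L"


section \<open>Polynomials in variables indexed by an arbitrary type\<close>

text \<open>A monomial is its exponent function; multiplication is convolution.\<close>

type_synonym 'v poly = "('v \<Rightarrow>\<^sub>0 nat) \<Rightarrow>\<^sub>0 real"

definition Var :: "'v \<Rightarrow> 'v poly" where
  "Var v = Poly_Mapping.single (Poly_Mapping.single v 1) 1"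

definition Const :: "real \<Rightarrow> 'v poly" where
  "Const c = Poly_Mapping.single 0 c"

definition poly_vars :: "'v poly \<Rightarrow> 'v set" where
  "poly_vars p = (\<Union>m\<in>Poly_Mapping.keys p. Poly_Mapping.keys m)"

definition homogeneous :: "nat \<Rightarrow> 'v poly \<Rightarrow> bool" where
  "homogeneous d p \<longleftrightarrow>
    (\<forall>m\<in>Poly_Mapping.keys p. (\<Sum>v\<in>Poly_Mapping.keys m. Poly_Mapping.lookup m v) = d)"

definition poly_subst :: "('v \<Rightarrow> 'w poly) \<Rightarrow> 'v poly \<Rightarrow> 'w poly" where
  "poly_subst s p =
    (\<Sum>m\<in>Poly_Mapping.keys p. Const (Poly_Mapping.lookup p m) *
      (\<Prod>v\<in>Poly_Mapping.keys m. s v ^ Poly_Mapping.lookup m v))"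

definition partial_deriv :: "'v \<Rightarrow> 'v poly \<Rightarrow> 'v poly" where
  "partial_deriv v p =
    (\<Sum>m\<in>Poly_Mapping.keys p. Poly_Mapping.single (m - Poly_Mapping.single v 1)
      (real (Poly_Mapping.lookup m v) * Poly_Mapping.lookup p m))"

text \<open>
  \<open>diff_op f V\<close> is \<open>f(\<partial>/\<partial>x) V\<close>. The order in which the fold applies the partial
  derivatives is immaterial since they commute (\<open>partial_deriv_commute\<close>).
\<close>

definition diff_monomial :: "('v \<Rightarrow>\<^sub>0 nat) \<Rightarrow> 'v poly \<Rightarrow> 'v poly" where
  "diff_monomial m V =
    Finite_Set.fold (\<lambda>v. partial_deriv v ^^ Poly_Mapping.lookup m v) V (Poly_Mapping.keys m)"

definition diff_op :: "'v poly \<Rightarrow> 'v poly \<Rightarrow> 'v poly" where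
  "diff_op f V =
    (\<Sum>m\<in>Poly_Mapping.keys f. Const (Poly_Mapping.lookup f m) * diff_monomial m V)"

lemma lookup_partial_deriv:
  "Poly_Mapping.lookup (partial_deriv v p) n =
    real (Suc (Poly_Mapping.lookup n v)) *
      Poly_Mapping.lookup p (n + Poly_Mapping.single v 1)"
proof -
  let ?k = "n + Poly_Mapping.single v (1::nat)"
  have eq: "(m - Poly_Mapping.single v 1 = n \<and> Poly_Mapping.lookup m v \<noteq> 0) \<longleftrightarrow> m = ?k"
    for m :: "'a \<Rightarrow>\<^sub>0 nat"
    by (auto simp: poly_mapping_eq_iff fun_eq_iff lookup_minus lookup_add lookup_single when_def
        split: if_splits)
  have "Poly_Mapping.lookup (partial_deriv v p) n =
    (\<Sum>m\<in>Poly_Mapping.keys p. if m = ?k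
      then real (Poly_Mapping.lookup m v) * Poly_Mapping.lookup p m else 0)"
    unfolding partial_deriv_def lookup_sum
  proof (rule sum.cong[OF refl])
    fix m
    show "Poly_Mapping.lookup (Poly_Mapping.single (m - Poly_Mapping.single v 1)
        (real (Poly_Mapping.lookup m v) * Poly_Mapping.lookup p m)) n =
      (if m = ?k then real (Poly_Mapping.lookup m v) * Poly_Mapping.lookup p m else 0)"
      using eq[of m] by (cases "Poly_Mapping.lookup m v = 0") (auto simp: lookup_single when_def)
  qed
  also have "\<dots> = real (Suc (Poly_Mapping.lookup n v)) * Poly_Mapping.lookup p ?k"
    by (simp add: sum.delta' in_keys_iff lookup_add lookup_single)
  finally show ?thesis .
qed

lemma partial_deriv_commute:
  "partial_deriv u (partial_deriv v p) = partial_deriv v (partial_deriv u p)"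
  by (cases "u = v")
    (auto simp: poly_mapping_eq_iff fun_eq_iff lookup_partial_deriv lookup_add lookup_single
      ac_simps)


section \<open>Simplicial fans, Chow rings and mixed volumes\<close>

text \<open>
  A simplicial fan in \<open>\<real>\<^sup>E / \<real>e\<^sub>E\<close>. A cone is recorded by its set of rays, and \<open>ray_vector\<close>
  gives representatives in \<open>\<real>\<^sup>E\<close>, i.e. functions vanishing outside \<open>E\<close>.
\<close>

record ('r, 'a) fan =
  ground :: "'a set"
  rays :: "'r set"
  cones :: "'r set set"
  ray_vector :: "'r \<Rightarrow> 'a \<Rightarrow> real"

definition maximal_cones :: "('r, 'a) fan \<Rightarrow> 'r set set" where
  "maximal_cones \<Delta> = {\<sigma> \<in> cones \<Delta>. \<not> (\<exists>\<tau>\<in>cones \<Delta>. \<sigma> \<subset> \<tau>)}"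

text \<open>
  Linear functions on \<open>\<real>\<^sup>E / \<real>e\<^sub>E\<close>, as linear functions that vanish on \<open>e\<^sub>E\<close>. They are only
  ever applied to vectors supported on \<open>E\<close>, so their values elsewhere are irrelevant.
\<close>

definition global_linear :: "'a set \<Rightarrow> (('a \<Rightarrow> real) \<Rightarrow> real) set" where
  "global_linear E = {l.
    (\<forall>u v. l (\<lambda>a. u a + v a) = l u + l v) \<and>
    (\<forall>c u. l (\<lambda>a. c * u a) = c * l u) \<and>
    l (indicator E) = 0}"

definition ray_poly_ring :: "('r, 'a) fan \<Rightarrow> 'r poly ring" where
  "ray_poly_ring \<Delta> =
    \<lparr>carrier = {p. poly_vars p \<subseteq> rays \<Delta>}, mult = (*), one = 1, zero = 0, add = (+)\<rparr>"

definition stanley_reisner_relations :: "('r, 'a) fan \<Rightarrow> 'r poly set" where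
  "stanley_reisner_relations \<Delta> =
    {\<Prod>\<rho>\<in>A. Var \<rho> | A. finite A \<and> A \<subseteq> rays \<Delta> \<and> \<not> (\<exists>\<sigma>\<in>cones \<Delta>. A \<subseteq> \<sigma>)}"

definition linear_relations :: "('r, 'a) fan \<Rightarrow> 'r poly set" where
  "linear_relations \<Delta> =
    {\<Sum>\<rho>\<in>rays \<Delta>. Const (l (ray_vector \<Delta> \<rho>)) * Var \<rho> | l. l \<in> global_linear (ground \<Delta>)}"

definition chow_ideal :: "('r, 'a) fan \<Rightarrow> 'r poly set" where
  "chow_ideal \<Delta> =
    Idl\<^bsub>ray_poly_ring \<Delta>\<^esub> (stanley_reisner_relations \<Delta> \<union> linear_relations \<Delta>)"

definition chow_ring :: "('r, 'a) fan \<Rightarrow> 'r poly set ring" where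
  "chow_ring \<Delta> = ray_poly_ring \<Delta> Quot chow_ideal \<Delta>"

definition chow_class :: "('r, 'a) fan \<Rightarrow> 'r poly \<Rightarrow> 'r poly set" where
  "chow_class \<Delta> f = chow_ideal \<Delta> +>\<^bsub>ray_poly_ring \<Delta>\<^esub> f"

definition forms :: "('r, 'a) fan \<Rightarrow> nat \<Rightarrow> 'r poly set" where
  "forms \<Delta> d = {f \<in> carrier (ray_poly_ring \<Delta>). homogeneous d f}"

definition chow_graded :: "('r, 'a) fan \<Rightarrow> nat \<Rightarrow> 'r poly set set" where
  "chow_graded \<Delta> d = chow_class \<Delta> ` forms \<Delta> d"

text \<open>
  \<open>\<phi>\<close> is linear on the degree \<open>d\<close> part of the Chow ring and restricts to the weight \<open>w\<close> on
  the classes of maximal cones.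
\<close>

definition chow_functional ::
    "('r, 'a) fan \<Rightarrow> nat \<Rightarrow> ('r set \<Rightarrow> real) \<Rightarrow> ('r poly set \<Rightarrow> real) \<Rightarrow> bool" where
  "chow_functional \<Delta> d w \<phi> \<longleftrightarrow>
    (\<forall>x\<in>chow_graded \<Delta> d. \<forall>y\<in>chow_graded \<Delta> d. \<phi> (x \<oplus>\<^bsub>chow_ring \<Delta>\<^esub> y) = \<phi> x + \<phi> y) \<and>
    (\<forall>c. \<forall>x\<in>chow_graded \<Delta> d. \<phi> (chow_class \<Delta> (Const c) \<otimes>\<^bsub>chow_ring \<Delta>\<^esub> x) = c * \<phi> x) \<and>
    (\<forall>\<sigma>\<in>maximal_cones \<Delta>. \<phi> (chow_class \<Delta> (\<Prod>\<rho>\<in>\<sigma>. Var \<rho>)) = w \<sigma>)"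

definition mixed_volume :: "('r, 'a) fan \<Rightarrow> nat \<Rightarrow> ('r set \<Rightarrow> real) \<Rightarrow> 'r poly" where
  "mixed_volume \<Delta> d w = (THE V. V \<in> forms \<Delta> d \<and>
    (\<exists>\<phi>. chow_functional \<Delta> d w \<phi> \<and>
      (\<forall>f\<in>forms \<Delta> d. diff_op f V = Const (\<phi> (chow_class \<Delta> f)))))"


section \<open>The Bergman fan and the fan \<open>\<Delta>\<^sub>k\<close>\<close>

definition bergman_fan :: "'a set \<Rightarrow> 'a set set \<Rightarrow> ('a set, 'a) fan" where
  "bergman_fan E L =
    \<lparr>ground = E,
     rays = nontrivial_flats E L,
     cones = chains (nontrivial_flats E L),
     ray_vector = indicator\<rparr>"

definition matroid_volume :: "'a set \<Rightarrow> 'a set set \<Rightarrow> 'a set poly" where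
  "matroid_volume E L = mixed_volume (bergman_fan E L) (matroid_rank L - 1) (\<lambda>_. 1)"

definition deletion_pairs :: "'a set \<Rightarrow> 'a set set \<Rightarrow> 'a \<Rightarrow> 'a set set" where
  "deletion_pairs E L i = {F. F \<subseteq> E \<and> F \<noteq> insert i F \<and>
    F \<in> nontrivial_flats E L \<and> insert i F \<in> nontrivial_flats E L}"

definition flat_equiv :: "'a set \<Rightarrow> 'a set set \<Rightarrow> 'a \<Rightarrow> ('a set \<times> 'a set) set" where
  "flat_equiv E L i = Id_on (nontrivial_flats E L) \<union>
    {(F, insert i F) | F. F \<in> deletion_pairs E L i} \<union>
    {(insert i F, F) | F. F \<in> deletion_pairs E L i}"

lemma equiv_flat_equiv: "equiv (nontrivial_flats E L) (flat_equiv E L i)"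
  unfolding flat_equiv_def deletion_pairs_def equiv_def refl_on_def sym_def trans_def
  by (auto simp: insert_ident)

definition flat_class :: "'a set \<Rightarrow> 'a set set \<Rightarrow> 'a \<Rightarrow> 'a set \<Rightarrow> 'a set set" where
  "flat_class E L i F = flat_equiv E L i `` {F}"

text \<open>
  All pairs in \<open>deletion_pairs\<close> are identified, so the fan does not depend on how they are
  ordered. The intersection of a class \<open>{F, insert i F}\<close> is \<open>F\<close> and that of a singleton
  class \<open>{F}\<close> is \<open>F\<close>, so the ray vector below is \<open>e\<^sub>F\<close> in both cases.
\<close>

definition deletion_fan :: "'a set \<Rightarrow> 'a set set \<Rightarrow> 'a \<Rightarrow> ('a set set, 'a) fan" where
  "deletion_fan E L i =
    \<lparr>ground = E,
     rays = nontrivial_flats E L // flat_equiv E L i,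
     cones = (\<lambda>C. flat_class E L i ` C) ` chains (nontrivial_flats E L),
     ray_vector = (\<lambda>c. indicator (\<Inter> c))\<rparr>"

text \<open>
  The ray corresponding to a flat \<open>G\<close> of the deletion of \<open>i\<close>.
\<close>

definition closure_ray :: "'a set \<Rightarrow> 'a set set \<Rightarrow> 'a \<Rightarrow> 'a set \<Rightarrow> 'a set set" where
  "closure_ray E L i G = flat_class E L i (flat_closure L G)"

end

theory Submission
  imports Defs
begin

text \<open>
  The weight \<open>1\<close> on the Bergman fan of the deletion is balanced, and a balanced weight on the maximal
  cones extends to a linear form on the monomials of top degree: a repeated variable is replaced, by means of a
  linear form dual to it on the cone, by variables outside the cone. The same replacement shows
  that this degree map is the only one. Sending the ray of \<open>{i}\<close> to the class of a linear form
  \<open>\<Sum>\<^sub>H ([a \<in> H] - [H is not a flat of M]) \<partial>\<^sub>H\<close> defines a map from the Chow ring of \<open>\<Delta>\<^sub>k\<close> to that of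
  the deletion. The class does not depend on \<open>a\<close>, and adapting \<open>a\<close> to a given cone shows that the map
  is well defined and that the pulled back degree map is \<open>1\<close> on every maximal cone. It is inverse to the
  map \<open>\<partial>\<^sub>G \<mapsto> \<partial>\<^sub>G\<^sub>'\<close> with \<open>G'\<close> the closure of \<open>G\<close>, so the two degree maps correspond, and the chain rule
  turns the given expression of \<open>\<partial>\<^sub>i\<close> into the substitution in the mixed volume.
\<close>

text \<open>The mixed volume is defined as the unique polynomial of its kind, so on each fan a
  degree map must exist and its values must be forced. For \<open>\<Delta>\<^sub>k\<close> the two
  halves use maps in opposite directions. Existence avoids checking balancing on
  \<open>\<Delta>\<^sub>k\<close>: the degree map of the deletion is pulled back along a map chosen
  independently of \<open>b\<close>. Its linear form is what remains when
  \<open>e_i^* - e_a^*\<close> is solved for the ray of \<open>{i}\<close>: that function is 1 on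
  this ray and \<open>[i \<in> G'] - [a \<in> G]\<close> on the ray of \<open>G'\<close>, and
  \<open>i \<in> G'\<close> says that \<open>G\<close> is not a flat of \<open>M\<close>. Uniqueness
  uses the given relation: every class on \<open>\<Delta>\<^sub>k\<close> comes from the deletion,
  and a degree map pulled back to the deletion again has weight 1. The numbers \<open>b\<close> may
  differ from the coefficients of the linear form above; the forced values show that this does not
  affect the result. That \<open>i\<close> is not a coloop enters twice: both matroids have the same
  rank, so the degree is \<open>d\<close> on both sides, and \<open>E - {i}\<close> is not a flat,
  so every chain of the deletion, with both ends added, passes from flats of \<open>M\<close> to
  sets that are not flats of \<open>M\<close>.\<close>

definition mdeg :: "('v \<Rightarrow>\<^sub>0 nat) \<Rightarrow> nat" where
  "mdeg m = (\<Sum>v\<in>Poly_Mapping.keys m. Poly_Mapping.lookup m v)"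

definition mon_eval :: "('v \<Rightarrow> 'b::comm_monoid_mult) \<Rightarrow> ('v \<Rightarrow>\<^sub>0 nat) \<Rightarrow> 'b" where
  "mon_eval s m = (\<Prod>v\<in>Poly_Mapping.keys m. s v ^ Poly_Mapping.lookup m v)"

lemma keys_add_nat: "Poly_Mapping.keys (m + n) = Poly_Mapping.keys m \<union> Poly_Mapping.keys n"
  for m n :: "'v \<Rightarrow>\<^sub>0 nat"
  by (auto simp: in_keys_iff lookup_add)

lemma mdeg_superset:
  assumes "finite A" "Poly_Mapping.keys m \<subseteq> A"
  shows "mdeg m = (\<Sum>v\<in>A. Poly_Mapping.lookup m v)"
  unfolding mdeg_def by (rule sum.mono_neutral_left) (use assms in \<open>auto simp: in_keys_iff\<close>)

lemma mon_eval_superset: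
  assumes "finite A" "Poly_Mapping.keys m \<subseteq> A"
  shows "mon_eval s m = (\<Prod>v\<in>A. s v ^ Poly_Mapping.lookup m v)"
  unfolding mon_eval_def by (rule prod.mono_neutral_left) (use assms in \<open>auto simp: in_keys_iff\<close>)

lemma mdeg_add: "mdeg (m + n) = mdeg m + mdeg n"
proof -
  let ?A = "Poly_Mapping.keys m \<union> Poly_Mapping.keys n"
  show ?thesis
    by (simp add: mdeg_superset[of ?A] keys_add_nat lookup_add sum.distrib)
qed

lemma mon_eval_add: "mon_eval s (m + n) = mon_eval s m * mon_eval s n"
proof -
  let ?A = "Poly_Mapping.keys m \<union> Poly_Mapping.keys n"
  show ?thesis
    by (simp add: mon_eval_superset[of ?A] keys_add_nat lookup_add power_add prod.distrib)
qed

lemma mdeg_zero [simp]: "mdeg 0 = 0"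
  by (simp add: mdeg_def)

lemma mdeg_single [simp]: "mdeg (Poly_Mapping.single v k) = k"
  by (simp add: mdeg_def)

lemma mon_eval_zero [simp]: "mon_eval s 0 = 1"
  by (simp add: mon_eval_def)

lemma mon_eval_single [simp]: "mon_eval s (Poly_Mapping.single v k) = s v ^ k"
  by (simp add: mon_eval_def)

lemma mdeg_eq_0_iff [simp]: "mdeg m = 0 \<longleftrightarrow> m = 0"
  by (auto simp: mdeg_def poly_mapping_eq_iff fun_eq_iff in_keys_iff)

lemma card_keys_le_mdeg: "card (Poly_Mapping.keys m) \<le> mdeg m"
proof -
  have "card (Poly_Mapping.keys m) = (\<Sum>v\<in>Poly_Mapping.keys m. 1)" by simp
  also have "\<dots> \<le> mdeg m" unfolding mdeg_def
    by (rule sum_mono) (auto simp: in_keys_iff)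
  finally show ?thesis .
qed

lemma exists_lookup_ge_2:
  assumes "card (Poly_Mapping.keys m) < mdeg m"
  shows "\<exists>v. Poly_Mapping.lookup m v \<ge> 2"
proof (rule ccontr)
  assume "\<not> ?thesis"
  then have "Poly_Mapping.lookup m v \<le> 1" for v by (metis not_less_eq_eq one_add_one plus_1_eq_Suc)
  then have "mdeg m \<le> (\<Sum>v\<in>Poly_Mapping.keys m. 1)" unfolding mdeg_def by (intro sum_mono) auto
  then show False using assms by simp
qed

definition mon_of_set :: "'v set \<Rightarrow> 'v \<Rightarrow>\<^sub>0 nat" where
  "mon_of_set A = (\<Sum>v\<in>A. Poly_Mapping.single v 1)"

lemma lookup_mon_of_set: "finite A \<Longrightarrow> Poly_Mapping.lookup (mon_of_set A) v = (if v \<in> A then 1 else 0)"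
  by (simp add: mon_of_set_def lookup_sum lookup_single when_def)

lemma keys_mon_of_set: "finite A \<Longrightarrow> Poly_Mapping.keys (mon_of_set A) = A"
  by (auto simp: in_keys_iff lookup_mon_of_set split: if_splits)

lemma mdeg_mon_of_set: "finite A \<Longrightarrow> mdeg (mon_of_set A) = card A"
  by (simp add: mdeg_def keys_mon_of_set lookup_mon_of_set)

text \<open>An exponent above 1 would make the degree exceed the number of variables.\<close>

lemma eq_mon_of_set_keys:
  assumes "card (Poly_Mapping.keys m) = mdeg m"
  shows "m = mon_of_set (Poly_Mapping.keys m)"
proof -
  have "Poly_Mapping.lookup m v = 1" if "v \<in> Poly_Mapping.keys m" for v
  proof (rule ccontr)
    assume "Poly_Mapping.lookup m v \<noteq> 1"
    then have gt: "1 < Poly_Mapping.lookup m v" using that by (auto simp: in_keys_iff)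
    have "(\<Sum>v\<in>Poly_Mapping.keys m. 1) < mdeg m" unfolding mdeg_def
      by (rule sum_strict_mono_ex1) (use gt that in \<open>auto simp: in_keys_iff Suc_le_eq\<close>)
    then show False using assms by simp
  qed
  then show ?thesis by (intro poly_mapping_eqI) (auto simp: lookup_mon_of_set in_keys_iff)
qed

section \<open>Polynomials as sums of monomials: induction and linear functionals\<close>

lemma poly_single_sum:
  fixes p :: "'a \<Rightarrow>\<^sub>0 'b::comm_monoid_add"
  shows "p = (\<Sum>m\<in>Poly_Mapping.keys p. Poly_Mapping.single m (Poly_Mapping.lookup p m))"
  by (rule poly_mapping_eqI) (auto simp: lookup_sum lookup_single when_def in_keys_iff)

lemma poly_induct_single [case_names single add]:
  fixes p :: "'a \<Rightarrow>\<^sub>0 'b::comm_monoid_add"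
  assumes single: "\<And>m c. P (Poly_Mapping.single m c)"
    and add: "\<And>p q. P p \<Longrightarrow> P q \<Longrightarrow> P (p + q)"
  shows "P p"
proof -
  \<comment> \<open>The zero polynomial is a monomial with coefficient 0, which saves a separate
    case.\<close>
  have z: "P 0" using single[of undefined 0] by simp
  have "finite A \<Longrightarrow> P (\<Sum>m\<in>A. Poly_Mapping.single m (Poly_Mapping.lookup p m))" for A
    by (induction A rule: finite_induct) (auto simp: z intro: add single)
  then show ?thesis using poly_single_sum[of p] by (metis finite_keys)
qed

lemma Const_0 [simp]: "Const 0 = 0"
  and Const_1 [simp]: "Const 1 = 1"
  by (simp_all add: Const_def)

lemma Const_add: "Const (a + b) = Const a + Const b"
  by (simp add: Const_def single_add)

lemma Const_mult: "Const (a * b) = Const a * Const b"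
  by (simp add: Const_def mult_single)

lemma Const_minus: "Const (- a) = - Const a"
  by (simp add: Const_def single_uminus)

lemma Const_times_single: "Const a * Poly_Mapping.single m b = Poly_Mapping.single m (a * b)"
  by (simp add: Const_def mult_single)

lemma lookup_Const_times [simp]:
  "Poly_Mapping.lookup (Const c * p) m = c * Poly_Mapping.lookup p m"
proof (induction p rule: poly_induct_single)
  case (single n a)
  then show ?case by (simp add: Const_times_single lookup_single when_def)
next
  case (add p q)
  then show ?case by (simp add: distrib_left lookup_add)
qed

lemma single_eq_Const_mon: "Poly_Mapping.single m c = Const c * mon_eval Var m"
proof -
  have *: "Var v ^ k = (Poly_Mapping.single (Poly_Mapping.single v k) 1 :: 'a poly)" for v k
    by (induction k) (auto simp: Var_def mult_single simp flip: single_add)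
  have "finite A \<Longrightarrow> (\<Prod>v\<in>A. Var v ^ Poly_Mapping.lookup m v) =
      Poly_Mapping.single (\<Sum>v\<in>A. Poly_Mapping.single v (Poly_Mapping.lookup m v)) (1::real)" for A
    by (induction A rule: finite_induct) (auto simp: * mult_single)
  then show ?thesis unfolding mon_eval_def
    using poly_single_sum[of m] by (simp add: Const_times_single)
qed

lemma mon_eval_Var: "mon_eval Var m = Poly_Mapping.single m 1"
  by (simp add: single_eq_Const_mon)

lemma prod_Var: "finite A \<Longrightarrow> (\<Prod>v\<in>A. Var v) = Poly_Mapping.single (mon_of_set A) 1"
  by (simp add: mon_eval_def keys_mon_of_set lookup_mon_of_set flip: mon_eval_Var)

text \<open>Each monomial is peeled off one variable at a time, so that a proof only has to multiply
  by a single variable from \<open>R\<close> and never leaves the polynomials over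
  \<open>R\<close>.\<close>

lemma poly_vars_induct [consumes 1, case_names Const Var add]:
  assumes vars: "poly_vars p \<subseteq> R"
    and C: "\<And>c. P (Const c)" and V: "\<And>v p. v \<in> R \<Longrightarrow> P p \<Longrightarrow> P (Var v * p)"
    and add: "\<And>p q. P p \<Longrightarrow> P q \<Longrightarrow> P (p + q)"
  shows "P p"
proof -
  have mon: "P (Poly_Mapping.single m c)" if "Poly_Mapping.keys m \<subseteq> R" for m c
    using that
  proof (induction "mdeg m" arbitrary: m)
    case 0
    then have "m = 0" by simp
    then show ?case using C[of c] by (simp add: Const_def)
  next
    case (Suc k)
    then have "m \<noteq> 0" by auto
    then obtain v where v: "v \<in> Poly_Mapping.keys m" by fastforce
    define n where "n = m - Poly_Mapping.single v 1"
    have m: "m = Poly_Mapping.single v 1 + n"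
      unfolding n_def by (rule poly_mapping_eqI)
        (use v in \<open>auto simp: lookup_add lookup_minus lookup_single when_def in_keys_iff\<close>)
    have "mdeg n = k" "Poly_Mapping.keys n \<subseteq> R" "v \<in> R"
      using Suc(2,3) m v by (simp_all add: mdeg_add keys_add_nat subset_iff)
    then have "P (Var v * Poly_Mapping.single n c)" by (intro V Suc) auto
    then show ?case by (simp add: Var_def mult_single m)
  qed
  have "finite A \<Longrightarrow> A \<subseteq> Poly_Mapping.keys p \<Longrightarrow>
    P (\<Sum>m\<in>A. Poly_Mapping.single m (Poly_Mapping.lookup p m))" for A
  proof (induction A rule: finite_induct)
    case empty
    then show ?case using C[of 0] by (simp add: Const_def)
  next
    case (insert m A)
    have "Poly_Mapping.keys m \<subseteq> R" using vars insert by (auto simp: poly_vars_def)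
    with insert show ?case by (auto intro: add mon)
  qed
  then show ?thesis using poly_single_sum[of p] by (metis finite_keys subset_refl)
qed

lemmas poly_induct = poly_vars_induct[OF subset_UNIV, case_names Const Var add]

text \<open>The linear functional with prescribed values on monomials. Both the degree maps and the
  constants produced by \<open>diff_op\<close> take this form.\<close>

definition lin_ext :: "(('v \<Rightarrow>\<^sub>0 nat) \<Rightarrow> real) \<Rightarrow> 'v poly \<Rightarrow> real" where
  "lin_ext D p = (\<Sum>m\<in>Poly_Mapping.keys p. Poly_Mapping.lookup p m * D m)"

lemma lin_ext_add: "lin_ext D (p + q) = lin_ext D p + lin_ext D q"
  unfolding lin_ext_def by (rule setsum_keys_plus_distrib) (auto simp: distrib_right)

lemma lin_ext_single [simp]: "lin_ext D (Poly_Mapping.single m c) = c * D m"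
  by (simp add: lin_ext_def)

lemma lin_ext_0 [simp]: "lin_ext D 0 = 0"
  by (simp add: lin_ext_def)

lemma lin_ext_Const_times: "lin_ext D (Const c * p) = c * lin_ext D p"
  by (induction p rule: poly_induct_single) (auto simp: Const_times_single distrib_left lin_ext_add)

lemma lin_ext_sum: "lin_ext D (\<Sum>a\<in>A. f a) = (\<Sum>a\<in>A. lin_ext D (f a))"
  by (induction A rule: infinite_finite_induct) (auto simp: lin_ext_add)

section \<open>Substitution as a ring homomorphism\<close>

lemma poly_subst_mon: "poly_subst s p =
    (\<Sum>m\<in>Poly_Mapping.keys p. Const (Poly_Mapping.lookup p m) * mon_eval s m)"
  by (simp add: poly_subst_def mon_eval_def)

lemma poly_subst_add: "poly_subst s (p + q) = poly_subst s p + poly_subst s q"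
  unfolding poly_subst_mon by (rule setsum_keys_plus_distrib) (auto simp: distrib_right Const_add)

lemma poly_subst_single: "poly_subst s (Poly_Mapping.single m c) = Const c * mon_eval s m"
  by (simp add: poly_subst_mon)

lemma poly_subst_Const [simp]: "poly_subst s (Const c) = Const c"
  by (simp add: Const_def poly_subst_single[unfolded Const_def])

lemma poly_subst_0 [simp]: "poly_subst s 0 = 0"
  and poly_subst_1 [simp]: "poly_subst s 1 = 1"
  using poly_subst_Const[of s 0] poly_subst_Const[of s 1] by simp_all

lemma poly_subst_Var [simp]: "poly_subst s (Var v) = s v"
  by (simp add: Var_def poly_subst_single)

lemma poly_subst_mult: "poly_subst s (p * q) = poly_subst s p * poly_subst s q"
proof (induction p rule: poly_induct_single)
  case (single m c)
  show ?case
    by (induction q rule: poly_induct_single)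
      (simp_all only: mult_single poly_subst_single mon_eval_add Const_mult distrib_left
        distrib_right poly_subst_add ac_simps)
next
  case (add p p')
  then show ?case by (simp only: distrib_right poly_subst_add)
qed

lemma poly_subst_sum: "poly_subst s (\<Sum>a\<in>A. f a) = (\<Sum>a\<in>A. poly_subst s (f a))"
  by (induction A rule: infinite_finite_induct) (auto simp: poly_subst_add)

lemma poly_subst_prod: "poly_subst s (\<Prod>a\<in>A. f a) = (\<Prod>a\<in>A. poly_subst s (f a))"
  by (induction A rule: infinite_finite_induct) (auto simp: poly_subst_mult)

lemma poly_subst_poly_subst:
  "poly_subst s (poly_subst t p) = poly_subst (\<lambda>v. poly_subst s (t v)) p"
  by (induction p rule: poly_induct) (auto simp: poly_subst_mult poly_subst_add)

lemma poly_subst_Var_id [simp]: "poly_subst Var p = p"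
  by (induction p rule: poly_induct) (auto simp: poly_subst_mult poly_subst_add)

lemma poly_subst_cong:
  assumes "\<And>v. v \<in> poly_vars p \<Longrightarrow> s v = t v"
  shows "poly_subst s p = poly_subst t p"
  unfolding poly_subst_def
  by (intro sum.cong prod.cong arg_cong2[where f="(*)"] arg_cong2[where f="(^)"] refl assms)
    (auto simp: poly_vars_def)

section \<open>Variables and homogeneity\<close>

lemma poly_vars_0 [simp]: "poly_vars 0 = {}"
  and poly_vars_Const [simp]: "poly_vars (Const c) = {}"
  and poly_vars_1 [simp]: "poly_vars 1 = {}"
  and poly_vars_Var [simp]: "poly_vars (Var v) = {v}"
  by (auto simp: poly_vars_def Const_def Var_def)

lemma poly_vars_add: "poly_vars (p + q) \<subseteq> poly_vars p \<union> poly_vars q"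
  using Poly_Mapping.keys_add[of p q] by (auto simp: poly_vars_def)

lemma poly_vars_mult: "poly_vars (p * q) \<subseteq> poly_vars p \<union> poly_vars q"
  using keys_mult[of p q] by (fastforce simp: poly_vars_def keys_add_nat)

lemma poly_vars_uminus [simp]: "poly_vars (- p) = poly_vars p"
  by (auto simp: poly_vars_def in_keys_iff)

lemma poly_vars_sum: "(\<And>a. a \<in> A \<Longrightarrow> poly_vars (f a) \<subseteq> R) \<Longrightarrow> poly_vars (\<Sum>a\<in>A. f a) \<subseteq> R"
  by (induction A rule: infinite_finite_induct) (auto dest!: poly_vars_add[THEN subsetD])

lemma poly_vars_prod: "(\<And>a. a \<in> A \<Longrightarrow> poly_vars (f a) \<subseteq> R) \<Longrightarrow> poly_vars (\<Prod>a\<in>A. f a) \<subseteq> R"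
  by (induction A rule: infinite_finite_induct) (auto dest!: poly_vars_mult[THEN subsetD])

lemma poly_vars_power: "poly_vars (p ^ k) \<subseteq> poly_vars p"
  by (induction k) (auto dest!: poly_vars_mult[THEN subsetD])

lemma poly_vars_subst:
  assumes "\<And>v. v \<in> poly_vars p \<Longrightarrow> poly_vars (s v) \<subseteq> R"
  shows "poly_vars (poly_subst s p) \<subseteq> R"
  unfolding poly_subst_mon
proof (rule poly_vars_sum)
  fix m assume "m \<in> Poly_Mapping.keys p"
  then have "poly_vars (mon_eval s m) \<subseteq> R"
    unfolding mon_eval_def using assms
    by (intro poly_vars_prod) (auto simp: poly_vars_def dest!: poly_vars_power[THEN subsetD, unfolded poly_vars_def])
  then show "poly_vars (Const (Poly_Mapping.lookup p m) * mon_eval s m) \<subseteq> R"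
    using poly_vars_mult[of "Const (Poly_Mapping.lookup p m)" "mon_eval s m"] by auto
qed

lemma homogeneous_mdeg: "homogeneous d p \<longleftrightarrow> (\<forall>m\<in>Poly_Mapping.keys p. mdeg m = d)"
  by (simp add: homogeneous_def mdeg_def)

lemma homogeneous_0 [simp]: "homogeneous d 0"
  and homogeneous_Const [simp]: "homogeneous 0 (Const c)"
  and homogeneous_1 [simp]: "homogeneous 0 1"
  and homogeneous_Var [simp]: "homogeneous (Suc 0) (Var v)"
  by (auto simp: homogeneous_mdeg Const_def Var_def)

lemma homogeneous_add: "homogeneous d p \<Longrightarrow> homogeneous d q \<Longrightarrow> homogeneous d (p + q)"
  using Poly_Mapping.keys_add[of p q] by (auto simp: homogeneous_mdeg)

lemma homogeneous_mult: "homogeneous d p \<Longrightarrow> homogeneous e q \<Longrightarrow> homogeneous (d + e) (p * q)"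
  using keys_mult[of p q] by (fastforce simp: homogeneous_mdeg mdeg_add)

lemma homogeneous_Const_times: "homogeneous d p \<Longrightarrow> homogeneous d (Const c * p)"
  using homogeneous_mult[of 0 "Const c" d p] by simp

lemma homogeneous_sum: "(\<And>a. a \<in> A \<Longrightarrow> homogeneous d (f a)) \<Longrightarrow> homogeneous d (\<Sum>a\<in>A. f a)"
  by (induction A rule: infinite_finite_induct) (auto intro: homogeneous_add)

lemma homogeneous_power: "homogeneous d p \<Longrightarrow> homogeneous (k * d) (p ^ k)"
  by (induction k) (auto intro: homogeneous_mult)

lemma homogeneous_subst:
  assumes "homogeneous d p" "\<And>v. v \<in> poly_vars p \<Longrightarrow> homogeneous (Suc 0) (s v)"
  shows "homogeneous d (poly_subst s p)"
  unfolding poly_subst_mon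
proof (intro homogeneous_sum homogeneous_Const_times)
  fix m assume m: "m \<in> Poly_Mapping.keys p"
  have "finite A \<Longrightarrow> A \<subseteq> Poly_Mapping.keys m \<Longrightarrow>
    homogeneous (\<Sum>v\<in>A. Poly_Mapping.lookup m v) (\<Prod>v\<in>A. s v ^ Poly_Mapping.lookup m v)" for A
  proof (induction A rule: finite_subset_induct)
    case (insert v F)
    have "homogeneous (Suc 0) (s v)" using assms(2) m insert by (auto simp: poly_vars_def)
    from homogeneous_power[OF this, of "Poly_Mapping.lookup m v"] insert show ?case
      by (auto intro!: homogeneous_mult)
  qed auto
  then show "homogeneous d (mon_eval s m)"
    using assms(1) m by (auto simp: mon_eval_def homogeneous_def)
qed

section \<open>Constant coefficient differential operators and the multifactorial
  \<open>m!\<close>\<close>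

definition mfact :: "('v \<Rightarrow>\<^sub>0 nat) \<Rightarrow> real" where
  "mfact m = (\<Prod>v\<in>Poly_Mapping.keys m. fact (Poly_Mapping.lookup m v))"

lemma mfact_superset:
  assumes "finite A" "Poly_Mapping.keys m \<subseteq> A"
  shows "mfact m = (\<Prod>v\<in>A. fact (Poly_Mapping.lookup m v))"
  unfolding mfact_def by (rule prod.mono_neutral_left) (use assms in \<open>auto simp: in_keys_iff\<close>)

lemma mfact_pos: "mfact m > 0"
  unfolding mfact_def by (rule prod_pos) simp

lemma mfact_nonzero [simp]: "mfact m \<noteq> 0"
  using mfact_pos[of m] by simp

lemma mfact_zero [simp]: "mfact 0 = 1"
  by (simp add: mfact_def)

text \<open>The Pochhammer symbol is the factor \<open>(a + b)! / a!\<close> that \<open>b\<close>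
  derivatives of a power with exponent \<open>a + b\<close> produce.\<close>

lemma fact_add_pochhammer: "(fact (a + b) :: real) = fact a * pochhammer (real a + 1) b"
  by (induction b) (auto simp: pochhammer_Suc algebra_simps)

lemma lookup_partial_deriv_power:
  "Poly_Mapping.lookup ((partial_deriv v ^^ k) p) n =
    pochhammer (real (Poly_Mapping.lookup n v) + 1) k *
      Poly_Mapping.lookup p (n + Poly_Mapping.single v k)"
proof (induction k arbitrary: n)
  case (Suc k)
  have "n + Poly_Mapping.single v 1 + Poly_Mapping.single v k = n + Poly_Mapping.single v (Suc k)"
    by (simp add: add.assoc flip: single_add)
  then show ?case
    by (simp add: lookup_partial_deriv Suc pochhammer_rec lookup_add ac_simps)
qed simp

text \<open>Commutation in the form that \<open>comp_fun_commute\<close> demands, so that the fold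
  in \<open>diff_monomial\<close> can be unfolded.\<close>

lemma partial_deriv_power_commute:
  "(partial_deriv u ^^ j) \<circ> (partial_deriv v ^^ k) = (partial_deriv v ^^ k) \<circ> (partial_deriv u ^^ j)"
proof -
  have 1: "partial_deriv u \<circ> (partial_deriv v ^^ k) = (partial_deriv v ^^ k) \<circ> partial_deriv u" for k
  proof (induction k)
    case (Suc k)
    have "partial_deriv u (partial_deriv v ((partial_deriv v ^^ k) x)) =
        partial_deriv v (partial_deriv u ((partial_deriv v ^^ k) x))" for x
      by (rule partial_deriv_commute)
    with Suc show ?case by (simp add: fun_eq_iff)
  qed simp
  show ?thesis
    by (induction j) (use 1 in \<open>auto simp: fun_eq_iff\<close>)
qed

text \<open>Each derivative contributes a Pochhammer factor in its own variable; together these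
  factors make up \<open>(n + m)! / n!\<close>.\<close>

lemma lookup_diff_monomial:
  "Poly_Mapping.lookup (diff_monomial m p) n =
    mfact (n + m) * Poly_Mapping.lookup p (n + m) / mfact n"
proof -
  let ?f = "\<lambda>v. partial_deriv v ^^ Poly_Mapping.lookup m v"
  interpret comp_fun_commute ?f
    by unfold_locales (rule partial_deriv_power_commute)
  have fold: "finite A \<Longrightarrow> Poly_Mapping.lookup (Finite_Set.fold ?f p A) n =
      (\<Prod>v\<in>A. pochhammer (real (Poly_Mapping.lookup n v) + 1) (Poly_Mapping.lookup m v)) *
      Poly_Mapping.lookup p (n + (\<Sum>v\<in>A. Poly_Mapping.single v (Poly_Mapping.lookup m v)))"
    for A n
  proof (induction A arbitrary: n rule: finite_induct)
    case (insert v A)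
    let ?k = "Poly_Mapping.lookup m v"
    have "(\<Prod>u\<in>A. pochhammer (real (Poly_Mapping.lookup (n + Poly_Mapping.single v ?k) u) + 1)
            (Poly_Mapping.lookup m u)) =
        (\<Prod>u\<in>A. pochhammer (real (Poly_Mapping.lookup n u) + 1) (Poly_Mapping.lookup m u))"
      by (rule prod.cong) (use insert.hyps in \<open>auto simp: lookup_add lookup_single when_def\<close>)
    with insert show ?case
      by (simp add: lookup_partial_deriv_power add.assoc)
  qed simp
  \<comment> \<open>The factorials are compared on the union of both supports; outside the keys of
    \<open>m\<close> the Pochhammer symbols have length 0 and equal 1.\<close>
  let ?A = "Poly_Mapping.keys n \<union> Poly_Mapping.keys m"
  have "mfact (n + m) = mfact n *
      (\<Prod>v\<in>?A. pochhammer (real (Poly_Mapping.lookup n v) + 1) (Poly_Mapping.lookup m v))"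
    by (simp add: mfact_superset[of ?A] keys_add_nat lookup_add fact_add_pochhammer prod.distrib)
  also have "(\<Prod>v\<in>?A. pochhammer (real (Poly_Mapping.lookup n v) + 1) (Poly_Mapping.lookup m v)) =
      (\<Prod>v\<in>Poly_Mapping.keys m.
        pochhammer (real (Poly_Mapping.lookup n v) + 1) (Poly_Mapping.lookup m v))"
    by (rule prod.mono_neutral_right) (auto simp: in_keys_iff)
  finally show ?thesis
    unfolding diff_monomial_def by (simp add: fold flip: poly_single_sum)
qed

lemma lookup_diff_op:
  "Poly_Mapping.lookup (diff_op f p) n =
    lin_ext (\<lambda>m. mfact (n + m) * Poly_Mapping.lookup p (n + m)) f / mfact n"
  by (simp add: diff_op_def lin_ext_def lookup_sum lookup_diff_monomial sum_divide_distrib)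

lemma diff_op_add_left: "diff_op (f + g) p = diff_op f p + diff_op g p"
  by (rule poly_mapping_eqI) (simp add: lookup_diff_op lookup_add lin_ext_add add_divide_distrib)

lemma diff_op_Const: "diff_op (Const c) p = Const c * p"
proof (rule poly_mapping_eqI)
  fix n
  show "Poly_Mapping.lookup (diff_op (Const c) p) n = Poly_Mapping.lookup (Const c * p) n"
    unfolding lookup_diff_op by (subst (1) Const_def) simp
qed

text \<open>Both sides are bilinear in \<open>f\<close> and \<open>g\<close>, and on monomials the
  factorial quotients of the two successive actions telescope.\<close>

lemma diff_op_mult: "diff_op (f * g) p = diff_op f (diff_op g p)"
proof (rule poly_mapping_eqI)
  fix n
  have "lin_ext (\<lambda>m. mfact (n + m) * Poly_Mapping.lookup p (n + m)) (f * g) =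
    lin_ext (\<lambda>m. mfact (n + m) * Poly_Mapping.lookup (diff_op g p) (n + m)) f"
  proof (induction f rule: poly_induct_single)
    case (single m c)
    show ?case
    proof (induction g rule: poly_induct_single)
      case (single m' c')
      then show ?case by (simp add: lookup_diff_op mult_single add.assoc)
    next
      case (add g g')
      then show ?case
        by (simp add: distrib_left lin_ext_add diff_op_add_left lookup_add)
    qed
  next
    case (add f f')
    then show ?case by (simp add: distrib_right lin_ext_add)
  qed
  then show "Poly_Mapping.lookup (diff_op (f * g) p) n =
      Poly_Mapping.lookup (diff_op f (diff_op g p)) n"
    by (simp add: lookup_diff_op)
qed

lemma diff_op_Var: "diff_op (Var v) p = partial_deriv v p"
proof (rule poly_mapping_eqI)
  fix n
  have "Poly_Mapping.lookup (diff_op (Var v) p) n = Poly_Mapping.lookup (diff_monomial (Poly_Mapping.single v 1) p) n"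
    by (simp add: lookup_diff_op lookup_diff_monomial Var_def)
  also have "diff_monomial (Poly_Mapping.single v 1) p = partial_deriv v p"
  proof -
    interpret comp_fun_commute "\<lambda>u. partial_deriv u ^^ Poly_Mapping.lookup (Poly_Mapping.single v 1) u"
      by unfold_locales (rule partial_deriv_power_commute)
    show ?thesis by (simp add: diff_monomial_def)
  qed
  finally show "Poly_Mapping.lookup (diff_op (Var v) p) n = Poly_Mapping.lookup (partial_deriv v p) n" .
qed

text \<open>A term at \<open>n\<close> different from 0 would have degree above \<open>d\<close>, so
  only the constant survives. A form \<open>V\<close> of degree \<open>d\<close> thus encodes the
  functional that takes the value \<open>m!\<close> times its coefficient on the monomial
  \<open>m\<close>.\<close>

lemma diff_op_homogeneous:
  assumes "homogeneous d f" "homogeneous d V"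
  shows "diff_op f V = Const (lin_ext (\<lambda>m. mfact m * Poly_Mapping.lookup V m) f)"
proof (rule poly_mapping_eqI)
  fix n
  show "Poly_Mapping.lookup (diff_op f V) n =
    Poly_Mapping.lookup (Const (lin_ext (\<lambda>m. mfact m * Poly_Mapping.lookup V m) f)) n"
  proof (cases "n = 0")
    case True
    then show ?thesis by (simp add: lookup_diff_op Const_def)
  next
    case False
    have "Poly_Mapping.lookup V (n + m) = 0" if "m \<in> Poly_Mapping.keys f" for m
    proof (rule ccontr)
      assume "Poly_Mapping.lookup V (n + m) \<noteq> 0"
      then have "mdeg (n + m) = d" "mdeg m = d"
        using assms that by (auto simp: homogeneous_mdeg in_keys_iff)
      with False show False by (simp add: mdeg_add)
    qed
    then have "lin_ext (\<lambda>m. mfact (n + m) * Poly_Mapping.lookup V (n + m)) f = 0"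
      unfolding lin_ext_def by (intro sum.neutral) auto
    with False show ?thesis by (simp add: lookup_diff_op Const_def lookup_single when_def)
  qed
qed

section \<open>Product rule and chain rule\<close>

lemma partial_deriv_add: "partial_deriv v (p + q) = partial_deriv v p + partial_deriv v q"
  by (rule poly_mapping_eqI) (simp add: lookup_partial_deriv lookup_add algebra_simps)

lemma partial_deriv_single: "partial_deriv v (Poly_Mapping.single m c) =
   Poly_Mapping.single (m - Poly_Mapping.single v 1) (real (Poly_Mapping.lookup m v) * c)"
  by (cases "c = 0") (auto simp: partial_deriv_def)

lemma partial_deriv_Const [simp]: "partial_deriv v (Const c) = 0"
  by (simp add: Const_def partial_deriv_single)

lemma partial_deriv_Var: "partial_deriv v (Var u) = Const (if u = v then 1 else 0)"
  by (auto simp: Var_def Const_def partial_deriv_single lookup_single)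

lemma partial_deriv_mult:
  "partial_deriv v (p * q) = partial_deriv v p * q + p * partial_deriv v q"
proof (induction p rule: poly_induct_single)
  case (single m c)
  show ?case
  proof (induction q rule: poly_induct_single)
    case (single n c')
    let ?v = "Poly_Mapping.single v (1::nat)"
    \<comment> \<open>Subtraction of exponents is truncated, so the two monomials may differ when
      the exponent of \<open>v\<close> is 0; the coefficient is 0 in that case.\<close>
    have 1: "Poly_Mapping.single (m - ?v + n) (real (Poly_Mapping.lookup m v) * x) =
        Poly_Mapping.single (m + n - ?v) (real (Poly_Mapping.lookup m v) * x)"
      and 2: "Poly_Mapping.single (m + (n - ?v)) (real (Poly_Mapping.lookup n v) * x) =
        Poly_Mapping.single (m + n - ?v) (real (Poly_Mapping.lookup n v) * x)" for x
    proof -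
      have "m - ?v + n = m + n - ?v" if "Poly_Mapping.lookup m v \<noteq> 0"
        using that by (intro poly_mapping_eqI) (auto simp: lookup_add lookup_minus lookup_single when_def)
      then show "Poly_Mapping.single (m - ?v + n) (real (Poly_Mapping.lookup m v) * x) =
        Poly_Mapping.single (m + n - ?v) (real (Poly_Mapping.lookup m v) * x)" by (cases "Poly_Mapping.lookup m v = 0") auto
      have "m + (n - ?v) = m + n - ?v" if "Poly_Mapping.lookup n v \<noteq> 0"
        using that by (intro poly_mapping_eqI) (auto simp: lookup_add lookup_minus lookup_single when_def)
      then show "Poly_Mapping.single (m + (n - ?v)) (real (Poly_Mapping.lookup n v) * x) =
        Poly_Mapping.single (m + n - ?v) (real (Poly_Mapping.lookup n v) * x)" by (cases "Poly_Mapping.lookup n v = 0") auto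
    qed
    have eq: "(real (Poly_Mapping.lookup m v) * c) * c' = real (Poly_Mapping.lookup m v) * (c * c')"
      "c * (real (Poly_Mapping.lookup n v) * c') = real (Poly_Mapping.lookup n v) * (c * c')" by simp_all
    show ?case
      unfolding mult_single partial_deriv_single eq 1 2 lookup_add of_nat_add distrib_right single_add ..
  next
    case (add p q)
    then show ?case by (simp only: distrib_left distrib_right partial_deriv_add ac_simps)
  qed
next
  case (add p q)
  then show ?case by (simp only: distrib_left distrib_right partial_deriv_add ac_simps)
qed

lemma poly_vars_partial_deriv: "poly_vars (partial_deriv v p) \<subseteq> poly_vars p"
proof
  fix u assume "u \<in> poly_vars (partial_deriv v p)"
  then obtain m where "Poly_Mapping.lookup p (m + Poly_Mapping.single v 1) \<noteq> 0" "Poly_Mapping.lookup m u \<noteq> 0"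
    by (auto simp: poly_vars_def in_keys_iff lookup_partial_deriv)
  then show "u \<in> poly_vars p"
    unfolding poly_vars_def
    by (intro UN_I[of "m + Poly_Mapping.single v 1"]) (auto simp: in_keys_iff lookup_add)
qed

lemma partial_deriv_subst:
  assumes "finite R" "poly_vars p \<subseteq> R"
  shows "partial_deriv u (poly_subst s p) =
    (\<Sum>v\<in>R. partial_deriv u (s v) * poly_subst s (partial_deriv v p))"
  using assms(2)
proof (induction p rule: poly_vars_induct)
  case (Var v p)
  have "(\<Sum>w\<in>R. partial_deriv u (s w) * poly_subst s (partial_deriv w (Var v * p))) =
     (\<Sum>w\<in>R. (if w = v then partial_deriv u (s v) * poly_subst s p else 0) +
        s v * (partial_deriv u (s w) * poly_subst s (partial_deriv w p)))"
    by (rule sum.cong) (auto simp: partial_deriv_mult partial_deriv_Var poly_subst_add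
        poly_subst_mult algebra_simps)
  also have "\<dots> = partial_deriv u (s v) * poly_subst s p + s v * partial_deriv u (poly_subst s p)"
    using assms(1) Var by (simp add: sum.distrib sum_distrib_left)
  finally show ?case by (simp add: poly_subst_mult partial_deriv_mult)
qed (auto simp: partial_deriv_add poly_subst_add distrib_left sum.distrib)

lemma diff_op_0 [simp]: "diff_op 0 p = 0"
  using diff_op_Const[of 0 p] by simp

lemma diff_op_sum: "diff_op (\<Sum>a\<in>A. f a) p = (\<Sum>a\<in>A. diff_op (f a) p)"
  by (induction A rule: infinite_finite_induct) (auto simp: diff_op_add_left)

text \<open>Under a linear substitution \<open>s\<close>, the operator \<open>f(\<partial>)\<close> is transported by the transpose of \<open>s\<close>.\<close>

lemma diff_op_subst:
  assumes "finite R" "poly_vars p \<subseteq> R"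
    and s: "\<And>u v. v \<in> R \<Longrightarrow> partial_deriv u (s v) = Const (c u v)"
  shows "diff_op f (poly_subst s p) =
    poly_subst s (diff_op (poly_subst (\<lambda>u. \<Sum>v\<in>R. Const (c u v) * Var v) f) p)"
proof -
  let ?t = "poly_subst (\<lambda>u. \<Sum>v\<in>R. Const (c u v) * Var v)"
  \<comment> \<open>The chain rule will be applied to a derivative of \<open>p\<close>, so
    differentiation must not introduce variables outside \<open>R\<close>.\<close>
  have vars: "poly_vars (diff_op f p) \<subseteq> R" if "poly_vars p \<subseteq> R" for f p
  proof (induction f rule: poly_induct)
    case (Const c)
    then show ?case using that poly_vars_mult[of "Const c" p] by (auto simp: diff_op_Const)
  next
    case (Var v f)
    then show ?case unfolding diff_op_mult diff_op_Var
      by (intro order_trans[OF poly_vars_partial_deriv])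
  next
    case (add f g)
    then show ?case unfolding diff_op_add_left
      by (intro order_trans[OF poly_vars_add] Un_least)
  qed
  show ?thesis
  proof (induction f rule: poly_induct)
    case (Const c)
    then show ?case by (simp add: diff_op_Const poly_subst_mult)
  next
    case (Var u f)
    have "diff_op (Var u * f) (poly_subst s p) = partial_deriv u (poly_subst s (diff_op (?t f) p))"
      by (simp add: diff_op_mult diff_op_Var Var)
    also have "\<dots> = (\<Sum>v\<in>R. partial_deriv u (s v) * poly_subst s (partial_deriv v (diff_op (?t f) p)))"
      by (rule partial_deriv_subst) (use assms vars in auto)
    also have "\<dots> = poly_subst s (diff_op (\<Sum>v\<in>R. Const (c u v) * Var v) (diff_op (?t f) p))"
      by (simp add: diff_op_sum diff_op_mult diff_op_Const diff_op_Var poly_subst_sum poly_subst_mult s)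
    finally show ?case by (simp add: poly_subst_mult diff_op_mult)
  next
    case (add f g)
    then show ?case by (simp add: diff_op_add_left poly_subst_add)
  qed
qed

lemma finite_monomials:
  assumes "finite R"
  shows "finite {m :: 'v \<Rightarrow>\<^sub>0 nat. Poly_Mapping.keys m \<subseteq> R \<and> mdeg m = d}"
proof (rule finite_imageD)
  let ?S = "{m :: 'v \<Rightarrow>\<^sub>0 nat. Poly_Mapping.keys m \<subseteq> R \<and> mdeg m = d}"
  have "Poly_Mapping.lookup m v \<le> mdeg m" for m and v :: 'v
    by (cases "v \<in> Poly_Mapping.keys m") (auto simp: mdeg_def in_keys_iff intro: member_le_sum)
  then have "Poly_Mapping.lookup ` ?S \<subseteq> {f. \<forall>v. (v \<in> R \<longrightarrow> f v \<in> {..d}) \<and> (v \<notin> R \<longrightarrow> f v = 0)}"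
    by (auto simp: in_keys_iff)
  moreover have "finite \<dots>" by (rule finite_set_of_finite_funs) (use assms in auto)
  ultimately show "finite (Poly_Mapping.lookup ` ?S)" by (rule finite_subset)
  show "inj_on Poly_Mapping.lookup ?S" by (auto simp: inj_on_def intro: poly_mapping_eqI)
qed

section \<open>Chow rings\<close>

lemma carrier_ray_poly_ring [simp]: "p \<in> carrier (ray_poly_ring \<Delta>) \<longleftrightarrow> poly_vars p \<subseteq> rays \<Delta>"
  and ray_poly_ring_simps [simp]:
    "mult (ray_poly_ring \<Delta>) = (*)" "add (ray_poly_ring \<Delta>) = (+)"
    "zero (ray_poly_ring \<Delta>) = 0" "one (ray_poly_ring \<Delta>) = 1"
  by (simp_all add: ray_poly_ring_def)

lemma cring_ray_poly_ring: "cring (ray_poly_ring \<Delta>)"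
proof (rule cringI)
  show "abelian_group (ray_poly_ring \<Delta>)"
  proof (rule abelian_groupI)
    fix x assume "x \<in> carrier (ray_poly_ring \<Delta>)"
    then show "\<exists>y\<in>carrier (ray_poly_ring \<Delta>). y \<oplus>\<^bsub>ray_poly_ring \<Delta>\<^esub> x = \<zero>\<^bsub>ray_poly_ring \<Delta>\<^esub>"
      by (intro bexI[of _ "- x"]) auto
  next
    fix x y assume "x \<in> carrier (ray_poly_ring \<Delta>)" "y \<in> carrier (ray_poly_ring \<Delta>)"
    then show "x \<oplus>\<^bsub>ray_poly_ring \<Delta>\<^esub> y \<in> carrier (ray_poly_ring \<Delta>)"
      using poly_vars_add[of x y] by auto
  qed (auto simp: ac_simps)
  show "comm_monoid (ray_poly_ring \<Delta>)"
  proof (rule comm_monoidI)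
    fix x y assume "x \<in> carrier (ray_poly_ring \<Delta>)" "y \<in> carrier (ray_poly_ring \<Delta>)"
    then show "x \<otimes>\<^bsub>ray_poly_ring \<Delta>\<^esub> y \<in> carrier (ray_poly_ring \<Delta>)"
      using poly_vars_mult[of x y] by auto
  qed (auto simp: ac_simps)
qed (auto simp: distrib_right)

lemma chow_generators_subset:
  "stanley_reisner_relations \<Delta> \<union> linear_relations \<Delta> \<subseteq> carrier (ray_poly_ring \<Delta>)"
proof -
  have "poly_vars (\<Prod>\<rho>\<in>A. Var \<rho>) \<subseteq> rays \<Delta>" if "A \<subseteq> rays \<Delta>" for A
    using that by (intro poly_vars_prod) auto
  moreover have "poly_vars (\<Sum>\<rho>\<in>rays \<Delta>. Const (c \<rho>) * Var \<rho>) \<subseteq> rays \<Delta>" for c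
    by (intro poly_vars_sum) (use poly_vars_mult in fastforce)
  ultimately show ?thesis
    unfolding stanley_reisner_relations_def linear_relations_def
    by (intro Un_least subsetI; elim CollectE exE conjE) (simp_all only: carrier_ray_poly_ring)
qed

lemma ideal_chow_ideal: "ideal (chow_ideal \<Delta>) (ray_poly_ring \<Delta>)"
proof -
  interpret cring "ray_poly_ring \<Delta>" by (rule cring_ray_poly_ring)
  show ?thesis unfolding chow_ideal_def by (rule genideal_ideal[OF chow_generators_subset])
qed

lemma chow_ideal_generator:
  "p \<in> stanley_reisner_relations \<Delta> \<union> linear_relations \<Delta> \<Longrightarrow> p \<in> chow_ideal \<Delta>"
proof -
  interpret cring "ray_poly_ring \<Delta>" by (rule cring_ray_poly_ring)
  show "p \<in> stanley_reisner_relations \<Delta> \<union> linear_relations \<Delta> \<Longrightarrow> p \<in> chow_ideal \<Delta>"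
    unfolding chow_ideal_def using genideal_self[OF chow_generators_subset] by blast
qed

lemma chow_ideal_0 [simp]: "0 \<in> chow_ideal \<Delta>"
  using additive_subgroup.zero_closed[OF ideal.axioms(1)[OF ideal_chow_ideal[of \<Delta>]]] by simp

lemma chow_ideal_add: "p \<in> chow_ideal \<Delta> \<Longrightarrow> q \<in> chow_ideal \<Delta> \<Longrightarrow> p + q \<in> chow_ideal \<Delta>"
  using additive_subgroup.a_closed[OF ideal.axioms(1)[OF ideal_chow_ideal[of \<Delta>]]] by force

lemma chow_ideal_mult: "p \<in> chow_ideal \<Delta> \<Longrightarrow> poly_vars q \<subseteq> rays \<Delta> \<Longrightarrow> q * p \<in> chow_ideal \<Delta>"
  using ideal.I_l_closed[OF ideal_chow_ideal[of \<Delta>]] by force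

lemma chow_ideal_minus: "p \<in> chow_ideal \<Delta> \<Longrightarrow> - p \<in> chow_ideal \<Delta>"
  using chow_ideal_mult[of p \<Delta> "Const (- 1)"] by (simp add: Const_minus)

lemma chow_ideal_diff: "p \<in> chow_ideal \<Delta> \<Longrightarrow> q \<in> chow_ideal \<Delta> \<Longrightarrow> p - q \<in> chow_ideal \<Delta>"
  using chow_ideal_add[of p \<Delta> "- q"] chow_ideal_minus[of q \<Delta>] by simp

lemma chow_ideal_sum: "(\<And>a. a \<in> A \<Longrightarrow> f a \<in> chow_ideal \<Delta>) \<Longrightarrow> (\<Sum>a\<in>A. f a) \<in> chow_ideal \<Delta>"
  by (induction A rule: infinite_finite_induct) (auto intro: chow_ideal_add)

text \<open>Serves as an induction principle for membership in a Chow ideal: the property to be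
  proved is packed into \<open>J\<close>. Closure under negation comes from multiplying by the
  constant -1.\<close>

lemma chow_ideal_minimal:
  assumes J: "\<And>p. p \<in> J \<Longrightarrow> poly_vars p \<subseteq> rays \<Delta>" "0 \<in> J"
      "\<And>p q. p \<in> J \<Longrightarrow> q \<in> J \<Longrightarrow> p + q \<in> J"
      "\<And>p q. p \<in> J \<Longrightarrow> poly_vars q \<subseteq> rays \<Delta> \<Longrightarrow> q * p \<in> J"
    and gens: "stanley_reisner_relations \<Delta> \<union> linear_relations \<Delta> \<subseteq> J"
  shows "chow_ideal \<Delta> \<subseteq> J"
proof -
  interpret cring "ray_poly_ring \<Delta>" by (rule cring_ray_poly_ring)
  have minus: "- p \<in> J" if "p \<in> J" for p
    using J(4)[of p "Const (- 1)"] that by (simp add: Const_minus)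
  have inv: "\<ominus>\<^bsub>ray_poly_ring \<Delta>\<^esub> p = - p" if "p \<in> J" for p
    by (rule minus_equality) (use J(1)[OF that] in auto)
  have "ideal J (ray_poly_ring \<Delta>)"
  proof (rule idealI)
    show "subgroup J (add_monoid (ray_poly_ring \<Delta>))"
      by (rule add.subgroupI) (use J minus inv in \<open>auto simp: a_inv_def\<close>)
  qed (use J ring_axioms in \<open>auto simp: mult.commute\<close>)
  then show ?thesis unfolding chow_ideal_def by (rule genideal_minimal[OF _ gens])
qed

lemma chow_class_def': "chow_class \<Delta> f = {h + f | h. h \<in> chow_ideal \<Delta>}"
  by (auto simp: chow_class_def a_r_coset_def r_coset_def)

text \<open>A coset is a translate of the ideal under the ordinary addition of polynomials, and
  contains its representative because 0 lies in the ideal.\<close>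

lemma chow_class_eq_iff: "chow_class \<Delta> f = chow_class \<Delta> g \<longleftrightarrow> f - g \<in> chow_ideal \<Delta>"
proof
  assume "chow_class \<Delta> f = chow_class \<Delta> g"
  moreover have "f \<in> chow_class \<Delta> f" unfolding chow_class_def' by (auto intro!: exI[of _ 0])
  ultimately show "f - g \<in> chow_ideal \<Delta>" unfolding chow_class_def' by auto
next
  assume a: "f - g \<in> chow_ideal \<Delta>"
  have "h + f \<in> chow_class \<Delta> g" if "h \<in> chow_ideal \<Delta>" for h
    using chow_ideal_add[OF that a] unfolding chow_class_def' by (auto intro!: exI[of _ "h + (f - g)"])
  moreover have "h + g \<in> chow_class \<Delta> f" if "h \<in> chow_ideal \<Delta>" for h
    using chow_ideal_diff[OF that a] unfolding chow_class_def' by (auto intro!: exI[of _ "h - (f - g)"])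
  ultimately show "chow_class \<Delta> f = chow_class \<Delta> g" unfolding chow_class_def' by auto
qed

lemma chow_class_add:
  assumes "poly_vars f \<subseteq> rays \<Delta>" "poly_vars g \<subseteq> rays \<Delta>"
  shows "chow_class \<Delta> f \<oplus>\<^bsub>chow_ring \<Delta>\<^esub> chow_class \<Delta> g = chow_class \<Delta> (f + g)"
  using ideal.a_rcos_sum[OF ideal_chow_ideal[of \<Delta>], of f g] assms
  by (simp add: chow_ring_def FactRing_def chow_class_def)

lemma chow_class_mult:
  assumes "poly_vars f \<subseteq> rays \<Delta>" "poly_vars g \<subseteq> rays \<Delta>"
  shows "chow_class \<Delta> f \<otimes>\<^bsub>chow_ring \<Delta>\<^esub> chow_class \<Delta> g = chow_class \<Delta> (f * g)"
  using ideal.rcoset_mult_add[OF ideal_chow_ideal[of \<Delta>], of f g] assms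
  by (simp add: chow_ring_def FactRing_def chow_class_def)

section \<open>Functionals on the top degree part and their volume polynomials\<close>

lemma forms_iff: "f \<in> forms \<Delta> d \<longleftrightarrow> poly_vars f \<subseteq> rays \<Delta> \<and> homogeneous d f"
  by (simp add: forms_def)

lemma chow_functional_add:
  assumes "chow_functional \<Delta> d w \<phi>" "f \<in> forms \<Delta> d" "g \<in> forms \<Delta> d"
  shows "\<phi> (chow_class \<Delta> (f + g)) = \<phi> (chow_class \<Delta> f) + \<phi> (chow_class \<Delta> g)"
proof -
  have "\<phi> (chow_class \<Delta> f \<oplus>\<^bsub>chow_ring \<Delta>\<^esub> chow_class \<Delta> g) =
      \<phi> (chow_class \<Delta> f) + \<phi> (chow_class \<Delta> g)"
    using assms unfolding chow_functional_def chow_graded_def by blast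
  then show ?thesis using assms chow_class_add[of f \<Delta> g] by (simp add: forms_iff)
qed

lemma chow_functional_scale:
  assumes "chow_functional \<Delta> d w \<phi>" "f \<in> forms \<Delta> d"
  shows "\<phi> (chow_class \<Delta> (Const c * f)) = c * \<phi> (chow_class \<Delta> f)"
proof -
  have "\<phi> (chow_class \<Delta> (Const c) \<otimes>\<^bsub>chow_ring \<Delta>\<^esub> chow_class \<Delta> f) = c * \<phi> (chow_class \<Delta> f)"
    using assms unfolding chow_functional_def chow_graded_def by blast
  then show ?thesis using assms chow_class_mult[of "Const c" \<Delta> f] by (simp add: forms_iff)
qed

lemma chow_functional_weight:
  assumes "chow_functional \<Delta> d w \<phi>" "\<sigma> \<in> maximal_cones \<Delta>"
  shows "\<phi> (chow_class \<Delta> (\<Prod>\<rho>\<in>\<sigma>. Var \<rho>)) = w \<sigma>"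
  using assms by (simp add: chow_functional_def)

lemma chow_functional_0:
  assumes "chow_functional \<Delta> d w \<phi>" "f \<in> chow_ideal \<Delta>"
  shows "\<phi> (chow_class \<Delta> f) = 0"
proof -
  have "chow_class \<Delta> f = chow_class \<Delta> 0" using assms(2) by (simp add: chow_class_eq_iff)
  \<comment> \<open>The zero polynomial is a form of every degree, so scaling by 0 is available in
    degree \<open>d\<close>.\<close>
  moreover have "\<phi> (chow_class \<Delta> (Const 0 * 0)) = 0 * \<phi> (chow_class \<Delta> 0)"
    using assms(1) by (intro chow_functional_scale) (auto simp: forms_iff)
  ultimately show ?thesis by simp
qed

lemma forms_add: "f \<in> forms \<Delta> d \<Longrightarrow> g \<in> forms \<Delta> d \<Longrightarrow> f + g \<in> forms \<Delta> d"
  using poly_vars_add[of f g] by (auto simp: forms_iff intro: homogeneous_add)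

lemma forms_scale: "f \<in> forms \<Delta> d \<Longrightarrow> Const c * f \<in> forms \<Delta> d"
  using poly_vars_mult[of "Const c" f] by (auto simp: forms_iff intro: homogeneous_Const_times)

lemma forms_sum: "(\<And>a. a \<in> A \<Longrightarrow> f a \<in> forms \<Delta> d) \<Longrightarrow> (\<Sum>a\<in>A. f a) \<in> forms \<Delta> d"
proof (induction A rule: infinite_finite_induct)
  case (insert a A)
  then show ?case by (simp add: forms_add)
qed (auto simp: forms_iff)

lemma chow_functional_sum:
  assumes \<phi>: "chow_functional \<Delta> d w \<phi>" and "\<And>a. a \<in> A \<Longrightarrow> f a \<in> forms \<Delta> d"
  shows "\<phi> (chow_class \<Delta> (\<Sum>a\<in>A. f a)) = (\<Sum>a\<in>A. \<phi> (chow_class \<Delta> (f a)))"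
  using assms(2)
proof (induction A rule: infinite_finite_induct)
  case (insert x F)
  then show ?case using chow_functional_add[OF \<phi>, of "f x" "sum f F"] by (simp add: forms_sum)
qed (use chow_functional_0[OF \<phi>] in auto)

text \<open>Descends a linear functional from forms to cosets. Two homogeneous representatives of a
  coset differ by a form of the same degree in the ideal, which is why \<open>kill\<close> speaks of
  forms only.\<close>

lemma chow_functionalI:
  assumes add: "\<And>f g. f \<in> forms \<Delta> d \<Longrightarrow> g \<in> forms \<Delta> d \<Longrightarrow> \<Phi> (f + g) = \<Phi> f + \<Phi> g"
    and scale: "\<And>c f. f \<in> forms \<Delta> d \<Longrightarrow> \<Phi> (Const c * f) = c * \<Phi> f"
    and kill: "\<And>f. f \<in> forms \<Delta> d \<Longrightarrow> f \<in> chow_ideal \<Delta> \<Longrightarrow> \<Phi> f = 0"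
    and w: "\<And>\<sigma>. \<sigma> \<in> maximal_cones \<Delta> \<Longrightarrow> (\<Prod>\<rho>\<in>\<sigma>. Var \<rho>) \<in> forms \<Delta> d \<and> \<Phi> (\<Prod>\<rho>\<in>\<sigma>. Var \<rho>) = w \<sigma>"
  shows "\<exists>\<phi>. chow_functional \<Delta> d w \<phi> \<and> (\<forall>f\<in>forms \<Delta> d. \<phi> (chow_class \<Delta> f) = \<Phi> f)"
proof -
  \<comment> \<open>The choice is constrained to representatives of degree \<open>d\<close>; on
    cosets without one the value is arbitrary.\<close>
  define \<phi> where "\<phi> X = \<Phi> (SOME f. f \<in> forms \<Delta> d \<and> chow_class \<Delta> f = X)" for X
  have \<phi>: "\<phi> (chow_class \<Delta> f) = \<Phi> f" if f: "f \<in> forms \<Delta> d" for f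
  proof -
    define g where "g = (SOME g. g \<in> forms \<Delta> d \<and> chow_class \<Delta> g = chow_class \<Delta> f)"
    have "g \<in> forms \<Delta> d \<and> chow_class \<Delta> g = chow_class \<Delta> f"
      unfolding g_def by (rule someI[of _ f]) (use f in simp)
    then have g: "g \<in> forms \<Delta> d" "g - f \<in> chow_ideal \<Delta>" by (simp_all add: chow_class_eq_iff)
    have "g + Const (- 1) * f \<in> forms \<Delta> d" using f g by (intro forms_add forms_scale)
    then have h: "g - f \<in> forms \<Delta> d" by (simp add: Const_minus)
    have "\<Phi> (f + (g - f)) = \<Phi> f" unfolding add[OF f h] kill[OF h g(2)] by simp
    then show ?thesis by (simp add: \<phi>_def g_def)
  qed
  moreover have "chow_functional \<Delta> d w \<phi>"
    unfolding chow_functional_def chow_graded_def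
  proof (intro conjI ballI allI; (elim imageE)?; (hypsubst)?)
    fix f g assume "f \<in> forms \<Delta> d" "g \<in> forms \<Delta> d"
    then show "\<phi> (chow_class \<Delta> f \<oplus>\<^bsub>chow_ring \<Delta>\<^esub> chow_class \<Delta> g) = \<phi> (chow_class \<Delta> f) + \<phi> (chow_class \<Delta> g)"
      using chow_class_add[of f \<Delta> g] \<phi>[OF forms_add, of f g] add[of f g] \<phi>[of f] \<phi>[of g]
      by (simp add: forms_iff)
  next
    fix c f assume "f \<in> forms \<Delta> d"
    then show "\<phi> (chow_class \<Delta> (Const c) \<otimes>\<^bsub>chow_ring \<Delta>\<^esub> chow_class \<Delta> f) = c * \<phi> (chow_class \<Delta> f)"
      using chow_class_mult[of "Const c" \<Delta> f] \<phi>[OF forms_scale, of f c] scale[of f c] \<phi>[of f]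
      by (simp add: forms_iff)
  next
    fix \<sigma> assume "\<sigma> \<in> maximal_cones \<Delta>"
    then show "\<phi> (chow_class \<Delta> (\<Prod>\<rho>\<in>\<sigma>. Var \<rho>)) = w \<sigma>" using w \<phi> by simp
  qed
  ultimately show ?thesis by blast
qed

text \<open>The bound on the variables is part of the induction because
  \<open>poly_subst t p\<close> becomes the cofactor of \<open>s v - t v\<close>, and the ideal
  absorbs only polynomials in the rays.\<close>

lemma poly_subst_cong_chow_ideal:
  assumes "poly_vars p \<subseteq> rays \<Delta>"
    and s: "\<And>v. v \<in> rays \<Delta> \<Longrightarrow> s v - t v \<in> chow_ideal \<Delta>" "\<And>v. v \<in> rays \<Delta> \<Longrightarrow> poly_vars (s v) \<subseteq> rays \<Delta>"
      "\<And>v. v \<in> rays \<Delta> \<Longrightarrow> poly_vars (t v) \<subseteq> rays \<Delta>"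
  shows "poly_subst s p - poly_subst t p \<in> chow_ideal \<Delta> \<and> poly_vars (poly_subst t p) \<subseteq> rays \<Delta>"
  using assms(1)
proof (induction p rule: poly_vars_induct)
  case (Var v p)
  have "s v * poly_subst s p - t v * poly_subst t p =
      poly_subst t p * (s v - t v) + s v * (poly_subst s p - poly_subst t p)"
    by (simp add: algebra_simps)
  also have "\<dots> \<in> chow_ideal \<Delta>"
    using Var(2) s(1,2)[OF Var(1)] by (simp add: chow_ideal_add chow_ideal_mult)
  finally have "s v * poly_subst s p - t v * poly_subst t p \<in> chow_ideal \<Delta>" .
  moreover have "poly_vars (t v * poly_subst t p) \<subseteq> rays \<Delta>"
    using Var(2) s(3)[OF Var(1)] by (intro order_trans[OF poly_vars_mult]) simp
  ultimately show ?case by (simp add: poly_subst_mult)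
next
  case (add p q)
  then have "(poly_subst s p - poly_subst t p) + (poly_subst s q - poly_subst t q) \<in> chow_ideal \<Delta>"
    by (intro chow_ideal_add) auto
  moreover have "poly_vars (poly_subst t p + poly_subst t q) \<subseteq> rays \<Delta>"
    using add by (intro order_trans[OF poly_vars_add]) simp
  ultimately show ?case by (simp add: poly_subst_add algebra_simps)
qed simp

text \<open>Applying the monomial operator \<open>m\<close> reads off the coefficient at
  \<open>m\<close>, up to the nonzero factor \<open>m!\<close>.\<close>

lemma forms_eqI:
  assumes "V \<in> forms \<Delta> d" "V' \<in> forms \<Delta> d"
    and eq: "\<And>f. f \<in> forms \<Delta> d \<Longrightarrow> diff_op f V = diff_op f V'"
  shows "V = V'"
proof (rule poly_mapping_eqI)
  fix m
  have zero: "Poly_Mapping.lookup W m = 0" if "W \<in> forms \<Delta> d" "\<not> (Poly_Mapping.keys m \<subseteq> rays \<Delta> \<and> mdeg m = d)" for W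
    using that by (force simp: forms_iff homogeneous_mdeg poly_vars_def in_keys_iff)
  show "Poly_Mapping.lookup V m = Poly_Mapping.lookup V' m"
  proof (cases "Poly_Mapping.keys m \<subseteq> rays \<Delta> \<and> mdeg m = d")
    case True
    let ?f = "Poly_Mapping.single m (1::real)"
    have f: "?f \<in> forms \<Delta> d" using True by (auto simp: forms_iff poly_vars_def homogeneous_mdeg)
    have "Poly_Mapping.lookup (diff_op ?f V) 0 = Poly_Mapping.lookup (diff_op ?f V') 0" by (simp add: eq[OF f])
    then show ?thesis by (simp add: lookup_diff_op)
  next
    case False
    then show ?thesis using zero assms by simp
  qed
qed

text \<open>The functional is hidden under an existential quantifier, so the definite description
  needs that all admissible functionals agree. Agreement on classes of forms is the right demand,
  since values on other cosets are unconstrained.\<close>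

lemma mixed_volume_eqI:
  assumes V: "V \<in> forms \<Delta> d" and \<phi>: "chow_functional \<Delta> d w \<phi>"
    and eq: "\<And>f. f \<in> forms \<Delta> d \<Longrightarrow> diff_op f V = Const (\<phi> (chow_class \<Delta> f))"
    and unique: "\<And>\<phi>' f. chow_functional \<Delta> d w \<phi>' \<Longrightarrow> f \<in> forms \<Delta> d \<Longrightarrow>
      \<phi>' (chow_class \<Delta> f) = \<phi> (chow_class \<Delta> f)"
  shows "mixed_volume \<Delta> d w = V"
  unfolding mixed_volume_def
proof (rule the_equality)
  show "V \<in> forms \<Delta> d \<and> (\<exists>\<phi>. chow_functional \<Delta> d w \<phi> \<and>
      (\<forall>f\<in>forms \<Delta> d. diff_op f V = Const (\<phi> (chow_class \<Delta> f))))"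
    using V \<phi> eq by blast
next
  fix V' assume "V' \<in> forms \<Delta> d \<and> (\<exists>\<phi>. chow_functional \<Delta> d w \<phi> \<and>
      (\<forall>f\<in>forms \<Delta> d. diff_op f V' = Const (\<phi> (chow_class \<Delta> f))))"
  then show "V' = V"
    using forms_eqI[of V' \<Delta> d V] V eq unique by metis
qed

text \<open>The polynomial is the exponential generating function of the values of
  \<open>\<phi>\<close> on monomials: dividing by \<open>m!\<close> compensates the factor that
  differentiation creates.\<close>

lemma chow_functional_volume_exists:
  assumes fin: "finite (rays \<Delta>)" and \<phi>: "chow_functional \<Delta> d w \<phi>"
  shows "\<exists>V\<in>forms \<Delta> d. \<forall>f\<in>forms \<Delta> d. diff_op f V = Const (\<phi> (chow_class \<Delta> f))"
proof -
  let ?M = "{m. Poly_Mapping.keys m \<subseteq> rays \<Delta> \<and> mdeg m = d}"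
  let ?D = "\<lambda>m. \<phi> (chow_class \<Delta> (Poly_Mapping.single m 1))"
  define V where "V = (\<Sum>m\<in>?M. Poly_Mapping.single m (?D m / mfact m))"
  have finM: "finite ?M" using fin by (rule finite_monomials)
  have lookup_V: "Poly_Mapping.lookup V m = (if m \<in> ?M then ?D m / mfact m else 0)" for m
    using finM by (simp add: V_def lookup_sum lookup_single when_def)
  have V: "V \<in> forms \<Delta> d"
    unfolding forms_iff homogeneous_mdeg poly_vars_def
    by (auto simp: in_keys_iff[where s=V] lookup_V split: if_splits)
  have single: "Poly_Mapping.single m c \<in> forms \<Delta> d" if "m \<in> ?M" for m c
    using that by (auto simp: forms_iff poly_vars_def homogeneous_mdeg)
  have "diff_op f V = Const (\<phi> (chow_class \<Delta> f))" if f: "f \<in> forms \<Delta> d" for f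
  proof -
    have keys: "m \<in> ?M" if "m \<in> Poly_Mapping.keys f" for m
      using f that by (auto simp: forms_iff poly_vars_def homogeneous_mdeg)
    have "lin_ext (\<lambda>m. mfact m * Poly_Mapping.lookup V m) f = (\<Sum>m\<in>Poly_Mapping.keys f. Poly_Mapping.lookup f m * ?D m)"
      unfolding lin_ext_def by (rule sum.cong) (use keys in \<open>auto simp: lookup_V\<close>)
    also have "\<dots> = (\<Sum>m\<in>Poly_Mapping.keys f.
        \<phi> (chow_class \<Delta> (Const (Poly_Mapping.lookup f m) * Poly_Mapping.single m 1)))"
      by (rule sum.cong[OF refl], rule chow_functional_scale[OF \<phi>, symmetric]) (rule single[OF keys])
    also have "\<dots> = \<phi> (chow_class \<Delta> (\<Sum>m\<in>Poly_Mapping.keys f. Poly_Mapping.single m (Poly_Mapping.lookup f m)))"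
      using chow_functional_sum[OF \<phi>, of "Poly_Mapping.keys f" "\<lambda>m. Poly_Mapping.single m (Poly_Mapping.lookup f m)"]
        single keys by (simp add: Const_times_single)
    also have "\<dots> = \<phi> (chow_class \<Delta> f)" by (simp flip: poly_single_sum)
    finally show ?thesis
      using f V by (simp add: diff_op_homogeneous[of d] forms_iff)
  qed
  with V show ?thesis by blast
qed

section \<open>The degree map of a balanced simplicial fan\<close>

text \<open>Written with \<open>Suc 0\<close>, the form into which the simplifier turns the exponent
  1.\<close>

abbreviation mvar :: "'v \<Rightarrow> 'v \<Rightarrow>\<^sub>0 nat" where
  "mvar v \<equiv> Poly_Mapping.single v (Suc 0)"

text \<open>Only the values of linear functions on the rays matter, so \<open>\<Lambda>\<close> is a
  set of functions on rays. The assumption \<open>dual_form\<close> is the linear independence of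
  the ray vectors of a cone, expressed by a dual basis.\<close>

locale simplicial_fan =
  fixes R :: "'r set" and C :: "'r set set" and \<Lambda> :: "('r \<Rightarrow> real) set" and d :: nat
  assumes finite_rays: "finite R"
    and cone_rays: "\<sigma> \<in> C \<Longrightarrow> \<sigma> \<subseteq> R"
    and face_cone: "\<sigma> \<in> C \<Longrightarrow> \<tau> \<subseteq> \<sigma> \<Longrightarrow> \<tau> \<in> C"
    and linear_combination: "l \<in> \<Lambda> \<Longrightarrow> l' \<in> \<Lambda> \<Longrightarrow> (\<lambda>\<rho>. l \<rho> + c * l' \<rho>) \<in> \<Lambda>"
    and dual_form: "\<sigma> \<in> C \<Longrightarrow> \<rho> \<in> \<sigma> \<Longrightarrow> \<exists>l\<in>\<Lambda>. l \<rho> = 1 \<and> (\<forall>\<tau>\<in>\<sigma> - {\<rho>}. l \<tau> = 0)"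
begin

definition dual :: "'r set \<Rightarrow> 'r \<Rightarrow> 'r \<Rightarrow> real" where
  "dual \<sigma> \<rho> = (SOME l. l \<in> \<Lambda> \<and> l \<rho> = 1 \<and> (\<forall>\<tau>\<in>\<sigma> - {\<rho>}. l \<tau> = 0))"

lemma dual:
  assumes "\<sigma> \<in> C" "\<rho> \<in> \<sigma>"
  shows "dual \<sigma> \<rho> \<in> \<Lambda>" "dual \<sigma> \<rho> \<rho> = 1" "\<tau> \<in> \<sigma> \<Longrightarrow> \<tau> \<noteq> \<rho> \<Longrightarrow> dual \<sigma> \<rho> \<tau> = 0"
proof -
  have "\<exists>l. l \<in> \<Lambda> \<and> l \<rho> = 1 \<and> (\<forall>\<tau>\<in>\<sigma> - {\<rho>}. l \<tau> = 0)" using dual_form[OF assms] by blast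
  from someI_ex[OF this]
  show "dual \<sigma> \<rho> \<in> \<Lambda>" "dual \<sigma> \<rho> \<rho> = 1" "\<tau> \<in> \<sigma> \<Longrightarrow> \<tau> \<noteq> \<rho> \<Longrightarrow> dual \<sigma> \<rho> \<tau> = 0"
    by (auto simp: dual_def)
qed

lemma finite_cone: "\<sigma> \<in> C \<Longrightarrow> finite \<sigma>"
  using cone_rays finite_rays finite_subset by blast

lemma linear_diff_sum:
  "finite A \<Longrightarrow> l \<in> \<Lambda> \<Longrightarrow> (\<And>a. a \<in> A \<Longrightarrow> L a \<in> \<Lambda>) \<Longrightarrow> (\<lambda>\<rho>. l \<rho> - (\<Sum>a\<in>A. c a * L a \<rho>)) \<in> \<Lambda>"
proof (induction A rule: finite_induct)
  case (insert a A)
  then have "(\<lambda>\<rho>. l \<rho> - (\<Sum>a\<in>A. c a * L a \<rho>)) \<in> \<Lambda>" "L a \<in> \<Lambda>" by auto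
  from linear_combination[OF this, of "- c a"] insert.hyps show ?case by (simp add: algebra_simps)
qed simp

text \<open>Solves a linear relation for the term at \<open>\<rho>\<close>: inside
  \<open>\<sigma>\<close> the form \<open>l\<close> sees no other ray.\<close>

lemma dual_sum:
  fixes D :: "'r \<Rightarrow> real"
  assumes \<sigma>: "\<sigma> \<in> C" "\<rho> \<in> \<sigma>" and l: "l \<rho> = 1" "\<And>\<tau>. \<tau> \<in> \<sigma> \<Longrightarrow> \<tau> \<noteq> \<rho> \<Longrightarrow> l \<tau> = 0"
    and rel: "(\<Sum>\<tau>\<in>R. l \<tau> * D \<tau>) = 0"
  shows "D \<rho> = - (\<Sum>\<tau>\<in>R - \<sigma>. l \<tau> * D \<tau>)"
proof -
  have "(\<Sum>\<tau>\<in>\<sigma>. l \<tau> * D \<tau>) = (\<Sum>\<tau>\<in>\<sigma>. if \<tau> = \<rho> then D \<tau> else 0)"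
    by (rule sum.cong) (use l in auto)
  then have "(\<Sum>\<tau>\<in>\<sigma>. l \<tau> * D \<tau>) = D \<rho>" using \<sigma> finite_cone by simp
  then show ?thesis
    using rel sum.subset_diff[OF cone_rays[OF \<sigma>(1)] finite_rays, of "\<lambda>\<tau>. l \<tau> * D \<tau>"] by simp
qed

text \<open>A functional that kills the relations is determined by its square-free values: a dual form
  replaces one factor of a repeated variable by variables outside the support.\<close>

lemma functional_eq_0:
  fixes D :: "('r \<Rightarrow>\<^sub>0 nat) \<Rightarrow> real"
  assumes off: "\<And>m. mdeg m = d \<Longrightarrow> Poly_Mapping.keys m \<subseteq> R \<Longrightarrow> Poly_Mapping.keys m \<notin> C \<Longrightarrow> D m = 0"
    and sf: "\<And>m. mdeg m = d \<Longrightarrow> Poly_Mapping.keys m \<in> C \<Longrightarrow> card (Poly_Mapping.keys m) = d \<Longrightarrow> D m = 0"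
    and rel: "\<And>n l. mdeg n + 1 = d \<Longrightarrow> Poly_Mapping.keys n \<subseteq> R \<Longrightarrow> l \<in> \<Lambda> \<Longrightarrow>
      (\<Sum>\<rho>\<in>R. l \<rho> * D (n + mvar \<rho>)) = 0"
    and m: "mdeg m = d" "Poly_Mapping.keys m \<subseteq> R"
  shows "D m = 0"
  using m
proof (induction "d - card (Poly_Mapping.keys m)" arbitrary: m rule: less_induct)
  case less
  let ?\<sigma> = "Poly_Mapping.keys m"
  show ?case
  proof (cases "?\<sigma> \<in> C \<and> card ?\<sigma> \<noteq> d")
    case True
    then have lt: "card ?\<sigma> < d" using card_keys_le_mdeg[of m] less.prems by simp
    then obtain \<rho> where \<rho>: "Poly_Mapping.lookup m \<rho> \<ge> 2"
      using exists_lookup_ge_2[of m] less.prems by auto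
    \<comment> \<open>One copy of \<open>\<rho>\<close> is removed. As its exponent is at least 2,
      the support stays the same, and every replacement variable outside enlarges it.\<close>
    define n where "n = m - mvar \<rho>"
    have m_eq: "m = n + mvar \<rho>" unfolding n_def
      using \<rho> by (intro poly_mapping_eqI) (auto simp: lookup_add lookup_minus lookup_single when_def)
    have keys: "Poly_Mapping.keys n = ?\<sigma>" "\<rho> \<in> ?\<sigma>"
      using \<rho> by (auto simp: n_def in_keys_iff lookup_minus lookup_single when_def)
    have cone: "?\<sigma> \<in> C" using True by simp
    have "mdeg n + 1 = d" "Poly_Mapping.keys n \<subseteq> R"
      using less.prems m_eq keys by (simp_all add: mdeg_add)
    then have "(\<Sum>\<tau>\<in>R. dual ?\<sigma> \<rho> \<tau> * D (n + mvar \<tau>)) = 0"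
      by (rule rel) (rule dual(1)[OF cone keys(2)])
    then have "D (n + mvar \<rho>) = - (\<Sum>\<tau>\<in>R - ?\<sigma>. dual ?\<sigma> \<rho> \<tau> * D (n + mvar \<tau>))"
      by (intro dual_sum[OF cone keys(2)] dual[OF cone keys(2)])
    also have "(\<Sum>\<tau>\<in>R - ?\<sigma>. dual ?\<sigma> \<rho> \<tau> * D (n + mvar \<tau>)) = 0"
    proof (rule sum.neutral, rule ballI)
      fix \<tau> assume \<tau>: "\<tau> \<in> R - ?\<sigma>"
      have "D (n + mvar \<tau>) = 0"
      proof (rule less.hyps)
        show "d - card (Poly_Mapping.keys (n + mvar \<tau>)) < d - card ?\<sigma>"
          using \<tau> keys lt by (simp add: keys_add_nat)
        show "mdeg (n + mvar \<tau>) = d" using less.prems m_eq by (simp add: mdeg_add)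
        show "Poly_Mapping.keys (n + mvar \<tau>) \<subseteq> R" using \<tau> keys less.prems by (simp add: keys_add_nat)
      qed
      then show "dual ?\<sigma> \<rho> \<tau> * D (n + mvar \<tau>) = 0" by simp
    qed
    finally show ?thesis using m_eq by simp
  qed (use off sf less.prems in blast)
qed

end

text \<open>The balancing condition at a cone of codimension one says that the weighted sum of the
  neighbouring rays lies in the span of the cone; it is tested by the linear forms that vanish
  there. Weight 0 off the cones lets the sum run over all outer rays.\<close>

locale balanced_fan = simplicial_fan R C \<Lambda> d
  for R :: "'r set" and C \<Lambda> d +
  fixes w :: "'r set \<Rightarrow> real"
  assumes weight_off: "\<sigma> \<notin> C \<Longrightarrow> w \<sigma> = 0"
    and balanced: "\<sigma> \<in> C \<Longrightarrow> card \<sigma> + 1 = d \<Longrightarrow> l \<in> \<Lambda> \<Longrightarrow> (\<And>\<rho>. \<rho> \<in> \<sigma> \<Longrightarrow> l \<rho> = 0) \<Longrightarrow>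
      (\<Sum>\<rho>\<in>R - \<sigma>. l \<rho> * w (insert \<rho> \<sigma>)) = 0"
begin

text \<open>The value depends neither on the chosen variable nor on the chosen dual form; this is shown in
  the course of proving \<open>deg_relation\<close>.\<close>

function deg :: "('r \<Rightarrow>\<^sub>0 nat) \<Rightarrow> real" where
  "deg m = (if mdeg m \<noteq> d \<or> Poly_Mapping.keys m \<notin> C then 0
    else if card (Poly_Mapping.keys m) = d then w (Poly_Mapping.keys m)
    else let \<rho> = (SOME \<rho>. Poly_Mapping.lookup m \<rho> \<ge> 2) in
      - (\<Sum>\<tau>\<in>R - Poly_Mapping.keys m. dual (Poly_Mapping.keys m) \<rho> \<tau> *
        deg (m - mvar \<rho> + mvar \<tau>)))"
  by auto

lemma repeated_variable:
  assumes "mdeg m = d" "card (Poly_Mapping.keys m) \<noteq> d"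
  shows "Poly_Mapping.lookup m (SOME \<rho>. Poly_Mapping.lookup m \<rho> \<ge> 2) \<ge> 2"
  using exists_lookup_ge_2[of m] card_keys_le_mdeg[of m] assms
  by (intro someI_ex[of "\<lambda>\<rho>. Poly_Mapping.lookup m \<rho> \<ge> 2"]) auto

lemma keys_minus_mvar:
  "Poly_Mapping.lookup m \<rho> \<ge> 2 \<Longrightarrow> Poly_Mapping.keys (m - mvar \<rho>) = Poly_Mapping.keys m"
  by (auto simp: in_keys_iff lookup_minus lookup_single when_def)

termination
\<comment> \<open>The removed variable keeps a positive exponent and the new one lies outside the
  support, so the support grows while the degree stays \<open>d\<close>.\<close>
proof (relation "measure (\<lambda>m. d - card (Poly_Mapping.keys m))", goal_cases)
  case (2 m \<rho> \<tau>)
  then have "Poly_Mapping.lookup m \<rho> \<ge> 2" using repeated_variable by auto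
  moreover have "card (Poly_Mapping.keys m) < d"
    using 2 card_keys_le_mdeg[of m] by auto
  ultimately show ?case using 2 by (simp add: keys_add_nat keys_minus_mvar)
qed simp

declare deg.simps [simp del]

lemma deg_off: "mdeg m \<noteq> d \<or> Poly_Mapping.keys m \<notin> C \<Longrightarrow> deg m = 0"
  by (simp add: deg.simps)

lemma deg_square_free: "mdeg m = d \<Longrightarrow> card (Poly_Mapping.keys m) = d \<Longrightarrow> deg m = w (Poly_Mapping.keys m)"
  by (simp add: deg.simps weight_off)

lemma deg_rec:
  assumes "mdeg m = d" "Poly_Mapping.keys m \<in> C" "card (Poly_Mapping.keys m) \<noteq> d"
  obtains \<rho> where "Poly_Mapping.lookup m \<rho> \<ge> 2"
    "deg m = - (\<Sum>\<tau>\<in>R - Poly_Mapping.keys m. dual (Poly_Mapping.keys m) \<rho> \<tau> *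
        deg (m - mvar \<rho> + mvar \<tau>))"
  using that[OF repeated_variable[OF assms(1,3)]] assms by (simp add: deg.simps[of m] Let_def)

text \<open>Induction on the number of variables missing from the support of \<open>n\<close>. A
  form that vanishes on the support is treated by balancing or by expanding a repeated variable; a
  dual form gives the defining recursion, up to the choice of variable; a general form is a
  combination of these two kinds.\<close>

lemma deg_relation:
  assumes "mdeg n + 1 = d" "l \<in> \<Lambda>"
  shows "(\<Sum>\<rho>\<in>R. l \<rho> * deg (n + mvar \<rho>)) = 0"
  using assms
proof (induction "d - card (Poly_Mapping.keys n)" arbitrary: n l rule: less_induct)
  case less
  define \<sigma> where "\<sigma> = Poly_Mapping.keys n"
  show ?case
  proof (cases "\<sigma> \<in> C")
    case False
    have "deg (n + mvar \<rho>) = 0" for \<rho>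
      by (rule deg_off) (use False face_cone in \<open>auto simp: keys_add_nat \<sigma>_def\<close>)
    then show ?thesis by simp
  next
    case True
    note fin = finite_cone[OF True] and sub = cone_rays[OF True]
    have card: "card \<sigma> + 1 \<le> d" using card_keys_le_mdeg[of n] less.prems by (simp add: \<sigma>_def)
    \<comment> \<open>Here \<open>p\<close> stands for \<open>n\<close> with one copy of a repeated
      variable removed. Trading that copy for an outer variable \<open>\<kappa>\<close> keeps the
      degree and enlarges the support, so the induction hypothesis applies.\<close>
    have IH: "(\<Sum>\<tau>\<in>R. l \<tau> * deg (p + mvar \<kappa> + mvar \<tau>)) = 0"
      if "Poly_Mapping.keys p = \<sigma>" "mdeg p + 2 = d" "\<kappa> \<in> R - \<sigma>" "l \<in> \<Lambda>" for p \<kappa> l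
    proof (rule less.hyps)
      show "d - card (Poly_Mapping.keys (p + mvar \<kappa>)) < d - card (Poly_Mapping.keys n)"
        using that fin card by (simp add: keys_add_nat \<sigma>_def)
    qed (use that in \<open>auto simp: mdeg_add\<close>)
    have IH_vanish: "(\<Sum>\<tau>\<in>R - \<sigma>. l \<tau> * deg (p + mvar \<kappa> + mvar \<tau>)) = 0"
      if "Poly_Mapping.keys p = \<sigma>" "mdeg p + 2 = d" "\<kappa> \<in> R - \<sigma>" "l \<in> \<Lambda>" "\<And>\<rho>. \<rho> \<in> \<sigma> \<Longrightarrow> l \<rho> = 0" for p \<kappa> l
      using IH[OF that(1-4)] sum.subset_diff[OF sub finite_rays, of "\<lambda>\<tau>. l \<tau> * deg (p + mvar \<kappa> + mvar \<tau>)"]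
        that(5) by simp
    have IH_dual: "deg (p + mvar \<rho> + mvar \<kappa>) = - (\<Sum>\<tau>\<in>R - \<sigma>. dual \<sigma> \<rho> \<tau> * deg (p + mvar \<kappa> + mvar \<tau>))"
      if "Poly_Mapping.keys p = \<sigma>" "mdeg p + 2 = d" "\<kappa> \<in> R - \<sigma>" "\<rho> \<in> \<sigma>" for p \<kappa> \<rho>
      using dual_sum[OF True that(4), of "dual \<sigma> \<rho>" "\<lambda>\<tau>. deg (p + mvar \<kappa> + mvar \<tau>)"]
        IH[OF that(1-3)] dual[OF True that(4)]
      by (simp add: add.assoc add.commute[of "mvar \<rho>"])
    have split: "\<exists>p. n = p + mvar \<rho> \<and> Poly_Mapping.keys p = \<sigma> \<and> mdeg p + 2 = d"
      if "Poly_Mapping.lookup n \<rho> \<ge> 2" for \<rho>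
    proof (intro exI conjI)
      show eq: "n = (n - mvar \<rho>) + mvar \<rho>"
        using that by (intro poly_mapping_eqI) (auto simp: lookup_add lookup_minus lookup_single when_def)
      show "Poly_Mapping.keys (n - mvar \<rho>) = \<sigma>" by (simp add: keys_minus_mvar[OF that] \<sigma>_def)
      have "mdeg n = mdeg (n - mvar \<rho>) + 1" using arg_cong[OF eq, of mdeg] by (simp only: mdeg_add mdeg_single)
      then show "mdeg (n - mvar \<rho>) + 2 = d" using less.prems by simp
    qed
    have vanish: "(\<Sum>\<rho>\<in>R - \<sigma>. l \<rho> * deg (n + mvar \<rho>)) = 0"
      if l: "l \<in> \<Lambda>" "\<And>\<rho>. \<rho> \<in> \<sigma> \<Longrightarrow> l \<rho> = 0" for l
    proof (cases "card \<sigma> + 1 = d")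
      case eq: True
      have "deg (n + mvar \<rho>) = w (insert \<rho> \<sigma>)" if "\<rho> \<in> R - \<sigma>" for \<rho>
        using deg_square_free[of "n + mvar \<rho>"] that fin eq less.prems
        by (simp add: keys_add_nat mdeg_add \<sigma>_def)
      then show ?thesis using balanced[OF True eq l] by simp
    next
      case False
      then obtain \<rho>0 where r: "Poly_Mapping.lookup n \<rho>0 \<ge> 2"
        using exists_lookup_ge_2[of n] card less.prems by (auto simp: \<sigma>_def)
      then obtain p where p: "n = p + mvar \<rho>0" "Poly_Mapping.keys p = \<sigma>" "mdeg p + 2 = d"
        using split by blast
      have \<rho>0: "\<rho>0 \<in> \<sigma>" using r by (auto simp: \<sigma>_def in_keys_iff)
      \<comment> \<open>Expanding \<open>\<rho>0\<close> in every term gives a double sum over outer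
        rays whose degrees are symmetric in the two rays; after exchanging the sums, the inner one
        is the relation for \<open>l\<close> on a larger support.\<close>
      have "(\<Sum>\<rho>\<in>R - \<sigma>. l \<rho> * deg (n + mvar \<rho>)) =
        (\<Sum>\<rho>\<in>R - \<sigma>. \<Sum>\<tau>\<in>R - \<sigma>. - (l \<rho> * (dual \<sigma> \<rho>0 \<tau> * deg (p + mvar \<rho> + mvar \<tau>))))"
        using p IH_dual[OF p(2,3) _ \<rho>0] by (simp add: sum_distrib_left sum_negf)
      also have "\<dots> = (\<Sum>\<tau>\<in>R - \<sigma>. \<Sum>\<rho>\<in>R - \<sigma>. - (l \<rho> * (dual \<sigma> \<rho>0 \<tau> * deg (p + mvar \<rho> + mvar \<tau>))))"
        by (rule sum.swap)
      also have "\<dots> = (\<Sum>\<tau>\<in>R - \<sigma>. - dual \<sigma> \<rho>0 \<tau> * (\<Sum>\<rho>\<in>R - \<sigma>. l \<rho> * deg (p + mvar \<tau> + mvar \<rho>)))"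
        by (simp add: sum_distrib_left sum_negf ac_simps)
      also have "\<dots> = 0"
        using IH_vanish[OF p(2,3) _ l] by simp
      finally show ?thesis .
    qed
    have dual_rel: "deg (n + mvar \<rho>) = - (\<Sum>\<tau>\<in>R - \<sigma>. dual \<sigma> \<rho> \<tau> * deg (n + mvar \<tau>))"
      if \<rho>: "\<rho> \<in> \<sigma>" for \<rho>
    proof -
      have keys: "Poly_Mapping.keys (n + mvar \<rho>) = \<sigma>" using \<rho> by (auto simp: keys_add_nat \<sigma>_def)
      have "mdeg (n + mvar \<rho>) = d" "Poly_Mapping.keys (n + mvar \<rho>) \<in> C"
        "card (Poly_Mapping.keys (n + mvar \<rho>)) \<noteq> d"
        using less.prems True card by (auto simp: mdeg_add keys)
      \<comment> \<open>The recursion may have selected a repeated variable \<open>\<rho>'\<close>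
        other than \<open>\<rho>\<close>. Expanding both variables gives the same symmetric double
        sum in either order, which proves independence of the choice.\<close>
      from deg_rec[OF this] obtain \<rho>' where \<rho>': "Poly_Mapping.lookup (n + mvar \<rho>) \<rho>' \<ge> 2"
        and deg: "deg (n + mvar \<rho>) = - (\<Sum>\<tau>\<in>R - \<sigma>. dual \<sigma> \<rho>' \<tau> * deg (n + mvar \<rho> - mvar \<rho>' + mvar \<tau>))"
        unfolding keys by blast
      show ?thesis
      proof (cases "\<rho>' = \<rho>")
        case True
        then show ?thesis using deg by simp
      next
        case False
        then have r: "Poly_Mapping.lookup n \<rho>' \<ge> 2" using \<rho>' by (simp add: lookup_add lookup_single)
        then obtain p where p: "n = p + mvar \<rho>'" "Poly_Mapping.keys p = \<sigma>" "mdeg p + 2 = d"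
          using split by blast
        have \<rho>'_in: "\<rho>' \<in> \<sigma>" using r by (auto simp: \<sigma>_def in_keys_iff)
        have "n + mvar \<rho> - mvar \<rho>' = p + mvar \<rho>" 
          by (intro poly_mapping_eqI) (simp add: p(1) lookup_add lookup_minus)
        then have "deg (n + mvar \<rho>) = - (\<Sum>\<tau>\<in>R - \<sigma>. dual \<sigma> \<rho>' \<tau> * deg (p + mvar \<rho> + mvar \<tau>))"
          using deg by simp
        also have "\<dots> = (\<Sum>\<tau>\<in>R - \<sigma>. \<Sum>\<kappa>\<in>R - \<sigma>. dual \<sigma> \<rho>' \<tau> * (dual \<sigma> \<rho> \<kappa> * deg (p + mvar \<tau> + mvar \<kappa>)))"
          using IH_dual[OF p(2,3) _ \<rho>] by (simp add: sum_distrib_left sum_negf)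
        also have "\<dots> = (\<Sum>\<kappa>\<in>R - \<sigma>. \<Sum>\<tau>\<in>R - \<sigma>. dual \<sigma> \<rho>' \<tau> * (dual \<sigma> \<rho> \<kappa> * deg (p + mvar \<tau> + mvar \<kappa>)))"
          by (rule sum.swap)
        also have "\<dots> = (\<Sum>\<kappa>\<in>R - \<sigma>. \<Sum>\<tau>\<in>R - \<sigma>. dual \<sigma> \<rho> \<kappa> * (dual \<sigma> \<rho>' \<tau> * deg (p + mvar \<kappa> + mvar \<tau>)))"
          by (simp add: ac_simps)
        also have "\<dots> = - (\<Sum>\<kappa>\<in>R - \<sigma>. dual \<sigma> \<rho> \<kappa> * deg (p + mvar \<rho>' + mvar \<kappa>))"
          using IH_dual[OF p(2,3) _ \<rho>'_in] by (simp add: sum_distrib_left sum_negf)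
        finally show ?thesis using p(1) by simp
      qed
    qed
    \<comment> \<open>Subtracting the expansion of \<open>l\<close> in the dual basis of
      \<open>\<sigma>\<close> leaves a form that vanishes on \<open>\<sigma>\<close>.\<close>
    define l' where "l' = (\<lambda>\<tau>. l \<tau> - (\<Sum>\<rho>\<in>\<sigma>. l \<rho> * dual \<sigma> \<rho> \<tau>))"
    have "l' \<in> \<Lambda>" unfolding l'_def
      by (rule linear_diff_sum) (use fin less.prems dual[OF True] in auto)
    moreover have "l' \<rho> = 0" if "\<rho> \<in> \<sigma>" for \<rho>
    proof -
      have "(\<Sum>\<kappa>\<in>\<sigma>. l \<kappa> * dual \<sigma> \<kappa> \<rho>) = (\<Sum>\<kappa>\<in>\<sigma>. if \<kappa> = \<rho> then l \<rho> else 0)"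
        by (rule sum.cong) (use dual[OF True] that in auto)
      then show ?thesis using fin that by (simp add: l'_def)
    qed
    ultimately have 0: "(\<Sum>\<tau>\<in>R - \<sigma>. l' \<tau> * deg (n + mvar \<tau>)) = 0" by (rule vanish)
    have "(\<Sum>\<rho>\<in>\<sigma>. l \<rho> * deg (n + mvar \<rho>)) =
      (\<Sum>\<rho>\<in>\<sigma>. \<Sum>\<tau>\<in>R - \<sigma>. - (l \<rho> * (dual \<sigma> \<rho> \<tau> * deg (n + mvar \<tau>))))"
      using dual_rel by (simp add: sum_distrib_left sum_negf)
    also have "\<dots> = (\<Sum>\<tau>\<in>R - \<sigma>. \<Sum>\<rho>\<in>\<sigma>. - (l \<rho> * (dual \<sigma> \<rho> \<tau> * deg (n + mvar \<tau>))))"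
      by (rule sum.swap)
    also have "\<dots> = (\<Sum>\<tau>\<in>R - \<sigma>. - ((\<Sum>\<rho>\<in>\<sigma>. l \<rho> * dual \<sigma> \<rho> \<tau>) * deg (n + mvar \<tau>)))"
      by (simp add: sum_distrib_right sum_negf ac_simps)
    finally have "(\<Sum>\<rho>\<in>R. l \<rho> * deg (n + mvar \<rho>)) = (\<Sum>\<tau>\<in>R - \<sigma>. l' \<tau> * deg (n + mvar \<tau>))"
      using sum.subset_diff[OF sub finite_rays, of "\<lambda>\<tau>. l \<tau> * deg (n + mvar \<tau>)"]
      by (simp add: l'_def sum_negf sum_subtractf algebra_simps)
    with 0 show ?thesis by simp
  qed
qed

end

section \<open>Flats of matroids\<close>

lemma finite_chain_Union: "finite S \<Longrightarrow> S \<noteq> {} \<Longrightarrow> S \<in> chains T \<Longrightarrow> \<Union>S \<in> S"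
proof (induction S rule: finite_ne_induct)
  case (insert x F)
  then have F: "F \<in> chains T" by (auto simp: chains_def chain_subset_def)
  with insert have "\<Union>F \<in> F" by simp
  moreover from this have "x \<subseteq> \<Union>F \<or> \<Union>F \<subseteq> x"
    using insert.prems by (intro chainsD[OF insert.prems]) auto
  ultimately show ?case by (auto simp: Un_absorb1 Un_absorb2 Un_commute)
qed simp

lemma finite_chain_Inter: "finite S \<Longrightarrow> S \<noteq> {} \<Longrightarrow> S \<in> chains T \<Longrightarrow> \<Inter>S \<in> S"
proof (induction S rule: finite_ne_induct)
  case (insert x F)
  then have F: "F \<in> chains T" by (auto simp: chains_def chain_subset_def)
  with insert have "\<Inter>F \<in> F" by simp
  moreover from this have "x \<subseteq> \<Inter>F \<or> \<Inter>F \<subseteq> x"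
    using insert.prems by (intro chainsD[OF insert.prems]) auto
  ultimately show ?case by (auto simp: Int_absorb1 Int_absorb2 Int_commute)
qed simp

lemma chains_subset: "C \<in> chains S \<Longrightarrow> D \<subseteq> C \<Longrightarrow> D \<in> chains S"
  unfolding chains_def chain_subset_def by blast

lemma chains_insert:
  "insert G C \<in> chains S \<longleftrightarrow> G \<in> S \<and> C \<in> chains S \<and> (\<forall>F\<in>C. F \<subseteq> G \<or> G \<subseteq> F)"
  unfolding chains_def chain_subset_def by blast

lemma chains_image:
  assumes "C \<in> chains S" "\<And>X. X \<in> C \<Longrightarrow> f X \<in> T" "\<And>X Y. X \<subseteq> Y \<Longrightarrow> f X \<subseteq> f Y"
  shows "f ` C \<in> chains T"
proof -
  have "f X \<subseteq> f Y \<or> f Y \<subseteq> f X" if "X \<in> C" "Y \<in> C" for X Y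
    using chainsD[OF assms(1) that] assms(3) by blast
  with assms(2) show ?thesis by (simp add: chains_def chain_subset_def image_subset_iff)
qed

text \<open>The empty set is a sentinel for the case that no member lies below \<open>G\<close>; the
  ground set plays this role above.\<close>

lemma chain_predecessor:
  assumes "finite \<sigma>" "\<sigma> \<in> chains S" "{} \<subset> G"
  obtains A where "A \<in> insert {} \<sigma>" "A \<subset> G" "\<And>F. F \<in> \<sigma> \<Longrightarrow> F \<subset> G \<Longrightarrow> F \<subseteq> A"
proof (cases "{F\<in>\<sigma>. F \<subset> G} = {}")
  case True
  then show ?thesis using that[of "{}"] assms(3) by blast
next
  case False
  then have "\<Union>{F\<in>\<sigma>. F \<subset> G} \<in> {F\<in>\<sigma>. F \<subset> G}"
    using assms(1) by (intro finite_chain_Union[where T=S] chains_subset[OF assms(2)]) auto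
  then show ?thesis using that[of "\<Union>{F\<in>\<sigma>. F \<subset> G}"] by blast
qed

lemma chain_successor:
  assumes "finite \<sigma>" "\<sigma> \<in> chains S" "G \<subset> E" "\<And>F. F \<in> \<sigma> \<Longrightarrow> F \<subseteq> E"
  obtains B where "B \<in> insert E \<sigma>" "G \<subset> B" "\<And>F. F \<in> \<sigma> \<Longrightarrow> G \<subset> F \<Longrightarrow> B \<subseteq> F"
proof (cases "{F\<in>\<sigma>. G \<subset> F} = {}")
  case True
  then show ?thesis using that[of E] assms(3) by blast
next
  case False
  then have "\<Inter>{F\<in>\<sigma>. G \<subset> F} \<in> {F\<in>\<sigma>. G \<subset> F}"
    using assms(1) by (intro finite_chain_Inter[where T=S] chains_subset[OF assms(2)]) auto
  then show ?thesis using that[of "\<Inter>{F\<in>\<sigma>. G \<subset> F}"] by blast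
qed

context matroid
begin

lemma finite_flats: "finite L"
  by (rule finite_subset[of _ "Pow E"]) (use flats_subset finite_ground in auto)

lemma Inter_flat: "finite S \<Longrightarrow> S \<noteq> {} \<Longrightarrow> S \<subseteq> L \<Longrightarrow> \<Inter>S \<in> L"
  by (induction S rule: finite_ne_induct) (auto intro: inter_flat)

lemma closure_flat: "A \<subseteq> E \<Longrightarrow> flat_closure L A \<in> L"
  unfolding flat_closure_def
  by (rule Inter_flat) (use finite_flats ground_flat in auto)

lemma closure_superset: "A \<subseteq> flat_closure L A"
  by (auto simp: flat_closure_def)

lemma closure_least: "F \<in> L \<Longrightarrow> A \<subseteq> F \<Longrightarrow> flat_closure L A \<subseteq> F"
  by (auto simp: flat_closure_def)

lemma closure_of_flat: "F \<in> L \<Longrightarrow> flat_closure L F = F"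
  using closure_superset closure_least by blast

lemma closure_mono: "A \<subseteq> B \<Longrightarrow> flat_closure L A \<subseteq> flat_closure L B"
  by (auto simp: flat_closure_def)

text \<open>The cover of \<open>F\<close> through \<open>a\<close> contains the closure, and equals
  it because a cover leaves no flat strictly between.\<close>

lemma closure_insert_covers:
  assumes "F \<in> L" "a \<in> E - F" "H \<in> L" "F \<subset> H" "H \<subseteq> flat_closure L (insert a F)"
  shows "H = flat_closure L (insert a F)"
proof -
  obtain G where G: "G \<in> L" "F \<subset> G" "\<not> (\<exists>H\<in>L. F \<subset> H \<and> H \<subset> G)" "a \<in> G"
    using ex1_implies_ex[OF cover_partition[OF assms(1,2)]] by (elim exE conjE)
  let ?K = "flat_closure L (insert a F)"
  have "?K \<in> L" using assms flats_subset by (intro closure_flat) auto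
  moreover have "?K \<subseteq> G" using G by (intro closure_least) auto
  moreover have "F \<subset> ?K" using closure_superset[of "insert a F"] assms(2) by auto
  ultimately have "?K = G" using G(3) by (metis psubsetI)
  then show ?thesis using G(3) assms by (metis psubsetI)
qed

text \<open>The exchange property: the closure through \<open>b\<close> is a flat strictly above
  \<open>F\<close> inside a cover of \<open>F\<close>.\<close>

lemma closure_insert_eq:
  assumes "F \<in> L" "a \<in> E - F" "b \<in> flat_closure L (insert a F)" "b \<notin> F"
  shows "flat_closure L (insert b F) = flat_closure L (insert a F)"
proof (rule closure_insert_covers[OF assms(1,2)])
  have cl: "flat_closure L (insert a F) \<in> L"
    using assms flats_subset by (intro closure_flat) auto
  have "b \<in> E" using flats_subset[OF cl] assms(3) by blast
  then show "flat_closure L (insert b F) \<in> L"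
    using assms flats_subset by (intro closure_flat) auto
  show "F \<subset> flat_closure L (insert b F)" using closure_superset[of "insert b F"] assms(4) by blast
  show "flat_closure L (insert b F) \<subseteq> flat_closure L (insert a F)"
    using closure_superset[of "insert a F"] assms(3) by (intro closure_least cl) auto
qed

text \<open>Adding an element \<open>a\<close> of the second flat of \<open>C\<close> to every member of \<open>D\<close> merges at most one pair
  of neighbours, since the closure of \<open>insert a G\<close> covers \<open>G\<close>.\<close>

lemma chain_card_le_above:
  assumes "C \<in> chains {G\<in>L. F \<subseteq> G}" "F \<in> L"
    and "\<And>G. G \<in> L \<Longrightarrow> F \<subseteq> G \<Longrightarrow> (\<And>X. X \<in> C \<Longrightarrow> X \<subseteq> G \<or> G \<subseteq> X) \<Longrightarrow> G \<in> C"
    and "D \<in> chains {G\<in>L. F \<subseteq> G}"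
  shows "card D \<le> card C"
  using assms
proof (induction "card C" arbitrary: C D F rule: less_induct)
  case less
  note chain = less.prems(1) and F = less.prems(2) and max = less.prems(3) and D = less.prems(4)
  have finC: "finite C" and finD: "finite D"
    using finite_subset[OF chainsD2[OF chain]] finite_subset[OF chainsD2[OF D]] finite_flats by auto
  have FC: "F \<in> C" by (rule max[OF F]) (use chainsD2[OF chain] in auto)
  have EC: "E \<in> C" by (rule max) (use chainsD2[OF chain] F flats_subset ground_flat in auto)
  define C' where "C' = C - {F}"
  have C': "C' \<in> chains {G\<in>L. F \<subseteq> G}" using chains_subset[OF chain] by (auto simp: C'_def)
  show ?case
  proof (cases "C' = {}")
    case True
    then have "C = {F}" "F = E" using FC EC by (auto simp: C'_def)
    then have "D \<subseteq> {F}" using chainsD2[OF D] flats_subset by auto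
    then have "card D \<le> card {F}" by (rule card_mono[rotated]) simp
    with \<open>C = {F}\<close> show ?thesis by simp
  next
    case False
    define F1 where "F1 = \<Inter>C'"
    have "F1 \<in> C'" unfolding F1_def
      using finite_chain_Inter[OF _ False C'] finC by (simp add: C'_def)
    then have F1: "F1 \<in> L" "F \<subset> F1" "F1 \<in> C" and F1_le: "\<And>X. X \<in> C' \<Longrightarrow> F1 \<subseteq> X"
      using chainsD2[OF C'] by (auto simp: C'_def F1_def)
    obtain a where a: "a \<in> F1" "a \<notin> F" using F1 by blast
    have aE: "a \<in> E" using a F1 flats_subset by blast
    define f where "f G = flat_closure L (insert a G)" for G
    have f_flat: "f G \<in> L" if "G \<in> L" for G
      using that aE flats_subset unfolding f_def by (intro closure_flat) auto
    have f_mono: "G \<subseteq> H \<Longrightarrow> f G \<subseteq> f H" for G H unfolding f_def by (rule closure_mono) auto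
    have f_id: "f G = G" if "G \<in> L" "a \<in> G" for G
      using that closure_of_flat[of G] by (simp add: f_def insert_absorb)
    have f_sup: "G \<subseteq> f G" "a \<in> f G" for G using closure_superset[of "insert a G"] by (auto simp: f_def)
    have f_F: "F1 \<subseteq> f F"
    proof -
      have le: "f F \<subseteq> F1" unfolding f_def using a F1 by (intro closure_least) auto
      \<comment> \<open>This closure lies between \<open>F\<close> and \<open>F1\<close>, so it is
        comparable to all of \<open>C\<close> and maximality puts it into \<open>C\<close>.\<close>
      have "f F \<in> C"
      proof (rule max[OF f_flat[OF F] f_sup(1)])
        fix X assume "X \<in> C"
        then show "X \<subseteq> f F \<or> f F \<subseteq> X"
          using F1_le[of X] le f_sup(1)[of F] by (cases "X = F") (auto simp: C'_def)
      qed
      then show ?thesis using F1_le f_sup(2)[of F] a by (auto simp: C'_def)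
    qed
    have D': "f ` D \<in> chains {G\<in>L. F1 \<subseteq> G}"
    proof -
      have "f G \<in> L \<and> F1 \<subseteq> f G" if "G \<in> D" for G
        using that chainsD2[OF D] f_flat[of G] order_trans[OF f_F f_mono[of F G]] by blast
      moreover have "f G \<subseteq> f H \<or> f H \<subseteq> f G" if "G \<in> D" "H \<in> D" for G H
        using chainsD[OF D that] f_mono by blast
      ultimately show ?thesis by (auto simp: chains_def chain_subset_def)
    qed
    have "card (f ` D) \<le> card C'"
    proof (rule less.hyps[OF _ _ F1(1) _ D'])
      show "card C' < card C" unfolding C'_def by (rule card_Diff1_less[OF finC FC])
      show "C' \<in> chains {G\<in>L. F1 \<subseteq> G}"
        using C' F1_le by (auto simp: chains_def)
      fix G assume G: "G \<in> L" "F1 \<subseteq> G" "\<And>X. X \<in> C' \<Longrightarrow> X \<subseteq> G \<or> G \<subseteq> X"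
      have "G \<in> C" by (rule max) (use G F1 in \<open>auto simp: C'_def\<close>)
      then show "G \<in> C'" using G F1 by (auto simp: C'_def)
    qed
    moreover have "card D \<le> card (f ` D) + 1"
    proof -
      define D0 where "D0 = {G\<in>D. a \<notin> G}"
      \<comment> \<open>The exception \<open>M\<close> is the largest member of \<open>D\<close>
        avoiding \<open>a\<close>, if there is one.\<close>
      have "\<exists>M. inj_on f (D - {M})"
      proof (cases "D0 = {}")
        case True
        then have "inj_on f D"
          unfolding inj_on_def D0_def using f_id chainsD2[OF D] by (metis (mono_tags, lifting) empty_Collect_eq mem_Collect_eq subsetD)
        then show ?thesis by (meson Diff_subset inj_on_subset)
      next
        case False
        have "\<Union>D0 \<in> D0"
          by (rule finite_chain_Union[OF _ False chains_subset[OF D]]) (use finD in \<open>auto simp: D0_def\<close>)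
        then obtain M where M: "M \<in> D" "a \<notin> M" "\<And>G. G \<in> D \<Longrightarrow> a \<notin> G \<Longrightarrow> G \<subseteq> M"
          unfolding D0_def by blast
        \<comment> \<open>If \<open>f\<close> identified \<open>G\<close> with a larger
          \<open>H\<close>, then \<open>H = f G\<close> would contain \<open>a\<close>, hence also
          \<open>M\<close>. As \<open>f G\<close> covers \<open>G\<close>, this forces
          \<open>M = f G\<close>, although \<open>a\<close> is not in \<open>M\<close>.\<close>
        have less_neq: "f G \<noteq> f H" if GH: "G \<in> D" "H \<in> D" "G \<noteq> M" "G \<subset> H" for G H
        proof
          assume eq: "f G = f H"
          have L: "G \<in> L" "H \<in> L" "M \<in> L" using GH M chainsD2[OF D] by auto
          have aG: "a \<notin> G" using f_id[of G] f_id[of H] eq GH L by blast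
          have GM: "G \<subset> M" using M(3)[OF GH(1) aG] GH by blast
          have cov: "X = f G" if "X \<in> L" "G \<subset> X" "X \<subseteq> f G" for X
            using closure_insert_covers[of G a X] that L aE aG by (simp add: f_def)
          have "H = f G" using cov[OF L(2) GH(4)] f_sup(1)[of H] eq by simp
          then have "M \<subseteq> f G" using chainsD[OF D M(1) GH(2)] M(2) f_sup(2)[of G] by blast
          then have "M = f G" using cov[OF L(3) GM] by simp
          then show False using M f_sup(2)[of G] by simp
        qed
        have "inj_on f (D - {M})"
        proof (rule inj_onI, rule ccontr)
          fix G H assume *: "G \<in> D - {M}" "H \<in> D - {M}" "f G = f H" "G \<noteq> H"
          then have "G \<subset> H \<or> H \<subset> G" using chainsD[OF D, of G H] by blast
          then show False using less_neq[of G H] less_neq[of H G] * by auto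
        qed
        then show ?thesis by blast
      qed
      then obtain M where M: "inj_on f (D - {M})" by blast
      have "card D \<le> card (D - {M}) + 1" by (simp add: card_Diff_singleton_if) linarith
      also have "card (D - {M}) = card (f ` (D - {M}))" using card_image[OF M] by simp
      also have "\<dots> \<le> card (f ` D)" using finD by (intro card_mono) auto
      finally show ?thesis by simp
    qed
    moreover have "card C = card C' + 1" using card_Suc_Diff1[OF finC FC] by (simp add: C'_def)
    ultimately show ?thesis by simp
  qed
qed

end

section \<open>Rank and purity\<close>

lemma chain_card_le_rank:
  assumes "finite L" "C \<in> chains L"
  shows "card C \<le> matroid_rank L + 1"
proof -
  have "finite (card ` chains L)"
    by (rule finite_imageI, rule finite_subset[of _ "Pow L"]) (use assms(1) chainsD2 in auto)
  then have "card C \<le> Max (card ` chains L)" using assms(2) by (intro Max_ge) auto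
  then show ?thesis by (simp add: matroid_rank_def)
qed

lemma rank_chain_exists:
  assumes "finite L" "L \<noteq> {}"
  obtains C where "C \<in> chains L" "card C = matroid_rank L + 1"
proof -
  have fin: "finite (card ` chains L)"
    by (rule finite_imageI, rule finite_subset[of _ "Pow L"]) (use assms(1) chainsD2 in auto)
  obtain F where "F \<in> L" using assms(2) by blast
  then have F: "{F} \<in> chains L" by (auto simp: chains_def chain_subset_def)
  then have "Max (card ` chains L) \<in> card ` chains L" using fin by (intro Max_in) auto
  then obtain C where C: "C \<in> chains L" "card C = Max (card ` chains L)" by auto
  \<comment> \<open>A singleton chain makes the maximum at least 1, so the truncated subtraction in
    \<open>matroid_rank\<close> is exact.\<close>
  have "card {F} \<le> Max (card ` chains L)" using F fin by (intro Max_ge imageI) auto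
  then show ?thesis using that[OF C(1)] C(2) by (simp add: matroid_rank_def)
qed

text \<open>The number \<open>d\<close> is the dimension of the Bergman fan: a longest chain of
  flats has \<open>d + 2\<close> members, two of which are the trivial flats.\<close>

locale loopless_matroid = matroid +
  fixes d :: nat
  assumes empty_flat: "{} \<in> L" and rank: "matroid_rank L = d + 1"
begin

abbreviation N where "N \<equiv> nontrivial_flats E L"

lemma ground_nonempty: "E \<noteq> {}"
proof
  assume "E = {}"
  then have "L \<subseteq> {{}}" using flats_subset by auto
  moreover obtain C where "C \<in> chains L" "card C = matroid_rank L + 1"
    using rank_chain_exists[OF finite_flats] empty_flat by blast
  ultimately have "card C \<le> card {{} :: 'a set}" using chainsD2 by (intro card_mono) auto
  then show False using \<open>card C = matroid_rank L + 1\<close> rank by simp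
qed

lemma chain_card_le: "C \<in> chains L \<Longrightarrow> card C \<le> d + 2"
  using chain_card_le_rank[OF finite_flats] rank by simp

lemma maximal_chain_card:
  assumes "C \<in> chains L" "\<And>G. G \<in> L \<Longrightarrow> (\<And>X. X \<in> C \<Longrightarrow> X \<subseteq> G \<or> G \<subseteq> X) \<Longrightarrow> G \<in> C"
  shows "card C = d + 2"
proof -
  obtain D where D: "D \<in> chains L" "card D = d + 2"
    using rank_chain_exists[OF finite_flats] empty_flat rank by (metis add_Suc_right empty_iff one_add_one plus_1_eq_Suc add.assoc)
  have "card D \<le> card C"
    by (rule chain_card_le_above[of _ "{}"]) (use assms D empty_flat in auto)
  then show ?thesis using chain_card_le[OF assms(1)] D by simp
qed

lemma finite_N: "finite N"
  using finite_flats by (auto simp: nontrivial_flats_def)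

lemma N_iff: "F \<in> N \<longleftrightarrow> F \<in> L \<and> F \<noteq> {} \<and> F \<noteq> E"
  by (auto simp: nontrivial_flats_def)

lemma extend_chain: "\<sigma> \<in> chains N \<Longrightarrow> insert {} (insert E \<sigma>) \<in> chains L"
proof -
  assume \<sigma>: "\<sigma> \<in> chains N"
  then have "\<sigma> \<subseteq> L" by (auto simp: chains_def N_iff)
  moreover from this \<sigma> have "\<sigma> \<in> chains L" by (simp add: chains_def)
  ultimately show ?thesis
    using flats_subset empty_flat ground_flat by (auto simp: chains_insert)
qed

lemma card_extend_chain:
  assumes "\<sigma> \<in> chains N"
  shows "card (insert {} (insert E \<sigma>)) = card \<sigma> + 2"
proof -
  have "finite \<sigma>" "{} \<notin> \<sigma>" "E \<notin> \<sigma>"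
    using chainsD2[OF assms] finite_N finite_subset by (auto simp: N_iff)
  then show ?thesis using ground_nonempty by simp
qed

lemma nontrivial_chain_card_le: "\<sigma> \<in> chains N \<Longrightarrow> card \<sigma> \<le> d"
  using chain_card_le[OF extend_chain] card_extend_chain by fastforce

text \<open>Purity of the Bergman fan: if nothing can be inserted, adding the two trivial flats
  gives an inextensible chain of \<open>d + 2\<close> flats.\<close>

lemma chain_extension_exists:
  assumes "\<sigma> \<in> chains N" "card \<sigma> \<noteq> d"
  obtains G where "G \<in> N - \<sigma>" "insert G \<sigma> \<in> chains N"
proof -
  note extension = that
  have "card (insert {} (insert E \<sigma>)) = d + 2" if no: "\<not> thesis"
  proof (rule maximal_chain_card[OF extend_chain[OF assms(1)]], rule ccontr)
    fix G assume G: "G \<in> L" "\<And>X. X \<in> insert {} (insert E \<sigma>) \<Longrightarrow> X \<subseteq> G \<or> G \<subseteq> X"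
      "G \<notin> insert {} (insert E \<sigma>)"
    have "G \<in> N - \<sigma>" using G by (simp add: N_iff)
    moreover have "insert G \<sigma> \<in> chains N"
      unfolding chains_insert using G(2) assms(1) \<open>G \<in> N - \<sigma>\<close> by simp
    ultimately show False using extension[of G] no by simp
  qed
  then show thesis using card_extend_chain[OF assms(1)] assms(2) by auto
qed

text \<open>Two comparable extensions could be inserted together, giving a chain of
  \<open>d + 1\<close> nontrivial flats.\<close>

lemma chain_extensions_incomparable:
  assumes "\<sigma> \<in> chains N" "card \<sigma> + 1 = d" "G \<in> N - \<sigma>" "insert G \<sigma> \<in> chains N"
    "H \<in> N - \<sigma>" "insert H \<sigma> \<in> chains N" "G \<subseteq> H"
  shows "G = H"
proof (rule ccontr)
  assume neq: "G \<noteq> H"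
  have "insert G (insert H \<sigma>) \<in> chains N" using assms by (auto simp: chains_insert)
  moreover have "finite \<sigma>" using finite_subset[OF chainsD2[OF assms(1)] finite_N] .
  ultimately show False using nontrivial_chain_card_le[of "insert G (insert H \<sigma>)"] assms neq by simp
qed

end

section \<open>The degree map on the Chow ring\<close>

lemma global_linear_add: "l \<in> global_linear E \<Longrightarrow> l (\<lambda>a. u a + v a) = l u + l v"
  and global_linear_scale: "l \<in> global_linear E \<Longrightarrow> l (\<lambda>a. c * u a) = c * l u"
  and global_linear_ground: "l \<in> global_linear E \<Longrightarrow> l (indicator E) = 0"
  by (simp_all add: global_linear_def)

lemma global_linear_0: "l \<in> global_linear E \<Longrightarrow> l (\<lambda>a. 0) = 0"
  using global_linear_scale[of l E 0 "\<lambda>a. 0"] by simp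

lemma global_linear_empty: "l \<in> global_linear E \<Longrightarrow> l (indicator {}) = 0"
  using global_linear_0[of l E] by (simp add: indicator_def[abs_def])

lemma global_linear_sum: "l \<in> global_linear E \<Longrightarrow> l (\<lambda>a. \<Sum>x\<in>X. f x a) = (\<Sum>x\<in>X. l (f x))"
proof (induction X rule: infinite_finite_induct)
  case (insert x X)
  then show ?case using global_linear_add[of l E "f x" "\<lambda>a. \<Sum>x\<in>X. f x a"] by simp
qed (auto simp: global_linear_0)

lemma global_linear_combination:
  assumes "l \<in> global_linear E" "l' \<in> global_linear E"
  shows "(\<lambda>u. l u + c * l' u) \<in> global_linear E"
  using assms
  by (auto simp: global_linear_def) (simp_all add: algebra_simps)

lemma global_linear_coordinates:
  "a \<in> E \<Longrightarrow> b \<in> E \<Longrightarrow> (\<lambda>u. u a - u b) \<in> global_linear E"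
  by (auto simp: global_linear_def algebra_simps)

definition ray_forms :: "('r, 'a) fan \<Rightarrow> ('r \<Rightarrow> real) set" where
  "ray_forms \<Delta> = {\<lambda>\<rho>. l (ray_vector \<Delta> \<rho>) | l. l \<in> global_linear (ground \<Delta>)}"

lemma linear_relations_ray_forms:
  "linear_relations \<Delta> = {\<Sum>\<rho>\<in>rays \<Delta>. Const (l \<rho>) * Var \<rho> | l. l \<in> ray_forms \<Delta>}"
  by (auto simp: linear_relations_def ray_forms_def)

lemma ray_forms_combination:
  assumes "l \<in> ray_forms \<Delta>" "l' \<in> ray_forms \<Delta>"
  shows "(\<lambda>\<rho>. l \<rho> + c * l' \<rho>) \<in> ray_forms \<Delta>"
proof -
  obtain k k' where "k \<in> global_linear (ground \<Delta>)" "k' \<in> global_linear (ground \<Delta>)"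
    "l = (\<lambda>\<rho>. k (ray_vector \<Delta> \<rho>))" "l' = (\<lambda>\<rho>. k' (ray_vector \<Delta> \<rho>))"
    using assms by (auto simp: ray_forms_def)
  then show ?thesis
    unfolding ray_forms_def
    by (intro CollectI exI[of _ "\<lambda>u. k u + c * k' u"]) (simp add: global_linear_combination)
qed

locale balanced_chow = balanced_fan "rays \<Delta>" "cones \<Delta>" "ray_forms \<Delta>" d w
  for \<Delta> :: "('r, 'a) fan" and d :: nat and w :: "'r set \<Rightarrow> real" +
  assumes cone_card_le: "\<sigma> \<in> cones \<Delta> \<Longrightarrow> card \<sigma> \<le> d"
begin

lemma deg_cone: "\<sigma> \<in> cones \<Delta> \<Longrightarrow> card \<sigma> = d \<Longrightarrow> lin_ext deg (\<Prod>\<rho>\<in>\<sigma>. Var \<rho>) = w \<sigma>"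
  using finite_cone by (simp add: prod_Var deg_square_free keys_mon_of_set mdeg_mon_of_set)

lemma deg_not_cone: "finite A \<Longrightarrow> A \<notin> cones \<Delta> \<Longrightarrow> lin_ext deg (\<Prod>\<rho>\<in>A. Var \<rho>) = 0"
  by (simp add: prod_Var deg_off keys_mon_of_set)

text \<open>The set \<open>J\<close> collects the polynomials all of whose multiples have degree 0.
  It is an ideal for formal reasons, so only the generators are tested, and by linearity only
  against monomials.\<close>

lemma deg_chow_ideal:
  assumes "p \<in> chow_ideal \<Delta>"
  shows "lin_ext deg p = 0"
proof -
  define J where "J = {p. poly_vars p \<subseteq> rays \<Delta> \<and> (\<forall>q. lin_ext deg (q * p) = 0)}"
  have "chow_ideal \<Delta> \<subseteq> J"
  proof (rule chow_ideal_minimal)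
    fix p q assume "p \<in> J" "q \<in> J"
    then show "p + q \<in> J"
      using poly_vars_add[of p q] by (auto simp: J_def distrib_left lin_ext_add)
  next
    fix p q assume "p \<in> J" "poly_vars q \<subseteq> rays \<Delta>"
    then show "q * p \<in> J"
      using poly_vars_mult[of q p] by (auto simp: J_def simp flip: mult.assoc)
  next
    have "lin_ext deg (q * (\<Prod>\<rho>\<in>A. Var \<rho>)) = 0"
      if A: "finite A" "\<not> (\<exists>\<sigma>\<in>cones \<Delta>. A \<subseteq> \<sigma>)" for q A
    proof (induction q rule: poly_induct_single)
      case (single m c)
      have "Poly_Mapping.keys (m + mon_of_set A) \<notin> cones \<Delta>"
        using A by (auto simp: keys_add_nat keys_mon_of_set)
      then show ?case using A by (simp add: prod_Var mult_single deg_off)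
    qed (simp add: distrib_right lin_ext_add)
    moreover have "poly_vars p \<subseteq> rays \<Delta>" if "p \<in> stanley_reisner_relations \<Delta>" for p
      using subsetD[OF chow_generators_subset[of \<Delta>], of p] that by simp
    ultimately have SR: "stanley_reisner_relations \<Delta> \<subseteq> J"
      by (auto simp: J_def stanley_reisner_relations_def simp del: carrier_ray_poly_ring)
    have "lin_ext deg (q * (\<Sum>\<rho>\<in>rays \<Delta>. Const (l \<rho>) * Var \<rho>)) = 0"
      if l: "l \<in> ray_forms \<Delta>" for q l
    proof (induction q rule: poly_induct_single)
      case (single n c)
      have "lin_ext deg (Poly_Mapping.single n c * (\<Sum>\<rho>\<in>rays \<Delta>. Const (l \<rho>) * Var \<rho>)) =
        (\<Sum>\<rho>\<in>rays \<Delta>. c * (l \<rho> * deg (n + mvar \<rho>)))"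
        by (simp add: sum_distrib_left lin_ext_sum Var_def Const_times_single mult_single ac_simps)
      also have "\<dots> = c * (\<Sum>\<rho>\<in>rays \<Delta>. l \<rho> * deg (n + mvar \<rho>))"
        by (simp add: sum_distrib_left)
      also have "\<dots> = 0"
      proof (cases "mdeg n + 1 = d")
        case True
        then show ?thesis using deg_relation[OF True l] by simp
      next
        case False
        then show ?thesis by (simp add: deg_off mdeg_add)
      qed
      finally show ?case .
    qed (simp add: distrib_right lin_ext_add)
    moreover have "poly_vars p \<subseteq> rays \<Delta>" if "p \<in> linear_relations \<Delta>" for p
      using subsetD[OF chow_generators_subset[of \<Delta>], of p] that by simp
    ultimately have "linear_relations \<Delta> \<subseteq> J"
      by (auto simp: J_def linear_relations_ray_forms)
    with SR show "stanley_reisner_relations \<Delta> \<union> linear_relations \<Delta> \<subseteq> J" by simp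
  qed (auto simp: J_def)
  then have "lin_ext deg (1 * p) = 0" using assms unfolding J_def by blast
  then show ?thesis by simp
qed

text \<open>The difference of the two functionals on monomials satisfies the hypotheses of
  \<open>functional_eq_0\<close>. The weights are compared on top-dimensional cones only, since
  \<open>w\<close> vanishes off the cones while \<open>w'\<close> may be constant.\<close>

lemma chow_functional_eq_deg:
  assumes \<phi>: "chow_functional \<Delta> d w' \<phi>"
    and w': "\<And>\<sigma>. \<sigma> \<in> cones \<Delta> \<Longrightarrow> card \<sigma> = d \<Longrightarrow> w' \<sigma> = w \<sigma>"
    and f: "f \<in> forms \<Delta> d"
  shows "\<phi> (chow_class \<Delta> f) = lin_ext deg f"
proof -
  define D where "D m = \<phi> (chow_class \<Delta> (Poly_Mapping.single m 1)) - deg m" for m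
  have D0: "D m = 0" if m: "mdeg m = d" "Poly_Mapping.keys m \<subseteq> rays \<Delta>" for m
  proof (rule functional_eq_0[OF _ _ _ m])
    fix m assume m: "mdeg m = d" "Poly_Mapping.keys m \<subseteq> rays \<Delta>" "Poly_Mapping.keys m \<notin> cones \<Delta>"
    let ?A = "Poly_Mapping.keys m"
    \<comment> \<open>The monomial is a multiple of the square-free product over its support, which
      is a Stanley-Reisner relation.\<close>
    have "\<not> (\<exists>\<sigma>\<in>cones \<Delta>. ?A \<subseteq> \<sigma>)" using face_cone m(3) by blast
    then have "(\<Prod>\<rho>\<in>?A. Var \<rho>) \<in> chow_ideal \<Delta>"
      using m(2) by (intro chow_ideal_generator) (auto simp: stanley_reisner_relations_def)
    moreover have "m - mon_of_set ?A + mon_of_set ?A = m"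
      by (rule poly_mapping_eqI) (auto simp: lookup_add lookup_minus lookup_mon_of_set in_keys_iff)
    then have "Poly_Mapping.single (m - mon_of_set ?A) 1 * (\<Prod>\<rho>\<in>?A. Var \<rho>) = Poly_Mapping.single m (1::real)"
      by (simp add: prod_Var mult_single)
    moreover have "poly_vars (Poly_Mapping.single (m - mon_of_set ?A) (1::real)) \<subseteq> rays \<Delta>"
      using m(2) by (auto simp: poly_vars_def in_keys_iff lookup_minus)
    ultimately have "Poly_Mapping.single m (1::real) \<in> chow_ideal \<Delta>" using chow_ideal_mult by metis
    then show "D m = 0" using chow_functional_0[OF \<phi>] m(3) by (simp add: D_def deg_off)
  next
    fix m assume m: "mdeg m = d" "Poly_Mapping.keys m \<in> cones \<Delta>" "card (Poly_Mapping.keys m) = d"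
    let ?A = "Poly_Mapping.keys m"
    have "?A \<in> maximal_cones \<Delta>"
      unfolding maximal_cones_def
    proof (intro CollectI conjI notI)
      assume "\<exists>\<tau>\<in>cones \<Delta>. ?A \<subset> \<tau>"
      then obtain \<tau> where \<tau>: "\<tau> \<in> cones \<Delta>" "?A \<subset> \<tau>" by blast
      then show False using psubset_card_mono[OF finite_cone[OF \<tau>(1)] \<tau>(2)] cone_card_le[OF \<tau>(1)] m(3) by simp
    qed (use m in simp)
    from chow_functional_weight[OF \<phi> this]
    have "\<phi> (chow_class \<Delta> (\<Prod>\<rho>\<in>?A. Var \<rho>)) = w ?A" using w' m by simp
    moreover have "(\<Prod>\<rho>\<in>?A. Var \<rho>) = Poly_Mapping.single m (1::real)"
      using eq_mon_of_set_keys[of m] m by (simp add: prod_Var)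
    ultimately show "D m = 0" using m by (simp add: D_def deg_square_free)
  next
    fix n l assume n: "mdeg n + 1 = d" "Poly_Mapping.keys n \<subseteq> rays \<Delta>" "l \<in> ray_forms \<Delta>"
    let ?s = "\<Sum>\<rho>\<in>rays \<Delta>. Const (l \<rho>) * Var \<rho>"
    have "?s \<in> chow_ideal \<Delta>"
      using n(3) by (intro chow_ideal_generator) (auto simp: linear_relations_ray_forms)
    then have "Poly_Mapping.single n 1 * ?s \<in> chow_ideal \<Delta>"
      using n(2) by (intro chow_ideal_mult) (auto simp: poly_vars_def)
    then have "0 = \<phi> (chow_class \<Delta> (Poly_Mapping.single n 1 * ?s))"
      using chow_functional_0[OF \<phi>] by simp
    also have "Poly_Mapping.single n 1 * ?s = (\<Sum>\<rho>\<in>rays \<Delta>. Const (l \<rho>) * Poly_Mapping.single (n + mvar \<rho>) 1)"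
      by (simp add: sum_distrib_left Var_def Const_times_single mult_single ac_simps)
    also have "\<phi> (chow_class \<Delta> \<dots>) = (\<Sum>\<rho>\<in>rays \<Delta>. \<phi> (chow_class \<Delta> (Const (l \<rho>) * Poly_Mapping.single (n + mvar \<rho>) 1)))"
      by (rule chow_functional_sum[OF \<phi>])
        (use n in \<open>intro forms_scale; auto simp: forms_iff poly_vars_def homogeneous_mdeg mdeg_add keys_add_nat\<close>)
    also have "\<dots> = (\<Sum>\<rho>\<in>rays \<Delta>. l \<rho> * \<phi> (chow_class \<Delta> (Poly_Mapping.single (n + mvar \<rho>) 1)))"
      by (rule sum.cong[OF refl], rule chow_functional_scale[OF \<phi>])
        (use n in \<open>auto simp: forms_iff poly_vars_def homogeneous_mdeg mdeg_add keys_add_nat\<close>)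
    finally show "(\<Sum>\<rho>\<in>rays \<Delta>. l \<rho> * D (n + mvar \<rho>)) = 0"
      using deg_relation[OF n(1,3)] by (simp add: D_def right_diff_distrib sum_subtractf)
  qed
  have keys: "Poly_Mapping.single m 1 \<in> forms \<Delta> d \<and> mdeg m = d \<and> Poly_Mapping.keys m \<subseteq> rays \<Delta>"
    if "m \<in> Poly_Mapping.keys f" for m
    using f that by (auto simp: forms_iff poly_vars_def homogeneous_mdeg)
  have "\<phi> (chow_class \<Delta> f) = \<phi> (chow_class \<Delta> (\<Sum>m\<in>Poly_Mapping.keys f.
      Const (Poly_Mapping.lookup f m) * Poly_Mapping.single m 1))"
    by (simp add: Const_times_single flip: poly_single_sum)
  also have "\<dots> = (\<Sum>m\<in>Poly_Mapping.keys f. \<phi> (chow_class \<Delta> (Const (Poly_Mapping.lookup f m) * Poly_Mapping.single m 1)))"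
    by (rule chow_functional_sum[OF \<phi>]) (use keys in \<open>auto intro: forms_scale\<close>)
  also have "\<dots> = (\<Sum>m\<in>Poly_Mapping.keys f. Poly_Mapping.lookup f m * deg m)"
  proof (rule sum.cong[OF refl])
    fix m assume m: "m \<in> Poly_Mapping.keys f"
    show "\<phi> (chow_class \<Delta> (Const (Poly_Mapping.lookup f m) * Poly_Mapping.single m 1)) =
        Poly_Mapping.lookup f m * deg m"
      using chow_functional_scale[OF \<phi>, of "Poly_Mapping.single m 1"] keys[OF m] D0[of m]
      by (simp add: D_def)
  qed
  finally show ?thesis by (simp add: lin_ext_def)
qed

end

section \<open>Bergman fans are balanced\<close>

context loopless_matroid
begin

lemma nontrivial_between:
  assumes "\<sigma> \<in> chains N" "G \<in> N"
  obtains A B where "A \<in> insert {} \<sigma>" "A \<subset> G" "\<And>F. F \<in> \<sigma> \<Longrightarrow> F \<subset> G \<Longrightarrow> F \<subseteq> A"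
    "B \<in> insert E \<sigma>" "G \<subset> B" "\<And>F. F \<in> \<sigma> \<Longrightarrow> G \<subset> F \<Longrightarrow> B \<subseteq> F" "A \<in> L" "B \<in> L"
proof -
  have fin: "finite \<sigma>" using finite_subset[OF chainsD2[OF assms(1)] finite_N] .
  have G: "{} \<subset> G" "G \<subset> E" using assms(2) flats_subset by (auto simp: N_iff)
  have sub: "F \<subseteq> E" "F \<in> L" if "F \<in> \<sigma>" for F
  proof -
    show "F \<in> L" using chainsD2[OF assms(1)] that by (auto simp: N_iff)
    then show "F \<subseteq> E" by (rule flats_subset)
  qed
  obtain A where A: "A \<in> insert {} \<sigma>" "A \<subset> G" "\<And>F. F \<in> \<sigma> \<Longrightarrow> F \<subset> G \<Longrightarrow> F \<subseteq> A"
    using chain_predecessor[OF fin assms(1) G(1)] by metis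
  obtain B where B: "B \<in> insert E \<sigma>" "G \<subset> B" "\<And>F. F \<in> \<sigma> \<Longrightarrow> G \<subset> F \<Longrightarrow> B \<subseteq> F"
    using chain_successor[OF fin assms(1) G(2) sub(1)] by metis
  have "A \<in> L" "B \<in> L" using A(1) B(1) sub(2) empty_flat ground_flat by auto
  with A B show ?thesis using that by blast
qed

text \<open>Take \<open>a\<close> in \<open>F\<close> but not in its predecessor, and
  \<open>b\<close> outside \<open>F\<close> but in its successor. Smaller flats of the chain contain
  neither, larger ones both, so the difference of the two coordinates is dual to
  \<open>F\<close>.\<close>

lemma bergman_dual_form:
  assumes "\<sigma> \<in> chains N" "F \<in> \<sigma>"
  shows "\<exists>l\<in>ray_forms (bergman_fan E L). l F = 1 \<and> (\<forall>G\<in>\<sigma> - {F}. l G = 0)"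
proof -
  have F: "F \<in> N" using chainsD2[OF assms(1)] assms(2) by blast
  obtain A B where AB: "A \<subset> F" "\<And>G. G \<in> \<sigma> \<Longrightarrow> G \<subset> F \<Longrightarrow> G \<subseteq> A"
    "F \<subset> B" "\<And>G. G \<in> \<sigma> \<Longrightarrow> F \<subset> G \<Longrightarrow> B \<subseteq> G" "A \<in> L" "B \<in> L"
    using nontrivial_between[OF assms(1) F] by metis
  obtain a b where ab: "a \<in> F" "a \<notin> A" "b \<in> B" "b \<notin> F" using AB by blast
  have E: "a \<in> E" "b \<in> E" using ab AB flats_subset[of B] by auto
  let ?l = "\<lambda>G. indicator G a - indicator G b :: real"
  have "?l \<in> ray_forms (bergman_fan E L)"
    unfolding ray_forms_def
    by (intro CollectI exI[of _ "\<lambda>u. u a - u b"])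
      (simp add: bergman_fan_def global_linear_coordinates[OF E])
  moreover have "?l F = 1" using ab by simp
  moreover have "?l G = 0" if G: "G \<in> \<sigma> - {F}" for G
  proof (cases "G \<subset> F")
    case True
    then show ?thesis using AB(2)[of G] ab G by (auto simp: indicator_def)
  next
    case False
    then have "F \<subset> G" using chainsD[OF assms(1), of G F] G assms(2) by blast
    then show ?thesis using AB(4)[of G] ab G by (auto simp: indicator_def)
  qed
  ultimately show ?thesis by (intro bexI[of _ ?l]) auto
qed

text \<open>A chain one short of maximal has a single gap, between \<open>A\<close> and
  \<open>B\<close>. The flats in the gap partition \<open>B - A\<close>, hence their indicators sum
  to \<open>e_B + (card X - 1) e_A\<close>, a combination of rays of the cone and of the vectors of
  the trivial flats, on which \<open>l\<close> vanishes.\<close>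

lemma bergman_balanced:
  assumes \<sigma>: "\<sigma> \<in> chains N" "card \<sigma> + 1 = d" and l: "l \<in> global_linear E"
    and vanish: "\<And>F. F \<in> \<sigma> \<Longrightarrow> l (indicator F) = 0"
  shows "(\<Sum>H\<in>{H\<in>N - \<sigma>. insert H \<sigma> \<in> chains N}. l (indicator H)) = 0"
proof -
  define X where "X = {H\<in>N - \<sigma>. insert H \<sigma> \<in> chains N}"
  have finX: "finite X" using finite_N by (simp add: X_def)
  obtain G where G: "G \<in> X" using chain_extension_exists[OF \<sigma>(1)] \<sigma>(2) by (auto simp: X_def)
  then have "G \<in> N" by (simp add: X_def)
  then obtain A B where A: "A \<in> insert {} \<sigma>" "A \<subset> G" "\<And>F. F \<in> \<sigma> \<Longrightarrow> F \<subset> G \<Longrightarrow> F \<subseteq> A" "A \<in> L"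
    and B: "B \<in> insert E \<sigma>" "G \<subset> B" "\<And>F. F \<in> \<sigma> \<Longrightarrow> G \<subset> F \<Longrightarrow> B \<subseteq> F" "B \<in> L"
    using nontrivial_between[OF \<sigma>(1)] by metis
  have incomparable: "H = H'" if "H \<in> X" "H' \<in> X" "H \<subseteq> H'" for H H'
    using chain_extensions_incomparable[OF \<sigma>] that by (auto simp: X_def)
  have comparable: "F \<subseteq> H \<or> H \<subseteq> F" if "H \<in> X" "F \<in> insert {} (insert E \<sigma>)" for F H
    using that flats_subset[of H] chains_insert[of H \<sigma>] by (auto simp: X_def N_iff)
  have AHB: "A \<subset> H \<and> H \<subset> B" if H: "H \<in> X" for H
  proof -
    have neq: "H \<noteq> A" "H \<noteq> B" using H A(1) B(1) by (auto simp: X_def N_iff)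
    have "\<not> H \<subseteq> A" using incomparable[OF H G] A(2) by blast
    moreover have "\<not> B \<subseteq> H" using incomparable[OF G H] B(2) by blast
    ultimately show ?thesis using comparable[OF H, of A] comparable[OF H, of B] A(1) B(1) neq by auto
  qed
  have between: "H \<in> X" if H: "H \<in> L" "A \<subset> H" "H \<subset> B" for H
  proof -
    have "F \<subseteq> A \<or> B \<subseteq> F" if "F \<in> \<sigma>" for F
    proof -
      have "F \<noteq> G" using G that by (auto simp: X_def)
      then show ?thesis using comparable[OF G, of F] that A(3)[of F] B(3)[of F] by auto
    qed
    moreover have "H \<in> N" using H flats_subset[OF B(4)] by (auto simp: N_iff)
    ultimately show ?thesis using \<sigma>(1) H unfolding X_def chains_insert by blast
  qed
  have unique: "\<exists>!H. H \<in> X \<and> a \<in> H" if a: "a \<in> B - A" for a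
  proof (rule ex_ex1I)
    have aE: "a \<in> E" using a flats_subset[OF B(4)] by blast
    let ?H = "flat_closure L (insert a A)"
    have le: "?H \<subseteq> B" using a A B by (intro closure_least) auto
    have flat: "?H \<in> L" using aE flats_subset[OF A(4)] by (intro closure_flat) auto
    have gt: "a \<in> ?H" "A \<subset> ?H" using a closure_superset[of "insert a A"] by auto
    \<comment> \<open>Were the closure equal to \<open>B\<close>, then \<open>B\<close> would cover
      \<open>A\<close> and leave no room for \<open>G\<close>.\<close>
    have "?H \<noteq> B"
    proof
      assume "?H = B"
      then have "G = ?H" using closure_insert_covers[of A a G] A B a aE \<open>G \<in> N\<close> by (auto simp: N_iff)
      then show False using \<open>?H = B\<close> B(2) by blast
    qed
    then show "\<exists>H. H \<in> X \<and> a \<in> H" using between[OF flat gt(2)] le gt(1) by blast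
  next
    fix H H' assume H: "H \<in> X \<and> a \<in> H" "H' \<in> X \<and> a \<in> H'"
    have "H \<in> L" "H' \<in> L" using H by (auto simp: X_def N_iff)
    \<comment> \<open>The intersection still contains \<open>a\<close> and lies in the gap, whose
      flats form an antichain.\<close>
    then have "H \<inter> H' \<in> X"
      using AHB[of H] AHB[of H'] H a by (intro between) (auto intro: inter_flat)
    then show "H = H'" using incomparable[of "H \<inter> H'" H] incomparable[of "H \<inter> H'" H'] H by auto
  qed
  have "(\<Sum>H\<in>X. indicator H a) = indicator B a + (real (card X) - 1) * indicator A a" for a
  proof -
    consider "a \<in> A" | "a \<in> B - A" | "a \<notin> B" by blast
    then show ?thesis
    proof cases
      case 1
      then have "indicator H a = (1 :: real)" if "H \<in> X" for H
        using AHB[OF that] by (auto simp: indicator_def)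
      then have "(\<Sum>H\<in>X. indicator H a) = (\<Sum>H\<in>X. 1 :: real)"
        by (rule sum.cong[OF refl])
      with 1 A(2) B(2) show ?thesis by auto
    next
      case 2
      then obtain H0 where H0: "H0 \<in> X" "a \<in> H0" "\<And>H. H \<in> X \<Longrightarrow> a \<in> H \<Longrightarrow> H = H0"
        using unique[OF 2] by blast
      have "(\<Sum>H\<in>X. indicator H a) = (\<Sum>H\<in>X. if H = H0 then 1 else 0 :: real)"
      proof (rule sum.cong[OF refl])
        fix H assume "H \<in> X"
        then show "indicator H a = (if H = H0 then 1 else 0 :: real)"
          using H0(2) H0(3)[of H] by (cases "a \<in> H") auto
      qed
      with 2 H0(1) finX show ?thesis by simp
    next
      case 3
      then have "indicator H a = (0 :: real)" if "H \<in> X" for H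
        using AHB[OF that] by (auto simp: indicator_def)
      then have "(\<Sum>H\<in>X. indicator H a) = (\<Sum>H\<in>X. 0 :: real)"
        by (rule sum.cong[OF refl])
      with 3 A(2) B(2) show ?thesis by (auto simp: indicator_def)
    qed
  qed
  then have "(\<Sum>H\<in>X. l (indicator H)) = l (\<lambda>a. indicator B a + (real (card X) - 1) * indicator A a)"
    by (simp flip: global_linear_sum[OF l])
  also have "\<dots> = l (indicator B) + (real (card X) - 1) * l (indicator A)"
    by (simp only: global_linear_add[OF l] global_linear_scale[OF l])
  also have "\<dots> = 0"
    using A(1) B(1) vanish global_linear_ground[OF l] global_linear_empty[OF l] by auto
  finally show ?thesis by (simp add: X_def)
qed

text \<open>The weight 1, cut off to be 0 away from the top-dimensional cones, so that
  \<open>weight_off\<close> holds.\<close>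

definition bergman_weight :: "'a set set \<Rightarrow> real" where
  "bergman_weight \<sigma> = (if \<sigma> \<in> chains N \<and> card \<sigma> = d then 1 else 0)"

lemma bergman_simps:
  "rays (bergman_fan E L) = N" "cones (bergman_fan E L) = chains N" "ground (bergman_fan E L) = E"
  "ray_vector (bergman_fan E L) = indicator"
  by (simp_all add: bergman_fan_def)

lemma balanced_chow_bergman: "balanced_chow (bergman_fan E L) d bergman_weight"
proof unfold_locales
  fix \<sigma> :: "'a set set" and l :: "'a set \<Rightarrow> real"
  assume \<sigma>: "\<sigma> \<in> cones (bergman_fan E L)" "card \<sigma> + 1 = d" and "l \<in> ray_forms (bergman_fan E L)"
    and 0: "\<And>\<rho>. \<rho> \<in> \<sigma> \<Longrightarrow> l \<rho> = 0"
  then obtain k where k: "k \<in> global_linear E" "l = (\<lambda>F. k (indicator F))"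
    by (auto simp: ray_forms_def bergman_simps)
  have "\<sigma> \<in> chains N" using \<sigma> by (simp add: bergman_simps)
  then have fin: "finite \<sigma>" using finite_subset[OF chainsD2 finite_N] by blast
  have "(\<Sum>\<rho>\<in>N - \<sigma>. l \<rho> * bergman_weight (insert \<rho> \<sigma>)) =
    (\<Sum>\<rho>\<in>N - \<sigma>. if insert \<rho> \<sigma> \<in> chains N then l \<rho> else 0)"
    by (rule sum.cong) (use \<sigma> fin in \<open>auto simp: bergman_weight_def\<close>)
  also have "\<dots> = (\<Sum>H\<in>{H\<in>N - \<sigma>. insert H \<sigma> \<in> chains N}. l H)"
    using finite_N by (intro sum.inter_filter[symmetric]) simp
  also have "\<dots> = 0"
    using bergman_balanced[OF \<open>\<sigma> \<in> chains N\<close> \<sigma>(2) k(1)] 0 k(2) by simp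
  finally show "(\<Sum>\<rho>\<in>rays (bergman_fan E L) - \<sigma>. l \<rho> * bergman_weight (insert \<rho> \<sigma>)) = 0"
    by (simp add: bergman_simps)
qed (use finite_N nontrivial_chain_card_le chainsD2 chains_subset bergman_dual_form ray_forms_combination
    in \<open>auto simp: bergman_simps bergman_weight_def\<close>)

sublocale bergman: balanced_chow "bergman_fan E L" d bergman_weight
  by (rule balanced_chow_bergman)

lemma bergman_maximal_cone:
  assumes "\<sigma> \<in> maximal_cones (bergman_fan E L)"
  shows "\<sigma> \<in> chains N" "card \<sigma> = d"
proof -
  show \<sigma>: "\<sigma> \<in> chains N" using assms by (simp add: maximal_cones_def bergman_simps)
  show "card \<sigma> = d"
  proof (rule ccontr)
    assume "card \<sigma> \<noteq> d"
    with \<sigma> obtain G where "G \<in> N - \<sigma>" "insert G \<sigma> \<in> chains N" by (rule chain_extension_exists)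
    then show False using assms by (auto simp: maximal_cones_def bergman_simps)
  qed
qed

end

section \<open>Deletion of an element\<close>

locale matroid_deletion = loopless_matroid E L d
  for E :: "'a set" and L :: "'a set set" and d :: nat +
  fixes i :: 'a
  assumes deleted_in: "i \<in> E" and singleton_flat: "{i} \<in> L" and not_coloop: "\<not> is_coloop L i"
begin

abbreviation L' where "L' \<equiv> deletion_flats L i"
abbreviation N' where "N' \<equiv> nontrivial_flats (E - {i}) L'"
abbreviation cl where "cl \<equiv> flat_closure L"

section \<open>The flats of the deletion and their closures\<close>

lemma deletion_flatI: "F \<in> L \<Longrightarrow> F - {i} \<in> L'"
  by (auto simp: deletion_flats_def)

lemma deletion_flat_subset: "G \<in> L' \<Longrightarrow> G \<subseteq> E - {i}"
  using flats_subset by (auto simp: deletion_flats_def)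

lemma closure_deletion_flat:
  assumes "G \<in> L'"
  shows "cl G \<in> L" "cl G - {i} = G" "cl G = G \<or> cl G = insert i G"
proof -
  obtain F where F: "F \<in> L" "G = F - {i}" using assms by (auto simp: deletion_flats_def)
  have "cl G \<subseteq> F" using F by (intro closure_least) auto
  then have "cl G \<subseteq> insert i G" using F by auto
  with closure_superset[of G] show "cl G = G \<or> cl G = insert i G" by blast
  then show "cl G - {i} = G" using deletion_flat_subset[OF assms] by auto
  show "cl G \<in> L" using deletion_flat_subset[OF assms] by (intro closure_flat) auto
qed

lemma in_closure_iff: "G \<in> L' \<Longrightarrow> i \<in> cl G \<longleftrightarrow> G \<notin> L"
  using closure_deletion_flat[of G] closure_of_flat[of G] deletion_flat_subset[of G] by auto

lemma not_flat_insert: "G \<in> L' \<Longrightarrow> G \<notin> L \<Longrightarrow> insert i G \<in> L"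
  using closure_deletion_flat(1,3)[of G] by metis

lemma deletion_flat_cases: "G \<in> L' \<Longrightarrow> insert i G \<notin> L \<Longrightarrow> G \<in> L"
  using closure_deletion_flat(1,3)[of G] by metis

lemma closure_chain:
  assumes "C \<in> chains L'"
  shows "cl ` C \<in> chains L"
proof (rule chains_image[OF assms])
  show "cl G \<in> L" if "G \<in> C" for G using that chainsD2[OF assms] closure_deletion_flat(1) by blast
qed (rule closure_mono)

lemma inj_on_closure: "inj_on cl L'"
  by (rule inj_on_inverseI[of _ "\<lambda>F. F - {i}"]) (rule closure_deletion_flat(2))

lemma finite_deletion_flats: "finite L'"
  using finite_flats by (simp add: deletion_flats_def)

lemma deletion_ground_flat: "E - {i} \<in> L'"
  using deletion_flatI[OF ground_flat] .

text \<open>Taking closures is monotone and injective, with removal of \<open>i\<close> as its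
  inverse, so the rank cannot grow; it does not drop because \<open>i\<close> is not a
  coloop.\<close>

lemma rank_deletion: "matroid_rank L' = d + 1"
proof (rule antisym)
  show "d + 1 \<le> matroid_rank L'" using not_coloop rank by (simp add: is_coloop_def)
  obtain C where C: "C \<in> chains L'" "card C = matroid_rank L' + 1"
    using rank_chain_exists[OF finite_deletion_flats] deletion_ground_flat by blast
  have "card (cl ` C) = card C" by (rule card_image, rule inj_on_subset[OF inj_on_closure chainsD2[OF C(1)]])
  then show "matroid_rank L' \<le> d + 1" using chain_card_le[OF closure_chain[OF C(1)]] C(2) by simp
qed

text \<open>Otherwise the closures of a longest chain of the deletion would all avoid
  \<open>i\<close>, and adding \<open>E\<close> on top would give a chain of \<open>d + 3\<close>
  flats.\<close>

lemma deletion_ground_not_flat: "E - {i} \<notin> L"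
proof
  assume E': "E - {i} \<in> L"
  obtain C where C: "C \<in> chains L'" "card C = matroid_rank L' + 1"
    using rank_chain_exists[OF finite_deletion_flats] deletion_ground_flat by blast
  have le: "cl G \<subseteq> E - {i}" if "G \<in> C" for G
    using that chainsD2[OF C(1)] deletion_flat_subset E' by (intro closure_least) auto
  have "insert E (cl ` C) \<in> chains L"
    unfolding chains_insert using closure_chain[OF C(1)] ground_flat le by auto
  then have "card (insert E (cl ` C)) \<le> d + 2" by (rule chain_card_le)
  moreover have "E \<notin> cl ` C" using le deleted_in by blast
  moreover have "card (cl ` C) = card C" by (rule card_image, rule inj_on_subset[OF inj_on_closure chainsD2[OF C(1)]])
  moreover have "finite C" using finite_subset[OF chainsD2[OF C(1)] finite_deletion_flats] .
  ultimately show False using C(2) rank_deletion by simp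
qed

text \<open>The cover through \<open>a\<close> is \<open>K - {i}\<close> with \<open>K\<close> the
  closure of \<open>insert a (cl A)\<close>. By exchange, any element of \<open>K\<close> outside
  \<open>cl A\<close> generates the same \<open>K\<close>, so no flat of the deletion fits strictly
  between.\<close>

lemma deletion_cover_partition:
  assumes A: "A \<in> L'" and a: "a \<in> E - {i} - A"
  shows "\<exists>!G. G \<in> L' \<and> A \<subset> G \<and> \<not> (\<exists>H\<in>L'. A \<subset> H \<and> H \<subset> G) \<and> a \<in> G"
proof -
  define K where "K = cl (insert a (cl A))"
  note clA = closure_deletion_flat[OF A]
  have a': "a \<in> E - cl A" using a clA(2) by blast
  have K: "K \<in> L" unfolding K_def using a flats_subset[OF clA(1)] by (intro closure_flat) auto
  have KA: "insert a (cl A) \<subseteq> K" unfolding K_def by (rule closure_superset)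
  have AK: "A \<subset> K - {i}" "a \<in> K - {i}"
    using KA a closure_superset[of A] deletion_flat_subset[OF A] by auto
  have min: "K - {i} \<subseteq> H" if H: "H \<in> L'" "A \<subset> H" "H \<subseteq> K - {i}" for H
  proof -
    obtain b where b: "b \<in> H" "b \<notin> A" using H by blast
    have "b \<notin> cl A" using b clA(2) deletion_flat_subset[OF H(1)] by blast
    moreover have "b \<in> K" using b H by blast
    ultimately have "cl (insert b (cl A)) = K"
      using closure_insert_eq[OF clA(1) a', of b] by (simp add: K_def)
    moreover have "cl (insert b (cl A)) \<subseteq> cl H"
      using closure_mono[of A H] closure_superset[of H] H b closure_deletion_flat(1)[OF H(1)]
      by (intro closure_least) auto
    ultimately show ?thesis using closure_deletion_flat(2)[OF H(1)] by blast
  qed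
  show ?thesis
  proof (rule ex1I[of _ "K - {i}"])
    show "K - {i} \<in> L' \<and> A \<subset> K - {i} \<and> \<not> (\<exists>H\<in>L'. A \<subset> H \<and> H \<subset> K - {i}) \<and> a \<in> K - {i}"
    proof (intro conjI notI)
      assume "\<exists>H\<in>L'. A \<subset> H \<and> H \<subset> K - {i}"
      then obtain H where H: "H \<in> L'" "A \<subset> H" "H \<subset> K - {i}" by (elim bexE conjE)
      from min[OF H(1,2)] H(3) show False by auto
    qed (use AK deletion_flatI[OF K] in auto)
  next
    fix G assume G: "G \<in> L' \<and> A \<subset> G \<and> \<not> (\<exists>H\<in>L'. A \<subset> H \<and> H \<subset> G) \<and> a \<in> G"
    have "K \<subseteq> cl G" unfolding K_def
      using closure_mono[of A G] closure_superset[of G] G closure_deletion_flat(1)[of G]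
      by (intro closure_least) auto
    then have "K - {i} \<subseteq> G" using closure_deletion_flat(2)[of G] G by blast
    then show "G = K - {i}" using G AK(1) deletion_flatI[OF K] by (metis psubsetI)
  qed
qed

sublocale del: loopless_matroid "E - {i}" L' d
proof unfold_locales
  show "finite (E - {i})" using finite_ground by simp
  show "F \<subseteq> E - {i}" if "F \<in> L'" for F using that by (rule deletion_flat_subset)
  show "E - {i} \<in> L'" by (rule deletion_ground_flat)
  show "F \<inter> G \<in> L'" if "F \<in> L'" "G \<in> L'" for F G
  proof -
    obtain F0 G0 where "F0 \<in> L" "G0 \<in> L" "F = F0 - {i}" "G = G0 - {i}"
      using \<open>F \<in> L'\<close> \<open>G \<in> L'\<close> by (auto simp: deletion_flats_def)
    moreover have "(F0 - {i}) \<inter> (G0 - {i}) = F0 \<inter> G0 - {i}" by blast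
    ultimately show ?thesis using deletion_flatI[OF inter_flat[of F0 G0]] by simp
  qed
  show "{} \<in> L'" using deletion_flatI[OF empty_flat] by simp
  show "matroid_rank L' = d + 1" by (rule rank_deletion)
qed (rule deletion_cover_partition)

text \<open>The rays of the deletion fan are the sets \<open>ray G\<close> for \<open>G\<close> in \<open>N'\<close> and for \<open>G = {}\<close>, the
  latter being the class of \<open>{i}\<close>.\<close>

definition ray :: "'a set \<Rightarrow> 'a set set" where
  "ray G = {X\<in>N. X - {i} = G}"

text \<open>Identification only adds or removes \<open>i\<close>, so \<open>F - {i}\<close> is a
  complete invariant of the class.\<close>

lemma flat_class_ray:
  assumes F: "F \<in> N"
  shows "flat_class E L i F = ray (F - {i})"
proof
  have "X \<in> N \<and> X - {i} = F - {i}" if "(F, X) \<in> flat_equiv E L i" for X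
    using that assms by (auto simp: flat_equiv_def deletion_pairs_def)
  then show "flat_class E L i F \<subseteq> ray (F - {i})" by (auto simp: flat_class_def ray_def)
  show "ray (F - {i}) \<subseteq> flat_class E L i F"
  proof
    fix X assume "X \<in> ray (F - {i})"
    then have X: "X \<in> N" "X - {i} = F - {i}" by (auto simp: ray_def)
    then consider "X = F" | "i \<in> X" "i \<notin> F" "X = insert i F" | "i \<notin> X" "i \<in> F" "F = insert i X" by blast
    moreover have "F \<subseteq> E" "X \<subseteq> E" using F X(1) flats_subset by (simp_all add: N_iff)
    ultimately have "(F, X) \<in> flat_equiv E L i"
      using F X(1) by cases (auto simp: flat_equiv_def deletion_pairs_def)
    then show "X \<in> flat_class E L i F" by (simp add: flat_class_def)
  qed
qed

text \<open>If \<open>{i}\<close> were the ground set, \<open>E - {i}\<close> would be empty and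
  hence a flat.\<close>

lemma singleton_nontrivial: "{i} \<in> N"
  using singleton_flat deletion_ground_not_flat empty_flat by (auto simp: N_iff)

lemma minus_nontrivial: "F \<in> N \<Longrightarrow> F - {i} \<in> insert {} N'"
  using deletion_flatI[of F] deletion_ground_not_flat flats_subset[of F] deleted_in
  by (cases "i \<in> F") (auto simp: N_iff del.N_iff)

lemma closure_nontrivial: "G \<in> N' \<Longrightarrow> cl G \<in> N"
  using closure_deletion_flat(1,2)[of G] closure_superset[of G] deleted_in by (auto simp: N_iff del.N_iff)

lemma insert_nontrivial: "G \<in> insert {} N' \<Longrightarrow> insert i G \<in> L \<Longrightarrow> insert i G \<in> N"
  using singleton_nontrivial deletion_flat_subset[of G] by (auto simp: N_iff del.N_iff)

lemma ray_nonempty: "G \<in> insert {} N' \<Longrightarrow> ray G \<noteq> {}"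
proof -
  assume "G \<in> insert {} N'"
  then have "(if G = {} then {i} else cl G) \<in> ray G"
    using closure_nontrivial[of G] closure_deletion_flat(2)[of G] singleton_nontrivial
    by (auto simp: ray_def del.N_iff)
  then show ?thesis by blast
qed

lemma ray_eq_iff: "G \<in> insert {} N' \<Longrightarrow> ray G = ray H \<longleftrightarrow> G = H"
  using ray_nonempty[of G] by (auto simp: ray_def)

lemma inj_on_ray: "inj_on ray (insert {} N')"
  using ray_eq_iff by (auto simp: inj_on_def)

lemma Inter_ray: "G \<in> N' \<Longrightarrow> \<Inter>(ray G) = cl G"
proof
  assume G: "G \<in> N'"
  show "\<Inter>(ray G) \<subseteq> cl G"
    using closure_nontrivial[OF G] closure_deletion_flat(2)[of G] G by (auto simp: ray_def del.N_iff)
  show "cl G \<subseteq> \<Inter>(ray G)"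
    using closure_least[of _ G] by (auto simp: ray_def N_iff)
qed

lemma ray_empty: "ray {} = {{i}}"
  using singleton_nontrivial by (auto simp: ray_def N_iff)

lemma closure_ray_eq: "G \<in> N' \<Longrightarrow> closure_ray E L i G = ray G"
  using closure_nontrivial[of G] closure_deletion_flat(2)[of G]
  by (simp add: closure_ray_def flat_class_ray del.N_iff)

lemma singleton_class_eq: "flat_class E L i {i} = ray {}"
  using flat_class_ray[OF singleton_nontrivial] by simp

section \<open>Rays and cones of the deletion fan\<close>

abbreviation \<Delta> where "\<Delta> \<equiv> deletion_fan E L i"
abbreviation B where "B \<equiv> bergman_fan (E - {i}) L'"

lemma rays_deletion_fan: "rays \<Delta> = ray ` insert {} N'"
proof -
  have "rays \<Delta> = flat_class E L i ` N"
    by (auto simp: deletion_fan_def quotient_def flat_class_def)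
  also have "\<dots> = ray ` ((\<lambda>F. F - {i}) ` N)" by (auto simp: flat_class_ray image_image)
  also have "(\<lambda>F. F - {i}) ` N = insert {} N'"
  proof
    show "(\<lambda>F. F - {i}) ` N \<subseteq> insert {} N'" using minus_nontrivial by blast
    have "{} \<in> (\<lambda>F. F - {i}) ` N" using singleton_nontrivial by (intro image_eqI[of _ _ "{i}"]) auto
    moreover have "G \<in> (\<lambda>F. F - {i}) ` N" if "G \<in> N'" for G
      using closure_nontrivial[OF that] closure_deletion_flat(2)[of G] that
      by (intro image_eqI[of _ _ "cl G"]) (auto simp: del.N_iff)
    ultimately show "insert {} N' \<subseteq> (\<lambda>F. F - {i}) ` N" by blast
  qed
  finally show ?thesis .
qed

lemma cones_deletion_fan: "cones \<Delta> = (\<lambda>C. ray ` (\<lambda>F. F - {i}) ` C) ` chains N"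
proof -
  have "flat_class E L i ` C = ray ` (\<lambda>F. F - {i}) ` C" if "C \<in> chains N" for C
    using chainsD2[OF that] by (auto simp: flat_class_ray image_image subset_iff)
  then show ?thesis by (simp add: deletion_fan_def)
qed

lemma minus_chain: "C \<in> chains N \<Longrightarrow> (\<lambda>F. F - {i}) ` C - {{}} \<in> chains N'"
proof -
  assume C: "C \<in> chains N"
  have "F - {i} \<in> insert {} N'" if "F \<in> C" for F using minus_nontrivial chainsD2[OF C] that by blast
  moreover have "F - {i} \<subseteq> G - {i} \<or> G - {i} \<subseteq> F - {i}" if "F \<in> C" "G \<in> C" for F G
    using chainsD[OF C that] by blast
  ultimately show ?thesis unfolding chains_def chain_subset_def by blast
qed

text \<open>A cone comes from a chain of flats of \<open>M\<close>. If \<open>{i}\<close> belongs to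
  the chain, all members contain \<open>i\<close>, so \<open>G\<close> must lift to
  \<open>insert i G\<close>; otherwise the closures give a lift without further conditions.\<close>

lemma ray_image_cone_iff:
  assumes S: "S \<subseteq> insert {} N'"
  shows "ray ` S \<in> cones \<Delta> \<longleftrightarrow> S - {{}} \<in> chains N' \<and> ({} \<in> S \<longrightarrow> (\<forall>G\<in>S. insert i G \<in> L))"
proof
  assume "ray ` S \<in> cones \<Delta>"
  then obtain C where C: "C \<in> chains N" "ray ` S = ray ` (\<lambda>F. F - {i}) ` C"
    by (auto simp: cones_deletion_fan)
  have sub: "(\<lambda>F. F - {i}) ` C \<subseteq> insert {} N'" using chainsD2[OF C(1)] minus_nontrivial by blast
  have S_eq: "S = (\<lambda>F. F - {i}) ` C"
    by (rule iffD1[OF inj_on_image_eq_iff[OF inj_on_ray S sub] C(2)])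
  have "insert i G \<in> L" if "{} \<in> S" "G \<in> S" for G
  proof -
    have "{} \<in> (\<lambda>F. F - {i}) ` C" "G \<in> (\<lambda>F. F - {i}) ` C" using that S_eq by simp_all
    then obtain F F0 where F: "F \<in> C" "G = F - {i}" "F0 \<in> C" "{} = F0 - {i}" by (elim imageE)
    then have "F0 \<in> N" "F \<in> N" using chainsD2[OF C(1)] by auto
    \<comment> \<open>A nontrivial flat with empty image is \<open>{i}\<close>, and a nontrivial
      flat comparable to \<open>{i}\<close> contains \<open>i\<close>.\<close>
    moreover have "F0 \<subseteq> {i}" using F(4) by blast
    ultimately have "F0 = {i}" "F \<in> N" by (auto simp: N_iff)
    then have "i \<in> F" using chainsD[OF C(1) F(1,3)] by (auto simp: N_iff)
    with F \<open>F \<in> N\<close> show ?thesis by (simp add: insert_absorb N_iff)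
  qed
  then show "S - {{}} \<in> chains N' \<and> ({} \<in> S \<longrightarrow> (\<forall>G\<in>S. insert i G \<in> L))"
    using minus_chain[OF C(1)] S_eq by simp
next
  assume R: "S - {{}} \<in> chains N' \<and> ({} \<in> S \<longrightarrow> (\<forall>G\<in>S. insert i G \<in> L))"
  define C where "C = (if {} \<in> S then insert i ` S else cl ` S)"
  have sub: "G \<in> L'" if "G \<in> S" for G
    using that S del.empty_flat by (auto simp: del.N_iff)
  have comp: "G \<subseteq> H \<or> H \<subseteq> G" if "G \<in> S" "H \<in> S" for G H
    using that conjunct1[OF R] chainsD[of "S - {{}}" N' G H] by auto
  have "C \<subseteq> N"
    using S R closure_nontrivial insert_nontrivial unfolding C_def by auto
  moreover have "X \<subseteq> Y \<or> Y \<subseteq> X" if "X \<in> C" "Y \<in> C" for X Y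
  proof -
    from that have "\<exists>f G H. (f = insert i \<or> f = cl) \<and> X = f G \<and> Y = f H \<and> G \<in> S \<and> H \<in> S"
      unfolding C_def by (cases "{} \<in> S") auto
    then obtain f G H where "f = insert i \<or> f = cl" "X = f G" "Y = f H" "G \<in> S" "H \<in> S"
      by (elim exE conjE)
    then show ?thesis using comp[of G H] closure_mono[of G H] closure_mono[of H G] by auto
  qed
  ultimately have C: "C \<in> chains N" by (auto simp: chains_def chain_subset_def)
  have "insert i G - {i} = G \<and> cl G - {i} = G" if "G \<in> S" for G
    using sub[OF that] deletion_flat_subset[of G] closure_deletion_flat(2)[of G] by auto
  then have "(\<lambda>F. F - {i}) ` C = S" unfolding C_def by (auto simp: image_image)
  then show "ray ` S \<in> cones \<Delta>" using C unfolding cones_deletion_fan by blast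
qed

lemma cone_subset_rays:
  assumes "\<sigma> \<in> cones \<Delta>"
  obtains S where "S \<subseteq> insert {} N'" "\<sigma> = ray ` S"
proof -
  obtain C where "C \<in> chains N" "\<sigma> = ray ` (\<lambda>F. F - {i}) ` C" using assms by (auto simp: cones_deletion_fan)
  moreover from this have "(\<lambda>F. F - {i}) ` C \<subseteq> insert {} N'" using chainsD2 minus_nontrivial by blast
  ultimately show ?thesis using that by blast
qed

subsection \<open>Comparing the Chow rings\<close>

abbreviation degree :: "'a set poly \<Rightarrow> real" where
  "degree \<equiv> lin_ext del.bergman.deg"

text \<open>Modulo the linear form \<open>e\<^sub>i\<^sup>* - e\<^sub>a\<^sup>*\<close>, the ray of \<open>{i}\<close> becomes \<open>lift a\<close>.\<close>

definition lift_coeff :: "'a \<Rightarrow> 'a set \<Rightarrow> real" where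
  "lift_coeff a H = indicator H a - (if H \<in> L then 0 else 1)"

definition lift :: "'a \<Rightarrow> 'a set poly" where
  "lift a = (\<Sum>H\<in>N'. Const (lift_coeff a H) * Var H)"

text \<open>An arbitrary choice that fixes one polynomial for the ray of \<open>{i}\<close>; by
  \<open>lift_diff\<close> its class does not depend on it.\<close>

definition base :: 'a where
  "base = (SOME a. a \<in> E - {i})"

lemma base: "base \<in> E - {i}"
  unfolding base_def some_in_eq by (rule del.ground_nonempty)

text \<open>The smallest flat of a class with \<open>i\<close> removed is the flat of the deletion
  that labels the ray; the empty label singles out the ray of \<open>{i}\<close>.\<close>

definition theta_ray :: "'a set set \<Rightarrow> 'a set poly" where
  "theta_ray \<rho> = (if \<Inter>\<rho> - {i} = {} then lift base else Var (\<Inter>\<rho> - {i}))"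

abbreviation theta :: "'a set set poly \<Rightarrow> 'a set poly" where
  "theta \<equiv> poly_subst theta_ray"

abbreviation psi :: "'a set poly \<Rightarrow> 'a set set poly" where
  "psi \<equiv> poly_subst (\<lambda>G. Var (ray G))"

lemma finite_rays_deletion: "finite (rays \<Delta>)"
  using del.finite_N by (simp add: rays_deletion_fan)

lemma theta_ray_empty [simp]: "theta_ray (ray {}) = lift base"
  by (simp add: theta_ray_def ray_empty)

lemma theta_ray_nonempty [simp]: "G \<in> N' \<Longrightarrow> theta_ray (ray G) = Var G"
  using closure_deletion_flat(2)[of G] by (auto simp: theta_ray_def Inter_ray del.N_iff)

lemma lift_vars: "poly_vars (lift a) \<subseteq> N'"
  unfolding lift_def
proof (rule poly_vars_sum)
  fix H assume "H \<in> N'"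
  then show "poly_vars (Const (lift_coeff a H) * Var H) \<subseteq> N'"
    by (intro order_trans[OF poly_vars_mult]) simp
qed

lemma theta_ray_vars: "\<rho> \<in> rays \<Delta> \<Longrightarrow> poly_vars (theta_ray \<rho>) \<subseteq> N'"
  using lift_vars[of base] by (auto simp: rays_deletion_fan)

lemma theta_vars: "poly_vars p \<subseteq> rays \<Delta> \<Longrightarrow> poly_vars (theta p) \<subseteq> N'"
  by (rule poly_vars_subst) (use theta_ray_vars in blast)

lemma psi_vars: "poly_vars p \<subseteq> N' \<Longrightarrow> poly_vars (psi p) \<subseteq> rays \<Delta>"
  by (rule poly_vars_subst) (auto simp: rays_deletion_fan)

lemma degree_chow_ideal: "p \<in> chow_ideal B \<Longrightarrow> degree p = 0"
  by (rule del.bergman.deg_chow_ideal)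

lemma bergman_linear_relation:
  assumes "l \<in> global_linear (E - {i})"
  shows "(\<Sum>H\<in>N'. Const (l (indicator H)) * Var H) \<in> chow_ideal B"
  by (rule chow_ideal_generator) (use assms in \<open>auto simp: linear_relations_def del.bergman_simps\<close>)

lemma bergman_nonchain:
  assumes "S \<subseteq> N'" "S \<notin> chains N'"
  shows "(\<Prod>G\<in>S. Var G) \<in> chow_ideal B"
proof (rule chow_ideal_generator)
  have "\<not> (\<exists>\<sigma>\<in>chains N'. S \<subseteq> \<sigma>)" using assms(2) chains_subset by blast
  then show "(\<Prod>G\<in>S. Var G) \<in> stanley_reisner_relations B \<union> linear_relations B"
    using assms(1) finite_subset[OF assms(1) del.finite_N]
    by (auto simp: stanley_reisner_relations_def del.bergman_simps)
qed

text \<open>The flatness terms cancel, and what remains is the linear relation of the coordinate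
  difference at \<open>a\<close> and \<open>b\<close>.\<close>

lemma lift_diff:
  assumes "a \<in> E - {i}" "b \<in> E - {i}"
  shows "lift a - lift b \<in> chow_ideal B"
proof -
  have eq: "Const (lift_coeff a H) * Var H - Const (lift_coeff b H) * Var H =
      Const (indicator H a - indicator H b) * (Var H :: 'a set poly)" for H
  proof -
    have "lift_coeff a H = (indicator H a - indicator H b) + lift_coeff b H"
      by (simp add: lift_coeff_def)
    then show ?thesis by (simp only: Const_add distrib_right) simp
  qed
  have "lift a - lift b = (\<Sum>H\<in>N'. Const (indicator H a - indicator H b) * Var H)"
    unfolding lift_def sum_subtractf[symmetric] eq ..
  then show ?thesis
    using bergman_linear_relation[OF global_linear_coordinates[OF assms]] by simp
qed

lemma closure_exchange:
  assumes "G \<in> L" "i \<notin> G" "a \<in> cl (insert i G)" "a \<notin> G" "a \<noteq> i"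
  shows "cl (insert a G) = cl (insert i G)"
  using assms deleted_in by (intro closure_insert_eq) auto

text \<open>With \<open>a\<close> in the closure of \<open>insert i G\<close>, the coefficient of every flat comparable to \<open>G\<close>
  vanishes.\<close>

lemma lift_times_incompatible:
  assumes G: "G \<in> N'" "insert i G \<notin> L"
  shows "lift base * Var G \<in> chow_ideal B"
proof -
  have G': "G \<in> L'" using G by (simp add: del.N_iff)
  have GL: "G \<in> L" by (rule deletion_flat_cases[OF G' G(2)])
  have iG: "i \<notin> G" using deletion_flat_subset[OF G'] by blast
  have sub: "insert i G \<subseteq> E" using flats_subset[OF GL] deleted_in by blast
  have cl: "cl (insert i G) \<in> L" using sub by (rule closure_flat)
  \<comment> \<open>Such an element exists because \<open>insert i G\<close> is not a flat.\<close>
  then obtain a where a: "a \<in> cl (insert i G)" "a \<notin> insert i G"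
    using closure_superset[of "insert i G"] G(2) by (metis subset_antisym subsetI)
  have aE: "a \<in> E - {i}" using a flats_subset[OF cl] by blast
  have eq: "cl (insert a G) = cl (insert i G)" using a iG GL by (intro closure_exchange) auto
  have "Const (lift_coeff a H) * Var H * Var G \<in> chow_ideal B" if H: "H \<in> N'" for H
  proof (cases "H \<subseteq> G \<or> G \<subseteq> H")
    case True
    have H': "H \<in> L'" using H by (simp add: del.N_iff)
    have "lift_coeff a H = 0"
    proof (cases "H \<subseteq> G")
      case True
      \<comment> \<open>The closure of \<open>H\<close> stays inside the flat \<open>G\<close>,
        which avoids \<open>i\<close>, so \<open>H\<close> is itself a flat of
        \<open>M\<close>.\<close>
      then have "H \<in> L" using closure_least[OF GL True] iG in_closure_iff[OF H'] by blast
      moreover have "a \<notin> H" using True a by blast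
      ultimately show ?thesis by (simp add: lift_coeff_def)
    next
      case False
      then have GH: "G \<subseteq> H" using True by blast
      note clH = closure_deletion_flat[OF H']
      \<comment> \<open>Over \<open>G\<close> the elements \<open>a\<close> and \<open>i\<close>
        have the same closure, so for \<open>H\<close> containing \<open>G\<close> the closure of
        \<open>H\<close> contains both or neither.\<close>
      have "a \<in> H \<longleftrightarrow> H \<notin> L"
      proof
        assume "a \<in> H"
        then have "cl (insert a G) \<subseteq> cl H" using GH closure_superset[of H] by (intro closure_least clH) auto
        then show "H \<notin> L" using eq closure_superset[of "insert i G"] in_closure_iff[OF H'] by blast
      next
        assume "H \<notin> L"
        then have "i \<in> cl H" using in_closure_iff[OF H'] by simp
        then have "cl (insert i G) \<subseteq> cl H" using GH closure_superset[of H] by (intro closure_least clH) auto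
        then show "a \<in> H" using a clH(2) by blast
      qed
      then show ?thesis by (auto simp: lift_coeff_def)
    qed
    then show ?thesis by simp
  next
    case False
    then have "{H, G} \<notin> chains N'" "H \<noteq> G" by (auto simp: chains_insert)
    then have "Var H * Var G \<in> chow_ideal B"
      using bergman_nonchain[of "{H, G}"] H G by simp
    then show ?thesis using chow_ideal_mult[of "Var H * Var G" B "Const (lift_coeff a H)"]
      by (simp add: mult.assoc)
  qed
  then have "lift a * Var G \<in> chow_ideal B"
    unfolding lift_def sum_distrib_right by (rule chow_ideal_sum)
  moreover have "Var G * (lift base - lift a) \<in> chow_ideal B"
    using G lift_diff[OF base aE] by (intro chow_ideal_mult) (auto simp: del.bergman_simps)
  ultimately have "lift a * Var G + Var G * (lift base - lift a) \<in> chow_ideal B"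
    by (rule chow_ideal_add)
  then show ?thesis by (simp add: algebra_simps)
qed

section \<open>The two substitutions respect the Chow ideals\<close>

lemma prod_ray_image: "S \<subseteq> insert {} N' \<Longrightarrow> (\<Prod>\<rho>\<in>ray ` S. f \<rho>) = (\<Prod>G\<in>S. f (ray G))"
  using prod.reindex[OF inj_on_subset[OF inj_on_ray], of S f] by simp

lemma theta_prod_ray:
  assumes S: "S \<subseteq> insert {} N'"
  shows "theta (\<Prod>\<rho>\<in>ray ` S. Var \<rho>) = (if {} \<in> S then lift base else 1) * (\<Prod>G\<in>S - {{}}. Var G)"
proof -
  have fin: "finite S" using finite_subset[OF S] del.finite_N by simp
  have "theta (\<Prod>\<rho>\<in>ray ` S. Var \<rho>) = (\<Prod>G\<in>S. theta_ray (ray G))"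
    by (simp add: poly_subst_prod prod_ray_image[OF S])
  also have "\<dots> = (if {} \<in> S then lift base else 1) * (\<Prod>G\<in>S - {{}}. theta_ray (ray G))"
    using fin by (simp add: prod.remove)
  also have "(\<Prod>G\<in>S - {{}}. theta_ray (ray G)) = (\<Prod>G\<in>S - {{}}. Var G)"
    by (rule prod.cong) (use S in auto)
  finally show ?thesis .
qed

lemma prod_Var_vars: "S \<subseteq> R \<Longrightarrow> poly_vars (\<Prod>G\<in>S. Var G) \<subseteq> R"
  by (rule poly_vars_prod) auto

text \<open>A set of rays fails to be a cone for one of two reasons: its flats other than
  \<open>{}\<close> do not form a chain, which is already a relation of the deletion, or the ray of
  \<open>{i}\<close> meets an incompatible \<open>G\<close>, where
  \<open>lift_times_incompatible\<close> applies.\<close>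

lemma theta_stanley_reisner:
  assumes "A \<subseteq> rays \<Delta>" "\<not> (\<exists>\<sigma>\<in>cones \<Delta>. A \<subseteq> \<sigma>)"
  shows "theta (\<Prod>\<rho>\<in>A. Var \<rho>) \<in> chow_ideal B"
proof -
  obtain S where S: "S \<subseteq> insert {} N'" "A = ray ` S"
    using assms(1) unfolding rays_deletion_fan subset_image_iff by (elim exE conjE)
  define S1 where "S1 = S - {{}}"
  have S1: "S1 \<subseteq> N'" using S(1) by (auto simp: S1_def)
  have fin: "finite S1" using finite_subset[OF S1 del.finite_N] .
  let ?y = "if {} \<in> S then lift base else 1"
  have vars: "poly_vars ?y \<subseteq> rays B" using lift_vars[of base] by (simp add: del.bergman_simps)
  have "ray ` S \<notin> cones \<Delta>" using assms(2) S(2) by blast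
  then consider "S1 \<notin> chains N'" | G where "{} \<in> S" "G \<in> S" "insert i G \<notin> L"
    using ray_image_cone_iff[OF S(1)] by (auto simp: S1_def)
  then have "?y * (\<Prod>G\<in>S1. Var G) \<in> chow_ideal B"
  proof cases
    case 1
    then show ?thesis using bergman_nonchain[OF S1] vars by (intro chow_ideal_mult) auto
  next
    case (2 G)
    then have "G \<noteq> {}" using singleton_flat by auto
    then have G: "G \<in> S1" using 2 by (simp add: S1_def)
    have "(\<Prod>H\<in>S1 - {G}. Var H) * (lift base * Var G) \<in> chow_ideal B"
    proof (rule chow_ideal_mult)
      show "lift base * Var G \<in> chow_ideal B"
        using lift_times_incompatible[OF _ 2(3)] G S1 by blast
      show "poly_vars (\<Prod>H\<in>S1 - {G}. Var H) \<subseteq> rays B"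
        using S1 by (intro prod_Var_vars) (auto simp: del.bergman_simps)
    qed
    then show ?thesis using 2(1) G fin by (simp add: prod.remove ac_simps)
  qed
  then show ?thesis unfolding S(2) theta_prod_ray[OF S(1)] S1_def .
qed

lemma ray_vector_ray: "G \<in> N' \<Longrightarrow> ray_vector \<Delta> (ray G) = indicator (cl G)"
  "ray_vector \<Delta> (ray {}) = indicator {i}"
  by (simp_all add: deletion_fan_def Inter_ray) (simp add: ray_empty)

lemma sum_rays: "(\<Sum>\<rho>\<in>rays \<Delta>. f \<rho>) = f (ray {}) + (\<Sum>G\<in>N'. f (ray G))"
proof -
  have "(\<Sum>\<rho>\<in>rays \<Delta>. f \<rho>) = (\<Sum>G\<in>insert {} N'. f (ray G))"
    unfolding rays_deletion_fan using sum.reindex[OF inj_on_ray, of f] by simp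
  moreover have "{} \<notin> N'" by (simp add: del.N_iff)
  ultimately show ?thesis using del.finite_N by simp
qed

lemma indicator_closure:
  "G \<in> L' \<Longrightarrow> indicator (cl G) = (\<lambda>a. indicator G a + (if G \<in> L then 0 else 1) * indicator {i} a :: real)"
  using closure_deletion_flat(2)[of G] in_closure_iff[of G] deletion_flat_subset[of G]
  by (auto simp: fun_eq_iff indicator_def)

lemma theta_linear:
  assumes l: "l \<in> global_linear E"
  shows "theta (\<Sum>\<rho>\<in>rays \<Delta>. Const (l (ray_vector \<Delta> \<rho>)) * Var \<rho>) \<in> chow_ideal B"
proof -
  define k where "k = l (indicator {i})"
  \<comment> \<open>This is \<open>l\<close> minus \<open>k\<close> times the difference of the
    coordinates at \<open>i\<close> and \<open>base\<close>. It no longer sees the coordinate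
    \<open>i\<close>, hence is a linear function for the deletion.\<close>
  define l2 where "l2 u = l (\<lambda>a. indicator (E - {i}) a * u a) + k * u base" for u
  have "l2 \<in> global_linear (E - {i})"
    unfolding global_linear_def
  proof (intro CollectI conjI allI)
    fix u v :: "'a \<Rightarrow> real" and c :: real
    show "l2 (\<lambda>a. u a + v a) = l2 u + l2 v"
      using global_linear_add[OF l, of "\<lambda>a. indicator (E - {i}) a * u a" "\<lambda>a. indicator (E - {i}) a * v a"]
      by (simp add: l2_def algebra_simps)
    show "l2 (\<lambda>a. c * u a) = c * l2 u"
      using global_linear_scale[OF l, of c "\<lambda>a. indicator (E - {i}) a * u a"]
      by (simp add: l2_def algebra_simps)
    have "(\<lambda>a. indicator (E - {i}) a * indicator (E - {i}) a + indicator {i} a) = (indicator E :: 'a \<Rightarrow> real)"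
      using deleted_in by (auto simp: fun_eq_iff indicator_def)
    then show "l2 (indicator (E - {i})) = 0"
      using global_linear_add[OF l, of "\<lambda>a. indicator (E - {i}) a * indicator (E - {i}) a" "indicator {i}"]
        global_linear_ground[OF l] base
      by (simp add: l2_def k_def)
  qed
  then have mem: "(\<Sum>H\<in>N'. Const (l2 (indicator H)) * Var H) \<in> chow_ideal B"
    by (rule bergman_linear_relation)
  have coeff: "l (indicator (cl H)) + k * lift_coeff base H = l2 (indicator H)" if H: "H \<in> N'" for H
  proof -
    have H': "H \<in> L'" using H by (simp add: del.N_iff)
    have "(\<lambda>a. indicator (E - {i}) a * indicator H a) = (indicator H :: 'a \<Rightarrow> real)"
      using deletion_flat_subset[OF H'] by (auto simp: fun_eq_iff indicator_def)
    moreover have "l (indicator (cl H)) = l (indicator H) + (if H \<in> L then 0 else 1) * k"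
      unfolding indicator_closure[OF H'] k_def global_linear_add[OF l, of "indicator H"]
        global_linear_scale[OF l] ..
    ultimately show ?thesis by (simp add: l2_def lift_coeff_def algebra_simps)
  qed
  have "theta (\<Sum>\<rho>\<in>rays \<Delta>. Const (l (ray_vector \<Delta> \<rho>)) * Var \<rho>) =
      (\<Sum>\<rho>\<in>rays \<Delta>. Const (l (ray_vector \<Delta> \<rho>)) * theta_ray \<rho>)"
    by (simp add: poly_subst_sum poly_subst_mult)
  also have "\<dots> = Const k * lift base + (\<Sum>H\<in>N'. Const (l (indicator (cl H))) * Var H)"
    unfolding sum_rays by (simp add: ray_vector_ray k_def)
  also have "\<dots> = (\<Sum>H\<in>N'. Const (l (indicator (cl H)) + k * lift_coeff base H) * Var H)"
    unfolding lift_def Const_add Const_mult distrib_right sum.distrib sum_distrib_left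
    by (simp add: ac_simps)
  also have "\<dots> = (\<Sum>H\<in>N'. Const (l2 (indicator H)) * Var H)"
    by (rule sum.cong) (simp_all add: coeff)
  finally show ?thesis using mem by simp
qed

lemma theta_chow_ideal:
  assumes "p \<in> chow_ideal \<Delta>"
  shows "theta p \<in> chow_ideal B"
proof -
  define J where "J = {p. poly_vars p \<subseteq> rays \<Delta> \<and> theta p \<in> chow_ideal B}"
  have "chow_ideal \<Delta> \<subseteq> J"
  proof (rule chow_ideal_minimal)
    fix p q assume "p \<in> J" "q \<in> J"
    then show "p + q \<in> J"
      using order_trans[OF poly_vars_add, of p q] by (simp add: J_def poly_subst_add chow_ideal_add)
  next
    fix p q assume "p \<in> J" "poly_vars q \<subseteq> rays \<Delta>"
    then show "q * p \<in> J"
      using order_trans[OF poly_vars_mult, of q p] theta_vars[of q]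
      by (simp add: J_def poly_subst_mult chow_ideal_mult del.bergman_simps)
  next
    have "theta p \<in> chow_ideal B" if "p \<in> stanley_reisner_relations \<Delta>" for p
      using that theta_stanley_reisner by (auto simp: stanley_reisner_relations_def)
    moreover have "theta p \<in> chow_ideal B" if "p \<in> linear_relations \<Delta>" for p
      using that theta_linear by (auto simp: linear_relations_def deletion_fan_def)
    ultimately show "stanley_reisner_relations \<Delta> \<union> linear_relations \<Delta> \<subseteq> J"
      using chow_generators_subset[of \<Delta>] by (auto simp: J_def subset_iff)
  qed (auto simp: J_def)
  then show ?thesis using assms by (auto simp: J_def)
qed

text \<open>Cones without the ray of \<open>{i}\<close> are exactly chains of the deletion, so
  nonfaces go to nonfaces; deleting the ray of \<open>{i}\<close> from a cone leaves such a
  chain.\<close>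

lemma psi_chow_ideal:
  assumes "p \<in> chow_ideal B"
  shows "psi p \<in> chow_ideal \<Delta>"
proof -
  define J where "J = {p. poly_vars p \<subseteq> N' \<and> psi p \<in> chow_ideal \<Delta>}"
  have "chow_ideal B \<subseteq> J"
  proof (rule chow_ideal_minimal)
    fix p q assume "p \<in> J" "q \<in> J"
    then show "p + q \<in> J"
      using order_trans[OF poly_vars_add, of p q] by (simp add: J_def poly_subst_add chow_ideal_add)
  next
    fix p q assume "p \<in> J" "poly_vars q \<subseteq> rays B"
    then show "q * p \<in> J"
      using order_trans[OF poly_vars_mult, of q p] psi_vars[of q]
      by (simp add: J_def poly_subst_mult chow_ideal_mult del.bergman_simps)
  next
    have "psi p \<in> chow_ideal \<Delta>" if p: "p \<in> stanley_reisner_relations B" for p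
    proof -
      obtain A where A: "finite A" "A \<subseteq> N'" "\<not> (\<exists>\<sigma>\<in>chains N'. A \<subseteq> \<sigma>)" "p = (\<Prod>G\<in>A. Var G)"
        using p by (auto simp: stanley_reisner_relations_def del.bergman_simps)
      have A': "A \<subseteq> insert {} N'" using A(2) by blast
      have "\<not> (\<exists>\<sigma>\<in>cones \<Delta>. ray ` A \<subseteq> \<sigma>)"
      proof
        assume "\<exists>\<sigma>\<in>cones \<Delta>. ray ` A \<subseteq> \<sigma>"
        then obtain S where S: "S \<subseteq> insert {} N'" "ray ` S \<in> cones \<Delta>" "ray ` A \<subseteq> ray ` S"
          using cone_subset_rays by metis
        have "A \<subseteq> S"
        proof
          fix G assume G: "G \<in> A"
          then obtain H where "H \<in> S" "ray G = ray H" using S(3) by blast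
          then show "G \<in> S" using ray_eq_iff[of G H] A' G by blast
        qed
        moreover have "{} \<notin> A" using A(2) by (auto simp: del.N_iff)
        moreover have "S - {{}} \<in> chains N'" using ray_image_cone_iff[OF S(1)] S(2) by simp
        ultimately show False using A(3) subset_Diff_insert[of A S "{}" "{}"] by auto
      qed
      moreover have "ray ` A \<subseteq> rays \<Delta>" using A' by (auto simp: rays_deletion_fan)
      ultimately have "(\<Prod>\<rho>\<in>ray ` A. Var \<rho>) \<in> chow_ideal \<Delta>"
        using A(1) by (intro chow_ideal_generator) (auto simp: stanley_reisner_relations_def)
      then show ?thesis using A(4) by (simp add: poly_subst_prod prod_ray_image[OF A'])
    qed
    moreover have "psi p \<in> chow_ideal \<Delta>" if p: "p \<in> linear_relations B" for p
    proof -
      obtain l where l: "l \<in> global_linear (E - {i})" "p = (\<Sum>G\<in>N'. Const (l (indicator G)) * Var G)"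
        using p by (auto simp: linear_relations_def del.bergman_simps)
      \<comment> \<open>Extending \<open>l\<close> by ignoring the coordinate \<open>i\<close> makes
        it 0 on the ray of \<open>{i}\<close> and gives \<open>cl G\<close> the value of
        \<open>G\<close>.\<close>
      define k where "k u = l (\<lambda>a. indicator (E - {i}) a * u a)" for u
      have res: "(\<lambda>a. indicator (E - {i}) a * indicator X a) = (indicator (X - {i}) :: 'a \<Rightarrow> real)"
        if "X \<subseteq> E" for X using that by (auto simp: fun_eq_iff indicator_def)
      have k_ind: "k (indicator X) = l (indicator (X - {i}))" if "X \<subseteq> E" for X
        unfolding k_def res[OF that] ..
      have "k \<in> global_linear E"
        unfolding global_linear_def
      proof (intro CollectI conjI allI)
        fix u v :: "'a \<Rightarrow> real" and c :: real
        show "k (\<lambda>a. u a + v a) = k u + k v"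
          using global_linear_add[OF l(1), of "\<lambda>a. indicator (E - {i}) a * u a" "\<lambda>a. indicator (E - {i}) a * v a"]
          by (simp add: k_def algebra_simps)
        show "k (\<lambda>a. c * u a) = c * k u"
          using global_linear_scale[OF l(1), of c "\<lambda>a. indicator (E - {i}) a * u a"]
          by (simp add: k_def algebra_simps)
        show "k (indicator E) = 0" using k_ind[of E] global_linear_ground[OF l(1)] by simp
      qed
      then have "(\<Sum>\<rho>\<in>rays \<Delta>. Const (k (ray_vector \<Delta> \<rho>)) * Var \<rho>) \<in> chow_ideal \<Delta>"
        by (intro chow_ideal_generator) (auto simp: linear_relations_def deletion_fan_def)
      also have "(\<Sum>\<rho>\<in>rays \<Delta>. Const (k (ray_vector \<Delta> \<rho>)) * Var \<rho>) =
          (\<Sum>G\<in>N'. Const (k (indicator (cl G))) * Var (ray G))"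
        using k_ind[of "{i}"] deleted_in global_linear_empty[OF l(1)]
        unfolding sum_rays by (simp add: ray_vector_ray)
      also have "\<dots> = (\<Sum>G\<in>N'. Const (l (indicator G)) * Var (ray G))"
      proof (rule sum.cong[OF refl])
        fix G assume "G \<in> N'"
        then have "G \<in> L'" by (simp add: del.N_iff)
        note clG = closure_deletion_flat(1,2)[OF this]
        show "Const (k (indicator (cl G))) * Var (ray G) = Const (l (indicator G)) * Var (ray G)"
          by (simp only: k_ind[OF flats_subset[OF clG(1)]] clG(2))
      qed
      finally show ?thesis by (simp add: l(2) poly_subst_sum poly_subst_mult)
    qed
    ultimately show "stanley_reisner_relations B \<union> linear_relations B \<subseteq> J"
      using chow_generators_subset[of B] by (auto simp: J_def subset_iff del.bergman_simps)
  qed (auto simp: J_def del.bergman_simps)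
  then show ?thesis using assms by (auto simp: J_def)
qed

section \<open>Degrees of the maximal cones\<close>

lemma degree_chain: "S \<in> chains N' \<Longrightarrow> card S = d \<Longrightarrow> degree (\<Prod>G\<in>S. Var G) = 1"
  using del.bergman.deg_cone[of S] by (simp add: del.bergman_simps del.bergman_weight_def)

lemma degree_not_chain: "finite S \<Longrightarrow> S \<notin> chains N' \<Longrightarrow> degree (\<Prod>G\<in>S. Var G) = 0"
  using del.bergman.deg_not_cone[of S] by (simp add: del.bergman_simps)

text \<open>The three additional members are \<open>{}\<close>, \<open>{i}\<close> and
  \<open>E\<close>; the last two are the images of the trivial flats of the deletion.\<close>

lemma insert_chain:
  assumes S: "S \<in> chains N'" and ins: "\<And>G. G \<in> S \<Longrightarrow> insert i G \<in> L"
  defines "C \<equiv> insert {} (insert i ` insert {} (insert (E - {i}) S))"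
  shows "C \<in> chains L" "card C = card S + 3"
proof -
  let ?S = "insert {} (insert (E - {i}) S)"
  have S': "?S \<in> chains L'" by (rule del.extend_chain[OF S])
  have sub: "insert i G \<in> L" "i \<notin> G" if "G \<in> ?S" for G
    using that ins singleton_flat ground_flat deleted_in deletion_flat_subset chainsD2[OF S']
    by (auto simp: insert_absorb)
  have "insert i ` ?S \<in> chains L" by (rule chains_image[OF S' sub(1)]) auto
  then show "C \<in> chains L" unfolding C_def chains_insert using empty_flat by simp
  have "inj_on (insert i) ?S" using sub(2) by (intro inj_onI) (metis insert_ident)
  then have "card (insert i ` ?S) = card S + 2"
    using del.card_extend_chain[OF S] by (simp only: card_image)
  moreover have "finite (insert i ` ?S)"
    using finite_subset[OF chainsD2[OF S'] finite_deletion_flats] by (rule finite_imageI)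
  moreover have "{} \<notin> insert i ` ?S" by blast
  ultimately show "card C = card S + 3" 
    unfolding C_def using card_insert_disjoint[of "insert i ` ?S" "{}"] by linarith
qed

lemma compatible_chain_card:
  assumes S: "S \<in> chains N'" and ins: "\<And>G. G \<in> S \<Longrightarrow> insert i G \<in> L"
  shows "card S + 1 \<le> d"
  using chain_card_le[OF insert_chain(1)[OF S ins]] insert_chain(2)[OF S ins] by linarith

text \<open>The chain of sets \<open>insert i G\<close> with \<open>{}\<close> added is inextensible
  among the flats of \<open>M\<close>: a further nontrivial flat is comparable to
  \<open>{i}\<close>, so it contains \<open>i\<close>, and removing \<open>i\<close> gives a
  compatible extension of \<open>S\<close>.\<close>

lemma maximal_compatible_chain_card:
  assumes S: "S \<in> chains N'" and ins: "\<And>G. G \<in> S \<Longrightarrow> insert i G \<in> L"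
    and max: "\<And>G. G \<in> N' \<Longrightarrow> insert i G \<in> L \<Longrightarrow> insert G S \<in> chains N' \<Longrightarrow> G \<in> S"
  shows "card S + 1 = d"
proof -
  let ?S = "insert {} (insert (E - {i}) S)"
  have "card (insert {} (insert i ` ?S)) = d + 2"
  proof (rule maximal_chain_card)
    show "insert {} (insert i ` ?S) \<in> chains L" by (rule insert_chain[OF S ins])
    fix G assume G: "G \<in> L" "\<And>X. X \<in> insert {} (insert i ` ?S) \<Longrightarrow> X \<subseteq> G \<or> G \<subseteq> X"
    show "G \<in> insert {} (insert i ` ?S)"
    proof (cases "G = {} \<or> G = {i} \<or> G = E")
      case True
      then show ?thesis using deleted_in by (auto simp: insert_absorb)
    next
      case False
      have "{i} \<subseteq> G \<or> G \<subseteq> {i}" using G(2)[of "{i}"] by simp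
      then have iG: "i \<in> G" using False by auto
      have ins_G: "insert i (G - {i}) = G" using iG by blast
      have G': "G - {i} \<in> N'"
        using False iG deletion_flatI[OF G(1)] deleted_in unfolding del.N_iff by blast
      have "X \<subseteq> G - {i} \<or> G - {i} \<subseteq> X" if X: "X \<in> S" for X
      proof -
        have "X \<in> L'" using chainsD2[OF S] X by (auto simp: del.N_iff)
        then have "i \<notin> X" using deletion_flat_subset by blast
        moreover have "insert i X \<subseteq> G \<or> G \<subseteq> insert i X" using G(2)[of "insert i X"] X by simp
        ultimately show ?thesis by blast
      qed
      then have "insert (G - {i}) S \<in> chains N'" using S G' by (simp add: chains_insert)
      then have "G - {i} \<in> S" using max[OF G'] G(1) ins_G by simp
      then show ?thesis using ins_G by (metis imageI insertCI)
    qed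
  qed
  then show ?thesis using insert_chain(2)[OF S ins] by linarith
qed

text \<open>In the chain \<open>S\<close> with \<open>{}\<close> and \<open>E - {i}\<close> added, \<open>A\<close> is the last flat of \<open>L\<close> and \<open>B'\<close> its
  successor. For \<open>a \<in> B' - A\<close>, exactly one of the flats completing the chain has coefficient \<open>1\<close> in
  \<open>lift a\<close>, the others having coefficient \<open>0\<close>.\<close>

lemma degree_lift:
  assumes S: "S \<in> chains N'" and ins: "\<And>G. G \<in> S \<Longrightarrow> insert i G \<in> L"
    and max: "\<And>G. G \<in> N' \<Longrightarrow> insert i G \<in> L \<Longrightarrow> insert G S \<in> chains N' \<Longrightarrow> G \<in> S"
  shows "degree (lift base * (\<Prod>G\<in>S. Var G)) = 1"
proof -
  let ?S = "insert {} (insert (E - {i}) S)"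
  have card: "card S + 1 = d" by (rule maximal_compatible_chain_card[OF S ins max])
  have S': "?S \<in> chains L'" by (rule del.extend_chain[OF S])
  have finS: "finite ?S" using finite_subset[OF chainsD2[OF S'] finite_deletion_flats] .
  have SL': "G \<in> L'" if "G \<in> ?S" for G using that chainsD2[OF S'] by blast
  have ins': "insert i G \<in> L" if "G \<in> ?S" for G
    using that ins singleton_flat ground_flat deleted_in by (auto simp: insert_absorb)
  define A where "A = \<Union>{G\<in>?S. G \<in> L}"
  define B' where "B' = \<Inter>{G\<in>?S. G \<notin> L}"
  \<comment> \<open>Neither family is empty: \<open>{}\<close> is a flat of \<open>M\<close> and
    \<open>E - {i}\<close> is not.\<close>
  have "A \<in> {G\<in>?S. G \<in> L}" unfolding A_def
    using finS empty_flat by (intro finite_chain_Union[OF _ _ chains_subset[OF S']]) auto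
  then have A: "A \<in> ?S" "A \<in> L" by auto
  have "B' \<in> {G\<in>?S. G \<notin> L}" unfolding B'_def
    using finS deletion_ground_not_flat by (intro finite_chain_Inter[OF _ _ chains_subset[OF S']]) auto
  then have B: "B' \<in> ?S" "B' \<notin> L" by auto
  have le_A: "G \<subseteq> A" if "G \<in> ?S" "G \<in> L" for G using that unfolding A_def by blast
  have B_le: "B' \<subseteq> G" if "G \<in> ?S" "G \<notin> L" for G using that unfolding B'_def by blast
  note A' = SL'[OF A(1)] and B'' = SL'[OF B(1)]
  have iA: "i \<notin> A" using deletion_flat_subset[OF A'] by blast
  have icl: "i \<in> cl B'" using in_closure_iff[OF B''] B(2) by simp
  have "\<not> B' \<subseteq> A" using closure_least[OF A(2), of B'] icl iA by blast
  then have AB: "A \<subset> B'" using chainsD[OF S' A(1) B(1)] by blast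
  then obtain a where a: "a \<in> B'" "a \<notin> A" by blast
  have aE: "a \<in> E - {i}" using a deletion_flat_subset[OF B''] by blast
  define H0 where "H0 = flat_closure L' (insert a A)"
  have H0: "H0 \<in> L'" unfolding H0_def
    using aE deletion_flat_subset[OF A'] by (intro del.closure_flat) auto
  have H0_least: "H0 \<subseteq> H" if "H \<in> L'" "A \<subseteq> H" "a \<in> H" for H
    unfolding H0_def using that by (intro del.closure_least) auto
  have AH0: "A \<subset> H0" "a \<in> H0"
    using del.closure_superset[of "insert a A"] a by (auto simp: H0_def)
  \<comment> \<open>If they were equal, \<open>i\<close> would lie in the closure of
    \<open>insert a A\<close>. By exchange \<open>a\<close> would then lie in the closure of
    \<open>insert i A\<close>, which is a flat and does not contain \<open>a\<close>.\<close>
  have "H0 \<noteq> B'"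
  proof
    assume eq: "H0 = B'"
    let ?K = "cl (insert a A)"
    have K: "?K \<in> L" using aE flats_subset[OF A(2)] by (intro closure_flat) auto
    have "H0 \<subseteq> ?K - {i}"
      using closure_superset[of "insert a A"] iA aE by (intro H0_least deletion_flatI[OF K]) auto
    then have "i \<in> ?K" using closure_least[OF K, of B'] icl eq by blast
    then have "cl (insert i A) = ?K"
      using A(2) a aE iA by (intro closure_insert_eq) auto
    then have "a \<in> insert i A"
      using closure_of_flat[OF ins'[OF A(1)]] closure_superset[of "insert a A"] by auto
    then show False using a aE by blast
  qed
  then have H0B: "H0 \<subset> B'" using H0_least[OF B''] AB a by blast
  have H0_N: "H0 \<in> N'"
    using H0 AH0(2) H0B deletion_flat_subset[OF B''] unfolding del.N_iff by blast
  have H0_S: "H0 \<notin> S"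
  proof
    assume "H0 \<in> S"
    then have "H0 \<subseteq> A \<or> B' \<subseteq> H0" using le_A[of H0] B_le[of H0] by blast
    then show False using AH0 H0B by blast
  qed
  have H0_chain: "insert H0 S \<in> chains N'"
  proof -
    have "F \<subseteq> H0 \<or> H0 \<subseteq> F" if "F \<in> S" for F
      using that le_A[of F] B_le[of F] AH0(1) H0B by blast
    then show ?thesis using S H0_N by (simp add: chains_insert)
  qed
  \<comment> \<open>If \<open>H\<close> were not a flat of \<open>M\<close>, then
    \<open>insert i H\<close> would be one, and maximality of \<open>S\<close> would already contain
    \<open>H\<close>.\<close>
  have in_L: "H \<in> L" if "H \<in> N'" "H \<notin> S" "insert H S \<in> chains N'" for H
    using max[OF that(1) _ that(3)] that(1,2) not_flat_insert[of H] unfolding del.N_iff by blast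
  define X where "X = {H\<in>N' - S. insert H S \<in> chains N'}"
  \<comment> \<open>The coefficient is \<open>0 - 0\<close> for members inside \<open>A\<close> and
    \<open>1 - 1\<close> for members containing \<open>B'\<close>, so no square of a variable has to
    be evaluated.\<close>
  have coeff_S: "lift_coeff a H = 0" if "H \<in> S" for H
    using that le_A[of H] B_le[of H] a by (cases "H \<in> L") (auto simp: lift_coeff_def indicator_def)
  have coeff_X: "lift_coeff a H = (if H = H0 then 1 else 0)" if H: "H \<in> X" for H
  proof -
    have HX: "H \<in> N' - S" "insert H S \<in> chains N'" using H by (auto simp: X_def)
    have HL: "H \<in> L" using in_L HX by blast
    show ?thesis
    proof (cases "H = H0")
      case True
      then show ?thesis using AH0(2) HL by (simp add: lift_coeff_def)
    next
      case False
      \<comment> \<open>Distinct completions of \<open>S\<close> are incomparable. If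
        \<open>a\<close> were in \<open>H\<close>, then \<open>H\<close> would contain
        \<open>H0\<close>, or else \<open>H\<close> would lie in \<open>A\<close> and so in
        \<open>H0\<close>.\<close>
      have "\<not> H0 \<subseteq> H"
        using del.chain_extensions_incomparable[OF S card, of H0 H] H0_N H0_S H0_chain HX False by blast
      moreover have "\<not> H \<subseteq> H0"
        using del.chain_extensions_incomparable[OF S card, of H H0] H0_N H0_S H0_chain HX False by blast
      moreover have "A \<subseteq> H \<or> H \<subseteq> A"
        using chainsD[OF del.extend_chain[OF HX(2)], of A H] A(1) by auto
      moreover have "H \<in> L'" using HX(1) by (simp add: del.N_iff)
      ultimately have "a \<notin> H" using H0_least[of H] AH0(1) by blast
      then show ?thesis using False HL by (simp add: lift_coeff_def)
    qed
  qed
  let ?P = "(\<Prod>G\<in>S. Var G) :: 'a set poly"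
  have finS': "finite S" using finS by simp
  have term_eq: "lift_coeff a H * degree (Var H * ?P) = (if H = H0 then 1 else 0)" if H: "H \<in> N'" for H
  proof (cases "H \<in> S")
    case True
    then show ?thesis using coeff_S H0_S by auto
  next
    case False
    then have prod: "Var H * ?P = (\<Prod>G\<in>insert H S. Var G)" using finS' by simp
    show ?thesis
    proof (cases "insert H S \<in> chains N'")
      case True
      then have "degree (Var H * ?P) = 1"
        unfolding prod using False finS' card by (intro degree_chain) auto
      moreover have "H \<in> X" using True False H by (simp add: X_def)
      ultimately show ?thesis using coeff_X by simp
    next
      case F: False
      then have "degree (Var H * ?P) = 0" unfolding prod using finS' by (intro degree_not_chain) auto
      then show ?thesis using F H0_chain by auto
    qed
  qed
  have "degree (lift a * ?P) = (\<Sum>H\<in>N'. lift_coeff a H * degree (Var H * ?P))"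
    unfolding lift_def sum_distrib_right lin_ext_sum mult.assoc lin_ext_Const_times ..
  also have "\<dots> = (\<Sum>H\<in>N'. if H = H0 then 1 else 0)" by (rule sum.cong[OF refl]) (rule term_eq)
  also have "\<dots> = 1" using H0_N del.finite_N by simp
  finally have 1: "degree (lift a * ?P) = 1" .
  have "?P * (lift base - lift a) \<in> chow_ideal B"
    using lift_diff[OF base aE] chainsD2[OF S]
    by (intro chow_ideal_mult prod_Var_vars) (auto simp: del.bergman_simps)
  then have "degree (?P * (lift base - lift a)) = 0" by (rule degree_chow_ideal)
  moreover have "lift base * ?P = lift a * ?P + ?P * (lift base - lift a)" by (simp add: algebra_simps)
  ultimately show ?thesis using 1 by (simp add: lin_ext_add)
qed

lemma maximal_cone_deletion:
  assumes "\<sigma> \<in> maximal_cones \<Delta>"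
  shows "\<sigma> \<subseteq> rays \<Delta>" "card \<sigma> = d" "degree (theta (\<Prod>\<rho>\<in>\<sigma>. Var \<rho>)) = 1"
proof -
  have "\<sigma> \<in> cones \<Delta>" using assms by (simp add: maximal_cones_def)
  then obtain S where S: "S \<subseteq> insert {} N'" "\<sigma> = ray ` S" by (rule cone_subset_rays)
  show "\<sigma> \<subseteq> rays \<Delta>" using S by (auto simp: rays_deletion_fan)
  have fin: "finite S" using finite_subset[OF S(1)] del.finite_N by simp
  have card: "card \<sigma> = card S" unfolding S(2) by (rule card_image, rule inj_on_subset[OF inj_on_ray S(1)])
  have cone: "S - {{}} \<in> chains N'" "{} \<in> S \<Longrightarrow> G \<in> S \<Longrightarrow> insert i G \<in> L" for G
    using ray_image_cone_iff[OF S(1)] \<open>\<sigma> \<in> cones \<Delta>\<close> S(2) by auto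
  have max: "G \<in> S" if G: "G \<in> N'" "insert G (S - {{}}) \<in> chains N'" "{} \<in> S \<longrightarrow> insert i G \<in> L" for G
  proof (rule ccontr)
    assume "G \<notin> S"
    have GS: "insert G S \<subseteq> insert {} N'" using S(1) G(1) by blast
    have "insert G S - {{}} = insert G (S - {{}})" using G(1) by (auto simp: del.N_iff)
    then have "ray ` insert G S \<in> cones \<Delta>"
      unfolding ray_image_cone_iff[OF GS] using G cone(2) by (auto simp: del.N_iff)
    moreover have "ray G \<notin> ray ` S"
    proof
      assume "ray G \<in> ray ` S"
      then obtain H where "ray G = ray H" "H \<in> S" by (rule imageE)
      then show False using ray_eq_iff[of G H] G(1) \<open>G \<notin> S\<close> by simp
    qed
    then have "\<sigma> \<subset> ray ` insert G S" unfolding S(2) by blast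
    ultimately show False using assms by (auto simp: maximal_cones_def)
  qed
  show "card \<sigma> = d" and "degree (theta (\<Prod>\<rho>\<in>\<sigma>. Var \<rho>)) = 1"
  proof (atomize (full), cases "{} \<in> S")
    case True
    have *: "G \<in> S - {{}}" if "G \<in> N'" "insert i G \<in> L" "insert G (S - {{}}) \<in> chains N'" for G
      using max[OF that(1,3)] that by (auto simp: del.N_iff)
    have ins: "insert i G \<in> L" if "G \<in> S - {{}}" for G using cone(2)[OF True, of G] that by blast
    have "card (S - {{}}) + 1 = d"
      by (rule maximal_compatible_chain_card[OF cone(1) ins *])
    then have "card S = d" using True fin card_Suc_Diff1[OF fin True] by simp
    moreover have "degree (lift base * (\<Prod>G\<in>S - {{}}. Var G)) = 1"
      by (rule degree_lift[OF cone(1) ins *])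
    ultimately show "card \<sigma> = d \<and> degree (theta (\<Prod>\<rho>\<in>\<sigma>. Var \<rho>)) = 1"
      unfolding card unfolding S(2) theta_prod_ray[OF S(1)] using True by simp
  next
    case False
    then have S1: "S - {{}} = S" by blast
    have SN: "S \<in> chains N'" using cone(1) S1 by simp
    have "card S = d"
    proof (rule ccontr)
      assume "card S \<noteq> d"
      with SN obtain G where "G \<in> N' - S" "insert G S \<in> chains N'" by (rule del.chain_extension_exists)
      then show False using max[of G] False S1 by simp
    qed
    then show "card \<sigma> = d \<and> degree (theta (\<Prod>\<rho>\<in>\<sigma>. Var \<rho>)) = 1"
      unfolding card unfolding S(2) theta_prod_ray[OF S(1)] S1 using False degree_chain[OF SN] by simp
  qed
qed

text \<open>Only the ray of \<open>{i}\<close> could enlarge a chain of \<open>d\<close> flats, but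
  chains compatible with it have at most \<open>d - 1\<close> members.\<close>

lemma chain_maximal_cone:
  assumes S: "S \<in> chains N'" "card S = d"
  shows "ray ` S \<in> maximal_cones \<Delta>"
  unfolding maximal_cones_def
proof (intro CollectI conjI notI)
  have SN: "S \<subseteq> N'" by (rule chainsD2[OF S(1)])
  have S0: "S \<subseteq> insert {} N'" "{} \<notin> S" using SN by (auto simp: del.N_iff)
  then show "ray ` S \<in> cones \<Delta>" using ray_image_cone_iff[OF S0(1)] S(1) by simp
  assume "\<exists>\<tau>\<in>cones \<Delta>. ray ` S \<subset> \<tau>"
  then obtain \<tau> where \<tau>: "\<tau> \<in> cones \<Delta>" "ray ` S \<subset> \<tau>" by blast
  obtain T where T: "T \<subseteq> insert {} N'" "\<tau> = ray ` T" using cone_subset_rays[OF \<tau>(1)] .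
  have cone: "T - {{}} \<in> chains N'" "{} \<in> T \<longrightarrow> (\<forall>G\<in>T. insert i G \<in> L)"
    using ray_image_cone_iff[OF T(1)] \<tau>(1) T(2) by auto
  have finT: "finite (T - {{}})" using finite_subset[OF chainsD2[OF cone(1)] del.finite_N] .
  have ST: "S \<subset> T"
  proof -
    have "G \<in> T" if G: "G \<in> S" for G
    proof -
      obtain H where "H \<in> T" "ray G = ray H" using \<tau>(2) T(2) G by blast
      then show ?thesis using ray_eq_iff[of G H] S0(1) G by blast
    qed
    moreover have "S \<noteq> T" using \<tau>(2) T(2) by blast
    ultimately show ?thesis by blast
  qed
  have sub: "S \<subseteq> T - {{}}" using ST S0(2) by blast
  have le: "card (T - {{}}) \<le> d" by (rule del.nontrivial_chain_card_le[OF cone(1)])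
  have eq: "S = T - {{}}"
    by (rule card_subset_eq[OF finT sub]) (use le S(2) card_mono[OF finT sub] in simp)
  then have "{} \<in> T" using ST by blast
  then have "insert i G \<in> L" if "G \<in> S" for G using cone(2) that sub by blast
  then have "card S + 1 \<le> d" by (rule compatible_chain_card[OF S(1)])
  then show False using S(2) by simp
qed

subsection \<open>The mixed volumes\<close>

lemma prod_Var_forms: "finite A \<Longrightarrow> A \<subseteq> rays D \<Longrightarrow> (\<Prod>\<rho>\<in>A. Var \<rho>) \<in> forms D (card A)"
  using prod_Var_vars[of A "rays D"]
  by (simp add: forms_iff homogeneous_mdeg prod_Var mdeg_mon_of_set)

lemma bergman_functional_exists:
  "\<exists>\<phi>. chow_functional B d (\<lambda>_. 1) \<phi> \<and> (\<forall>f\<in>forms B d. \<phi> (chow_class B f) = degree f)"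
proof (rule chow_functionalI)
  fix \<sigma> assume \<sigma>: "\<sigma> \<in> maximal_cones B"
  note \<sigma>' = del.bergman_maximal_cone[OF \<sigma>]
  have "(\<Prod>\<rho>\<in>\<sigma>. Var \<rho>) \<in> forms B (card \<sigma>)"
    using chainsD2[OF \<sigma>'(1)] finite_subset[OF chainsD2[OF \<sigma>'(1)] del.finite_N]
    by (intro prod_Var_forms) (auto simp: del.bergman_simps)
  then show "(\<Prod>\<rho>\<in>\<sigma>. Var \<rho>) \<in> forms B d \<and> degree (\<Prod>\<rho>\<in>\<sigma>. Var \<rho>) = 1"
    using degree_chain[OF \<sigma>'] \<sigma>'(2) by simp
qed (auto simp: lin_ext_add lin_ext_Const_times degree_chow_ideal)

lemma bergman_functional_unique:
  assumes "chow_functional B d (\<lambda>_. 1) \<phi>" "f \<in> forms B d"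
  shows "\<phi> (chow_class B f) = degree f"
  by (rule del.bergman.chow_functional_eq_deg[OF assms(1) _ assms(2)])
    (simp add: del.bergman_weight_def del.bergman_simps)

lemma matroid_volume_deletion:
  "matroid_volume (E - {i}) L' \<in> forms B d"
  "f \<in> forms B d \<Longrightarrow> diff_op f (matroid_volume (E - {i}) L') = Const (degree f)"
proof -
  obtain \<phi> where \<phi>: "chow_functional B d (\<lambda>_. 1) \<phi>" "\<forall>f\<in>forms B d. \<phi> (chow_class B f) = degree f"
    using bergman_functional_exists by blast
  obtain V where V: "V \<in> forms B d" "\<forall>f\<in>forms B d. diff_op f V = Const (\<phi> (chow_class B f))"
    using chow_functional_volume_exists[OF _ \<phi>(1)] del.finite_N by (auto simp: del.bergman_simps)
  have "mixed_volume B d (\<lambda>_. 1) = V"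
    by (rule mixed_volume_eqI[OF V(1) \<phi>(1)]) (use V(2) \<phi>(2) bergman_functional_unique in auto)
  then have eq: "matroid_volume (E - {i}) L' = V"
    using rank_deletion by (simp add: matroid_volume_def)
  show "matroid_volume (E - {i}) L' \<in> forms B d" using V(1) eq by simp
  show "f \<in> forms B d \<Longrightarrow> diff_op f (matroid_volume (E - {i}) L') = Const (degree f)"
    using V(2) \<phi>(2) eq by simp
qed

lemma homogeneous_linear_form: "homogeneous (Suc 0) (\<Sum>v\<in>R. Const (c v) * Var v)"
  by (intro homogeneous_sum homogeneous_Const_times homogeneous_Var)

lemma psi_forms: "f \<in> forms B d \<Longrightarrow> psi f \<in> forms \<Delta> d"
  using psi_vars[of f] homogeneous_subst[of d f "\<lambda>G. Var (ray G)"]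
  by (simp add: forms_iff del.bergman_simps)

lemma deletion_functional_exists:
  "\<exists>\<phi>. chow_functional \<Delta> d (\<lambda>_. 1) \<phi> \<and> (\<forall>f\<in>forms \<Delta> d. \<phi> (chow_class \<Delta> f) = degree (theta f))"
proof (rule chow_functionalI)
  fix \<sigma> assume "\<sigma> \<in> maximal_cones \<Delta>"
  note \<sigma> = maximal_cone_deletion[OF this]
  show "(\<Prod>\<rho>\<in>\<sigma>. Var \<rho>) \<in> forms \<Delta> d \<and> degree (theta (\<Prod>\<rho>\<in>\<sigma>. Var \<rho>)) = 1"
    using prod_Var_forms[OF finite_subset[OF \<sigma>(1) finite_rays_deletion] \<sigma>(1)] \<sigma>(2,3) by simp
qed (auto simp: poly_subst_add poly_subst_mult lin_ext_add lin_ext_Const_times theta_chow_ideal degree_chow_ideal)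

text \<open>Composing \<open>\<phi>\<close> with \<open>psi\<close> gives a functional of weight 1
  for the deletion, because \<open>psi\<close> preserves relations and maximal cones; the one such
  functional is \<open>degree\<close>.\<close>

lemma deletion_functional_psi:
  assumes \<phi>: "chow_functional \<Delta> d (\<lambda>_. 1) \<phi>" and g: "g \<in> forms B d"
  shows "\<phi> (chow_class \<Delta> (psi g)) = degree g"
proof -
  have "\<exists>\<phi>'. chow_functional B d (\<lambda>_. 1) \<phi>' \<and>
    (\<forall>f\<in>forms B d. \<phi>' (chow_class B f) = \<phi> (chow_class \<Delta> (psi f)))"
  proof (rule chow_functionalI)
    fix \<sigma> assume \<sigma>: "\<sigma> \<in> maximal_cones B"
    note \<sigma>' = del.bergman_maximal_cone[OF \<sigma>]
    have sub: "\<sigma> \<subseteq> N'" by (rule chainsD2[OF \<sigma>'(1)])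
    have "(\<Prod>\<rho>\<in>\<sigma>. Var \<rho>) \<in> forms B (card \<sigma>)"
      using sub finite_subset[OF sub del.finite_N]
      by (intro prod_Var_forms) (auto simp: del.bergman_simps)
    moreover have "psi (\<Prod>G\<in>\<sigma>. Var G) = (\<Prod>\<rho>\<in>ray ` \<sigma>. Var \<rho>)"
      using sub by (simp add: poly_subst_prod prod_ray_image subset_insertI2)
    ultimately show "(\<Prod>\<rho>\<in>\<sigma>. Var \<rho>) \<in> forms B d \<and> \<phi> (chow_class \<Delta> (psi (\<Prod>\<rho>\<in>\<sigma>. Var \<rho>))) = 1"
      using chow_functional_weight[OF \<phi> chain_maximal_cone[OF \<sigma>']] \<sigma>'(2) by simp
  next
    fix f g assume "f \<in> forms B d" "g \<in> forms B d"
    then show "\<phi> (chow_class \<Delta> (psi (f + g))) = \<phi> (chow_class \<Delta> (psi f)) + \<phi> (chow_class \<Delta> (psi g))"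
      unfolding poly_subst_add by (intro chow_functional_add[OF \<phi>] psi_forms)
  next
    fix c f assume "f \<in> forms B d"
    then show "\<phi> (chow_class \<Delta> (psi (Const c * f))) = c * \<phi> (chow_class \<Delta> (psi f))"
      unfolding poly_subst_mult poly_subst_Const by (intro chow_functional_scale[OF \<phi>] psi_forms)
  next
    fix f assume "f \<in> chow_ideal B"
    then show "\<phi> (chow_class \<Delta> (psi f)) = 0" by (intro chow_functional_0[OF \<phi>] psi_chow_ideal)
  qed
  then show ?thesis using bergman_functional_unique g by force
qed

text \<open>The transpose \<open>t\<close> of the substitution \<open>s\<close> sends
  \<open>ray G\<close> to \<open>G\<close> and the ray of \<open>{i}\<close> to the combination with
  coefficients \<open>b\<close>. Thus the given relation says that \<open>psi\<close> after
  \<open>t\<close> is the identity modulo the ideal, and the chain rule moves \<open>t\<close> from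
  operators to the volume as \<open>s\<close>.\<close>

lemma mixed_volume_deletion_fan:
  fixes b :: "'a set \<Rightarrow> real"
  assumes rel: "Var (ray {}) - (\<Sum>G\<in>N'. Const (b G) * Var (ray G)) \<in> chow_ideal \<Delta>"
  shows "mixed_volume \<Delta> d (\<lambda>_. 1) =
    poly_subst (\<lambda>G. Var (ray G) + Const (b G) * Var (ray {})) (matroid_volume (E - {i}) L')"
proof -
  define s where "s G = Var (ray G) + Const (b G) * Var (ray {})" for G
  \<comment> \<open>The coefficient of the variable \<open>\<rho>\<close> in the linear form
    \<open>s G\<close>.\<close>
  define c where "c \<rho> G = (if ray G = \<rho> then 1 else 0) + b G * (if ray {} = \<rho> then 1 else 0)" for \<rho> G
  define t where "t = (\<lambda>\<rho>. \<Sum>G\<in>N'. Const (c \<rho> G) * Var G)"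
  let ?V = "matroid_volume (E - {i}) L'"
  have V: "poly_vars ?V \<subseteq> N'" "homogeneous d ?V"
    using matroid_volume_deletion(1) by (auto simp: forms_iff del.bergman_simps)
  have t_vars: "poly_vars (t \<rho>) \<subseteq> N'" for \<rho>
    unfolding t_def by (intro poly_vars_sum order_trans[OF poly_vars_mult]) simp
  have t_forms: "poly_subst t f \<in> forms B d" if "f \<in> forms \<Delta> d" for f
    using that poly_vars_subst[of f t N'] t_vars homogeneous_subst[of d f t]
    by (simp add: forms_iff del.bergman_simps t_def homogeneous_linear_form)
  have "partial_deriv u (s v) = Const (c u v)" for u v
    by (simp add: s_def partial_deriv_add partial_deriv_mult partial_deriv_Var c_def Const_add Const_mult)
  then have diff: "diff_op f (poly_subst s ?V) = poly_subst s (diff_op (poly_subst t f) ?V)" for f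
    unfolding t_def using del.finite_N V(1) by (intro diff_op_subst)
  have psi_t: "psi (t \<rho>) = (if \<rho> = ray {} then \<Sum>G\<in>N'. Const (b G) * Var (ray G) else Var \<rho>)"
    if "\<rho> \<in> rays \<Delta>" for \<rho>
  proof -
    have psi_eq: "psi (t \<rho>) = (\<Sum>G\<in>N'. Const (c \<rho> G) * Var (ray G))"
      by (simp add: t_def poly_subst_sum poly_subst_mult)
    from that obtain H where H: "H \<in> insert {} N'" "\<rho> = ray H" unfolding rays_deletion_fan by (elim imageE)
    have ne: "ray G = ray H \<longleftrightarrow> G = H" if "G \<in> insert {} N'" for G by (rule ray_eq_iff[OF that])
    show ?thesis
    proof (cases "H = {}")
      case True
      have "c \<rho> G = b G" if "G \<in> N'" for G
        using that ne[of G] H True by (auto simp: c_def del.N_iff)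
      then show ?thesis unfolding psi_eq using H True by simp
    next
      case False
      have "c \<rho> G = (if G = H then 1 else 0)" if "G \<in> N'" for G
        using that ne[of G] ne[of "{}"] H False by (auto simp: c_def)
      then have "psi (t \<rho>) = (\<Sum>G\<in>N'. if G = H then Var (ray G) else 0)"
        unfolding psi_eq by (intro sum.cong) auto
      also have "\<dots> = Var \<rho>" using H False del.finite_N by simp
      finally show ?thesis using ne[of "{}"] H False by auto
    qed
  qed
  have rel_f: "f - psi (poly_subst t f) \<in> chow_ideal \<Delta>" if f: "poly_vars f \<subseteq> rays \<Delta>" for f
  proof -
    have "poly_subst Var f - poly_subst (\<lambda>\<rho>. psi (t \<rho>)) f \<in> chow_ideal \<Delta> \<and>
        poly_vars (poly_subst (\<lambda>\<rho>. psi (t \<rho>)) f) \<subseteq> rays \<Delta>"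
    proof (rule poly_subst_cong_chow_ideal[OF f])
      fix \<rho> assume \<rho>: "\<rho> \<in> rays \<Delta>"
      show "Var \<rho> - psi (t \<rho>) \<in> chow_ideal \<Delta>" using psi_t[OF \<rho>] rel by simp
      show "poly_vars (Var \<rho>) \<subseteq> rays \<Delta>" using \<rho> by simp
      show "poly_vars (psi (t \<rho>)) \<subseteq> rays \<Delta>" by (rule psi_vars[OF t_vars])
    qed
    then show ?thesis by (simp add: poly_subst_poly_subst)
  qed
  \<comment> \<open>This functional, built from \<open>theta\<close>, supplies existence; its values
    are computed through \<open>t\<close>, where the numbers \<open>b\<close> enter.\<close>
  obtain \<phi> where \<phi>: "chow_functional \<Delta> d (\<lambda>_. 1) \<phi>"
    using deletion_functional_exists by blast
  have \<phi>_eq: "\<phi>' (chow_class \<Delta> f) = degree (poly_subst t f)"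
    if "chow_functional \<Delta> d (\<lambda>_. 1) \<phi>'" "f \<in> forms \<Delta> d" for \<phi>' f
  proof -
    have "chow_class \<Delta> f = chow_class \<Delta> (psi (poly_subst t f))"
      using rel_f that(2) by (simp add: chow_class_eq_iff forms_iff)
    then show ?thesis using deletion_functional_psi[OF that(1) t_forms[OF that(2)]] by simp
  qed
  have "mixed_volume \<Delta> d (\<lambda>_. 1) = poly_subst s ?V"
  proof (rule mixed_volume_eqI[OF _ \<phi>])
    have "poly_vars (s G) \<subseteq> rays \<Delta>" if "G \<in> N'" for G
      unfolding s_def using that
      by (intro order_trans[OF poly_vars_add] Un_least order_trans[OF poly_vars_mult])
        (auto simp: rays_deletion_fan)
    moreover have "homogeneous (Suc 0) (s G)" for G
      unfolding s_def by (intro homogeneous_add homogeneous_Const_times homogeneous_Var)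
    ultimately show "poly_subst s ?V \<in> forms \<Delta> d"
      unfolding forms_iff using V by (intro conjI poly_vars_subst homogeneous_subst) auto
  next
    fix f assume f: "f \<in> forms \<Delta> d"
    show "diff_op f (poly_subst s ?V) = Const (\<phi> (chow_class \<Delta> f))"
      unfolding diff matroid_volume_deletion(2)[OF t_forms[OF f]] using \<phi>_eq[OF \<phi> f] by simp
  next
    fix \<phi>' f assume "chow_functional \<Delta> d (\<lambda>_. 1) \<phi>'" "f \<in> forms \<Delta> d"
    then show "\<phi>' (chow_class \<Delta> f) = \<phi> (chow_class \<Delta> f)" using \<phi>_eq \<phi> by metis
  qed
  then show ?thesis by (simp add: s_def[abs_def])
qed

end

theorem theorem1p7:
  fixes E :: "'a set" and L :: "'a set set" and i :: 'a and d :: nat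
    and b :: "'a set \<Rightarrow> real"
  assumes "matroid E L"
    and "{} \<in> L"
    and "matroid_rank L = d + 1"
    and "i \<in> E"
    and "{i} \<in> L"
    and "\<not> is_coloop L i"
    and "chow_class (deletion_fan E L i) (Var (flat_class E L i {i})) =
      chow_class (deletion_fan E L i)
        (\<Sum>G\<in>nontrivial_flats (E - {i}) (deletion_flats L i).
          Const (b (flat_closure L G)) * Var (closure_ray E L i G))"
  shows "mixed_volume (deletion_fan E L i) d (\<lambda>_. 1) =
    poly_subst
      (\<lambda>G. Var (closure_ray E L i G) +
        Const (b (flat_closure L G)) * Var (flat_class E L i {i}))
      (matroid_volume (E - {i}) (deletion_flats L i))"
proof -
  interpret matroid E L by fact
  interpret matroid_deletion E L d i by unfold_locales fact+
  have "Var (ray {}) - (\<Sum>G\<in>N'. Const (b (cl G)) * Var (ray G)) \<in> chow_ideal \<Delta>"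
    using assms(7) by (simp add: chow_class_eq_iff singleton_class_eq closure_ray_eq)
  then have "mixed_volume \<Delta> d (\<lambda>_. 1) =
    poly_subst (\<lambda>G. Var (ray G) + Const (b (cl G)) * Var (ray {})) (matroid_volume (E - {i}) L')"
    by (rule mixed_volume_deletion_fan)
  also have "\<dots> = poly_subst (\<lambda>G. Var (closure_ray E L i G) + Const (b (cl G)) * Var (flat_class E L i {i}))
      (matroid_volume (E - {i}) L')"
    \<comment> \<open>The rays \<open>closure_ray E L i G\<close> and \<open>ray G\<close> are known
      to agree for \<open>G\<close> in \<open>N'\<close>, and all variables of the volume lie
      there.\<close>
    by (rule poly_subst_cong)
      (use matroid_volume_deletion(1) in
        \<open>auto simp: forms_iff del.bergman_simps singleton_class_eq closure_ray_eq subset_iff\<close>)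
  finally show ?thesis .
qed

end
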